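(* Let $(T_\alpha,\hbar)$ be a $C^2$-convergent matrix regularization of $(\Sigma,\omega)$, let $\{\hat K_\alpha\}$ be a discrete curvature of $\Sigma$, and let $\{\hat u_\alpha\}$ be a $C^2$-convergent eigenmatrix sequence of the discrete Laplacian $\hat\Delta_\alpha$ with eigenvalues $\{-\lambda_\alpha\}$. If $\hat K_\alpha\ge\kappa\mathbf 1_{N_\alpha}$ for some $\kappa\in\mathbb R$ and all $\alpha>\alpha_0$, then $$\lim_{\alpha\to\infty}\lambda_\alpha\ge2\kappa.$$
   Context: $\Sigma$ is a compact surface without boundary embedded in Euclidean space $\mathbb R^m$ via embedding coordinates $x^1,\dots,x^m\in C^\infty(\Sigma)$, with induced metric $g_{ab}$, $g=\det(g_{ab})$. $\omega$ is a symplectic form on $\Sigma$, $\omega=\rho(u^1,u^2)\,du^1\wedge du^2$ locally (oriented so that $\rho>0$), with Poisson bracket $\{f,h\}=\frac1\rho\varepsilon^{ab}(\partial_af)(\partial_bh)$; $\gamma=\sqrt g/\rho$. Matrix regularization: let $N_1<N_2<\cdots$ be positive integers, $T_\alpha$ ($\alpha=1,2,\dots$) linear maps from $C^\infty(\Sigma,\mathbb R)$ to hermitian $N_\alpha\times N_\alpha$ matrices, $\hbar(N)$ a real-valued strictly positive decreasing function such that $\lim_{N\to\infty}N\hbar(N)<\infty$, and $\hbar_\alpha=\hbar(N_\alpha)$. Put $\partial^f(h)=\{h,f\}$, $\hat\partial^f_\alpha(X)=\frac1{i\hbar_\alpha}[X,T_\alpha(f)]$, $\partial^{f_1\cdots f_l}=\partial^{f_1}\cdots\partial^{f_l}$,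 $\hat\partial_\alpha^{f_1\cdots f_l}=\hat\partial_\alpha^{f_1}\cdots\hat\partial_\alpha^{f_l}$. $(T_\alpha,\hbar)$ is a $C^k$-convergent matrix regularization of $(\Sigma,\omega)$ if for all integers $1\le l\le k$ and all $f,h,f_1,\dots,f_l\in C^\infty(\Sigma)$: $\lim\|T_\alpha(f)\|<\infty$; $\lim\|T_\alpha(fh)-T_\alpha(f)T_\alpha(h)\|=0$; $\lim\|\hat\partial_\alpha^{f_1\cdots f_l}(T_\alpha(f))-T_\alpha(\partial^{f_1\cdots f_l}(f))\|=0$; $\lim2\pi\hbar_\alpha\operatorname{Tr}T_\alpha(f)=\int_\Sigma f\omega$ (limits as $\alpha\to\infty$, operator norm). A sequence $\{\hat f_\alpha\}$ of $N_\alpha\times N_\alpha$ matrices converges to $f\in C^\infty(\Sigma)$ if $\lim\|\hat f_\alpha-T_\alpha(f)\|=0$, and $C^k$-converges to $f$ if in addition $\lim\|\hat\partial_\alpha^{f_1\cdots f_l}(\hat f_\alpha)-T_\alpha(\partial^{f_1\cdots f_l}(f))\|=0$ for all $1\le l\le k$ and all $f_1,\dots,f_l$. Standing: $X_\alpha^i=T_\alpha(x^i)$; $\{\hat\gamma_\alpha\}$ is a $C^2$-convergent sequence converging to $\gamma$, and $\{\hat\gamma_\alpha^{-1}\}$ exists and converges to $1/\gamma$. A discrete curvature of $\Sigma$ is a matrix sequence $\{\hat K_\alpha\}$ converging to the Gaussian curvature of $\Sigma$; the inequality $\hat K_\alpha\ge\kappa\mathbf 1_{N_\alpha}$ is the usual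 operator inequality, $\mathbf 1_{N_\alpha}$ being the identity matrix. The discrete Laplacian is the sequence of linear maps on $N_\alpha\times N_\alpha$ matrices $$\hat\Delta_\alpha(X)=-\frac1{\hbar_\alpha^2}\sum_{j=1}^m\hat\gamma_\alpha^{-1}\big[\hat\gamma_\alpha^{-1}[X,X_\alpha^j],X_\alpha^j\big].$$ An eigenmatrix sequence of $\hat\Delta_\alpha$ with eigenvalues $\{\mu_\alpha\}$ is a convergent matrix sequence $\{\hat u_\alpha\}$ with $\hat\Delta_\alpha(\hat u_\alpha)=\mu_\alpha\hat u_\alpha$ for all $\alpha$ and such that $\lim_{\alpha\to\infty}\mu_\alpha$ exists; here $\mu_\alpha=-\lambda_\alpha$.
   Formalization: Assumed in addition: the limit function of the eigenmatrix sequence is not identically zero, and, if κ > 0, lim λ_α ≠ 0. Without these the claim fails (û_α = 0 with any λ_α; û_α = identity with λ_α = 0 on the round sphere). *)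

theory Defs
  imports
    "HOL-Analysis.Analysis"
    "Jordan_Normal_Form.Schur_Decomposition"
begin

no_notation vec_index (infixl "$" 100)

section \<open>Smooth maps on open subsets of the plane\<close>

definition pd :: "2 \<Rightarrow> (real^2 \<Rightarrow> 'b::real_normed_vector) \<Rightarrow> real^2 \<Rightarrow> 'b" where
  "pd a F u = frechet_derivative F (at u) (axis a 1)"

fun Ck_on :: "nat \<Rightarrow> (real^2) set \<Rightarrow> (real^2 \<Rightarrow> 'b::real_normed_vector) \<Rightarrow> bool" where
  "Ck_on 0 U F \<longleftrightarrow> continuous_on U F"
| "Ck_on (Suc k) U F \<longleftrightarrow> (\<forall>u\<in>U. F differentiable (at u)) \<and> (\<forall>a. Ck_on k U (pd a F))"

definition smooth_on :: "(real^2) set \<Rightarrow> (real^2 \<Rightarrow> 'b::real_normed_vector) \<Rightarrow> bool" where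
  "smooth_on U F \<longleftrightarrow> (\<forall>k. Ck_on k U F)"


section \<open>Closed embedded surfaces\<close>

text \<open>An embedded surface is identified with its image \<open>\<Sigma>\<close>, a subset of Euclidean space; the
  embedding coordinates are then the restrictions to \<open>\<Sigma>\<close> of the standard coordinates.
  A local parametrization is the inverse of a coordinate chart.\<close>

definition local_param :: "(real^'m) set \<Rightarrow> (real^2) set \<Rightarrow> (real^2 \<Rightarrow> real^'m) \<Rightarrow> bool" where
  "local_param \<Sigma> U \<phi> \<longleftrightarrow>
     open U \<and> smooth_on U \<phi> \<and>
     (\<forall>u\<in>U. inj (frechet_derivative \<phi> (at u))) \<and>
     openin (top_of_set \<Sigma>) (\<phi> ` U) \<and>
     (\<exists>\<psi>. homeomorphism U (\<phi> ` U) \<phi> \<psi>)"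

definition closed_surface :: "(real^'m) set \<Rightarrow> bool" where
  "closed_surface \<Sigma> \<longleftrightarrow>
     compact \<Sigma> \<and> (\<forall>p\<in>\<Sigma>. \<exists>U \<phi>. local_param \<Sigma> U \<phi> \<and> p \<in> \<phi> ` U)"

text \<open>A function on \<open>\<Sigma>\<close> is represented by its extension by zero, so that two elements of
  \<open>smooth_fun \<Sigma>\<close> are equal iff they agree on \<open>\<Sigma>\<close>.\<close>

definition smooth_fun :: "(real^'m) set \<Rightarrow> (real^'m \<Rightarrow> real) set" where
  "smooth_fun \<Sigma> =
     {f. (\<forall>x. x \<notin> \<Sigma> \<longrightarrow> f x = 0) \<and> (\<forall>U \<phi>. local_param \<Sigma> U \<phi> \<longrightarrow> smooth_on U (f \<circ> \<phi>))}"

definition coord_fun :: "(real^'m) set \<Rightarrow> 'm \<Rightarrow> real^'m \<Rightarrow> real" where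
  "coord_fun \<Sigma> j = (\<lambda>x. if x \<in> \<Sigma> then x $ j else 0)"


section \<open>The symplectic form\<close>

text \<open>A 2-form on \<open>\<Sigma>\<close> assigns to \<open>p \<in> \<Sigma>\<close> an alternating bilinear form on the tangent plane at \<open>p\<close>.
  It is represented by any extension of that form to the ambient space; only the values on
  tangent vectors, that is, the functions \<open>rho \<omega> \<phi>\<close>, are ever used. Closedness is automatic in
  dimension two.\<close>

definition rho :: "(real^'m \<Rightarrow> real^'m \<Rightarrow> real^'m \<Rightarrow> real) \<Rightarrow> (real^2 \<Rightarrow> real^'m) \<Rightarrow> real^2 \<Rightarrow> real" where
  "rho \<omega> \<phi> u = \<omega> (\<phi> u) (pd 1 \<phi> u) (pd 2 \<phi> u)"

definition symplectic_form ::
    "(real^'m) set \<Rightarrow> (real^'m \<Rightarrow> real^'m \<Rightarrow> real^'m \<Rightarrow> real) \<Rightarrow> bool" where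
  "symplectic_form \<Sigma> \<omega> \<longleftrightarrow>
     (\<forall>p\<in>\<Sigma>. bilinear (\<omega> p) \<and> (\<forall>v. \<omega> p v v = 0)) \<and>
     (\<forall>U \<phi>. local_param \<Sigma> U \<phi> \<longrightarrow>
        smooth_on U (rho \<omega> \<phi>) \<and> (\<forall>u\<in>U. rho \<omega> \<phi> u \<noteq> 0))"

definition oriented_param ::
    "(real^'m) set \<Rightarrow> (real^'m \<Rightarrow> real^'m \<Rightarrow> real^'m \<Rightarrow> real) \<Rightarrow>
     (real^2) set \<Rightarrow> (real^2 \<Rightarrow> real^'m) \<Rightarrow> bool" where
  "oriented_param \<Sigma> \<omega> U \<phi> \<longleftrightarrow> local_param \<Sigma> U \<phi> \<and> (\<forall>u\<in>U. rho \<omega> \<phi> u > 0)"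

text \<open>Geometric quantities at \<open>p\<close> are evaluated in a chosen oriented parametrization around \<open>p\<close>;
  their values do not depend on the choice.\<close>

definition param_at ::
    "(real^'m) set \<Rightarrow> (real^'m \<Rightarrow> real^'m \<Rightarrow> real^'m \<Rightarrow> real) \<Rightarrow> real^'m \<Rightarrow>
     (real^2 \<Rightarrow> real^'m) \<times> (real^2)" where
  "param_at \<Sigma> \<omega> p = (SOME (\<phi>, u). \<exists>U. oriented_param \<Sigma> \<omega> U \<phi> \<and> u \<in> U \<and> \<phi> u = p)"

definition poisson_bracket ::
    "(real^'m) set \<Rightarrow> (real^'m \<Rightarrow> real^'m \<Rightarrow> real^'m \<Rightarrow> real) \<Rightarrow>
     (real^'m \<Rightarrow> real) \<Rightarrow> (real^'m \<Rightarrow> real) \<Rightarrow> real^'m \<Rightarrow> real" where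
  "poisson_bracket \<Sigma> \<omega> f h p =
     (if p \<in> \<Sigma> then
        (case param_at \<Sigma> \<omega> p of (\<phi>, u) \<Rightarrow>
           (pd 1 (f \<circ> \<phi>) u * pd 2 (h \<circ> \<phi>) u - pd 2 (f \<circ> \<phi>) u * pd 1 (h \<circ> \<phi>) u) / rho \<omega> \<phi> u)
      else 0)"

text \<open>A dissection of \<open>\<Sigma>\<close> is a partition into finitely many images of Borel sets, each relatively
  compact in the domain of an oriented parametrization. Integrals over \<open>\<Sigma>\<close> are computed with a
  chosen dissection; by the change of variables formula the value does not depend on the choice.\<close>

definition dissection ::
    "(real^'m) set \<Rightarrow> (real^'m \<Rightarrow> real^'m \<Rightarrow> real^'m \<Rightarrow> real) \<Rightarrow>
     nat \<times> (nat \<Rightarrow> real^2 \<Rightarrow> real^'m) \<times> (nat \<Rightarrow> (real^2) set) \<Rightarrow> bool" where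
  "dissection \<Sigma> \<omega> = (\<lambda>(n, \<phi>, D).
     (\<forall>i<n. D i \<in> sets borel \<and>
        (\<exists>U. oriented_param \<Sigma> \<omega> U (\<phi> i) \<and> compact (closure (D i)) \<and> closure (D i) \<subseteq> U)) \<and>
     disjoint_family_on (\<lambda>i. \<phi> i ` D i) {..<n} \<and>
     (\<Union>i<n. \<phi> i ` D i) = \<Sigma>)"

definition form_integral ::
    "(real^'m) set \<Rightarrow> (real^'m \<Rightarrow> real^'m \<Rightarrow> real^'m \<Rightarrow> real) \<Rightarrow> (real^'m \<Rightarrow> real) \<Rightarrow> real" where
  "form_integral \<Sigma> \<omega> f =
     (case (SOME d. dissection \<Sigma> \<omega> d) of (n, \<phi>, D) \<Rightarrow>
        \<Sum>i<n. set_lebesgue_integral lborel (D i) (\<lambda>u. f (\<phi> i u) * rho \<omega> (\<phi> i) u))"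


section \<open>The induced metric and its Gaussian curvature\<close>

definition gmat :: "(real^2 \<Rightarrow> real^'m) \<Rightarrow> real^2 \<Rightarrow> real^2^2" where
  "gmat \<phi> u = (\<chi> a b. pd a \<phi> u \<bullet> pd b \<phi> u)"

definition christoffel :: "(real^2 \<Rightarrow> real^'m) \<Rightarrow> 2 \<Rightarrow> 2 \<Rightarrow> 2 \<Rightarrow> real^2 \<Rightarrow> real" where
  "christoffel \<phi> c a b u =
     (1/2) * (\<Sum>d\<in>UNIV. matrix_inv (gmat \<phi> u) $ c $ d *
       (pd a (\<lambda>v. gmat \<phi> v $ b $ d) u + pd b (\<lambda>v. gmat \<phi> v $ a $ d) u
        - pd d (\<lambda>v. gmat \<phi> v $ a $ b) u))"

text \<open>\<open>riemann \<phi> a b c d\<close> is the component with upper index \<open>a\<close> and lower indices \<open>b c d\<close>, with the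
  sign convention under which the round sphere has positive curvature below.\<close>

definition riemann :: "(real^2 \<Rightarrow> real^'m) \<Rightarrow> 2 \<Rightarrow> 2 \<Rightarrow> 2 \<Rightarrow> 2 \<Rightarrow> real^2 \<Rightarrow> real" where
  "riemann \<phi> a b c d u =
     pd c (christoffel \<phi> a d b) u - pd d (christoffel \<phi> a c b) u
     + (\<Sum>e\<in>UNIV. christoffel \<phi> a c e u * christoffel \<phi> e d b u
                 - christoffel \<phi> a d e u * christoffel \<phi> e c b u)"

definition gauss_curvature ::
    "(real^'m) set \<Rightarrow> (real^'m \<Rightarrow> real^'m \<Rightarrow> real^'m \<Rightarrow> real) \<Rightarrow> real^'m \<Rightarrow> real" where
  "gauss_curvature \<Sigma> \<omega> p =
     (if p \<in> \<Sigma> then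
        (case param_at \<Sigma> \<omega> p of (\<phi>, u) \<Rightarrow>
           (\<Sum>e\<in>UNIV. gmat \<phi> u $ 1 $ e * riemann \<phi> e 2 1 2 u) / Determinants.det (gmat \<phi> u))
      else 0)"

definition gamma_fun ::
    "(real^'m) set \<Rightarrow> (real^'m \<Rightarrow> real^'m \<Rightarrow> real^'m \<Rightarrow> real) \<Rightarrow> real^'m \<Rightarrow> real" where
  "gamma_fun \<Sigma> \<omega> p =
     (if p \<in> \<Sigma> then
        (case param_at \<Sigma> \<omega> p of (\<phi>, u) \<Rightarrow> sqrt (Determinants.det (gmat \<phi> u)) / rho \<omega> \<phi> u)
      else 0)"


section \<open>Complex matrices\<close>

definition l2norm :: "complex Matrix.vec \<Rightarrow> real" where
  "l2norm v = sqrt (\<Sum>i<dim_vec v. (cmod (vec_index v i))\<^sup>2)"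

definition op_norm :: "complex Matrix.mat \<Rightarrow> real" where
  "op_norm A = Sup {l2norm (A *\<^sub>v v) |v. v \<in> carrier_vec (dim_col A) \<and> l2norm v \<le> 1}"

definition mtrace :: "complex Matrix.mat \<Rightarrow> complex" where
  "mtrace A = (\<Sum>i<dim_row A. A $$ (i, i))"

definition commutator :: "complex Matrix.mat \<Rightarrow> complex Matrix.mat \<Rightarrow> complex Matrix.mat" where
  "commutator A B = A * B - B * A"

text \<open>A quadratic form with real values forces \<open>A\<close> to be hermitian.\<close>

definition pos_semidef :: "complex Matrix.mat \<Rightarrow> bool" where
  "pos_semidef A \<longleftrightarrow>
     (\<forall>v\<in>carrier_vec (dim_col A). (A *\<^sub>v v) \<bullet>c v \<in> \<real> \<and> Re ((A *\<^sub>v v) \<bullet>c v) \<ge> 0)"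


section \<open>Matrix regularizations\<close>

definition iter_bracket ::
    "(real^'m) set \<Rightarrow> (real^'m \<Rightarrow> real^'m \<Rightarrow> real^'m \<Rightarrow> real) \<Rightarrow>
     (real^'m \<Rightarrow> real) list \<Rightarrow> (real^'m \<Rightarrow> real) \<Rightarrow> real^'m \<Rightarrow> real" where
  "iter_bracket \<Sigma> \<omega> fs f = foldr (\<lambda>g h. poisson_bracket \<Sigma> \<omega> h g) fs f"

text \<open>Here \<open>t\<close> is a single map \<open>T \<alpha>\<close> and \<open>h\<close> the corresponding value \<open>hbar (N \<alpha>)\<close>.\<close>

definition iter_commutator ::
    "((real^'m \<Rightarrow> real) \<Rightarrow> complex Matrix.mat) \<Rightarrow> real \<Rightarrow>
     (real^'m \<Rightarrow> real) list \<Rightarrow> complex Matrix.mat \<Rightarrow> complex Matrix.mat" where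
  "iter_commutator t h fs X =
     foldr (\<lambda>g Y. (1 / (\<i> * complex_of_real h)) \<cdot>\<^sub>m commutator Y (t g)) fs X"

definition matrix_seq_converges ::
    "(real^'m) set \<Rightarrow> (nat \<Rightarrow> nat) \<Rightarrow> (nat \<Rightarrow> (real^'m \<Rightarrow> real) \<Rightarrow> complex Matrix.mat) \<Rightarrow>
     (nat \<Rightarrow> complex Matrix.mat) \<Rightarrow> (real^'m \<Rightarrow> real) \<Rightarrow> bool" where
  "matrix_seq_converges \<Sigma> N T F f \<longleftrightarrow>
     f \<in> smooth_fun \<Sigma> \<and> (\<forall>\<alpha>. F \<alpha> \<in> carrier_mat (N \<alpha>) (N \<alpha>)) \<and>
     (\<lambda>\<alpha>. op_norm (F \<alpha> - T \<alpha> f)) \<longlonglongrightarrow> 0"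

definition matrix_seq_Ck_converges ::
    "nat \<Rightarrow> (real^'m) set \<Rightarrow> (real^'m \<Rightarrow> real^'m \<Rightarrow> real^'m \<Rightarrow> real) \<Rightarrow>
     (nat \<Rightarrow> nat) \<Rightarrow> (nat \<Rightarrow> (real^'m \<Rightarrow> real) \<Rightarrow> complex Matrix.mat) \<Rightarrow> (nat \<Rightarrow> real) \<Rightarrow>
     (nat \<Rightarrow> complex Matrix.mat) \<Rightarrow> (real^'m \<Rightarrow> real) \<Rightarrow> bool" where
  "matrix_seq_Ck_converges k \<Sigma> \<omega> N T hbar F f \<longleftrightarrow>
     matrix_seq_converges \<Sigma> N T F f \<and>
     (\<forall>fs. 1 \<le> length fs \<and> length fs \<le> k \<and> set fs \<subseteq> smooth_fun \<Sigma> \<longrightarrow>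
        (\<lambda>\<alpha>. op_norm (iter_commutator (T \<alpha>) (hbar (N \<alpha>)) fs (F \<alpha>)
                      - T \<alpha> (iter_bracket \<Sigma> \<omega> fs f))) \<longlonglongrightarrow> 0)"

text \<open>Matrix sequences are indexed by all natural numbers, starting at 0.\<close>

definition Ck_matrix_regularization ::
    "nat \<Rightarrow> (real^'m) set \<Rightarrow> (real^'m \<Rightarrow> real^'m \<Rightarrow> real^'m \<Rightarrow> real) \<Rightarrow>
     (nat \<Rightarrow> nat) \<Rightarrow> (nat \<Rightarrow> (real^'m \<Rightarrow> real) \<Rightarrow> complex Matrix.mat) \<Rightarrow> (nat \<Rightarrow> real) \<Rightarrow> bool" where
  "Ck_matrix_regularization k \<Sigma> \<omega> N T hbar \<longleftrightarrow>
     strict_mono N \<and> (\<forall>\<alpha>. N \<alpha> \<ge> 1) \<and>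
     (\<forall>\<alpha>. \<forall>f\<in>smooth_fun \<Sigma>. T \<alpha> f \<in> carrier_mat (N \<alpha>) (N \<alpha>) \<and> mat_adjoint (T \<alpha> f) = T \<alpha> f) \<and>
     (\<forall>\<alpha> a b. \<forall>f\<in>smooth_fun \<Sigma>. \<forall>h\<in>smooth_fun \<Sigma>.
        T \<alpha> (\<lambda>x. a * f x + b * h x) =
          complex_of_real a \<cdot>\<^sub>m T \<alpha> f + complex_of_real b \<cdot>\<^sub>m T \<alpha> h) \<and>
     (\<forall>n\<ge>1. hbar n > 0) \<and> (\<forall>m n. 1 \<le> m \<and> m \<le> n \<longrightarrow> hbar n \<le> hbar m) \<and>
     convergent (\<lambda>n. real n * hbar n) \<and>
     (\<forall>f\<in>smooth_fun \<Sigma>. convergent (\<lambda>\<alpha>. op_norm (T \<alpha> f))) \<and>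
     (\<forall>f\<in>smooth_fun \<Sigma>. \<forall>h\<in>smooth_fun \<Sigma>.
        (\<lambda>\<alpha>. op_norm (T \<alpha> (\<lambda>x. f x * h x) - T \<alpha> f * T \<alpha> h)) \<longlonglongrightarrow> 0) \<and>
     (\<forall>f\<in>smooth_fun \<Sigma>. \<forall>fs. 1 \<le> length fs \<and> length fs \<le> k \<and> set fs \<subseteq> smooth_fun \<Sigma> \<longrightarrow>
        (\<lambda>\<alpha>. op_norm (iter_commutator (T \<alpha>) (hbar (N \<alpha>)) fs (T \<alpha> f)
                      - T \<alpha> (iter_bracket \<Sigma> \<omega> fs f))) \<longlonglongrightarrow> 0) \<and>
     (\<forall>f\<in>smooth_fun \<Sigma>.
        (\<lambda>\<alpha>. complex_of_real (2 * pi * hbar (N \<alpha>)) * mtrace (T \<alpha> f))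
          \<longlonglongrightarrow> complex_of_real (form_integral \<Sigma> \<omega> f))"


section \<open>Discrete curvature and the discrete Laplacian\<close>

definition discrete_curvature ::
    "(real^'m) set \<Rightarrow> (real^'m \<Rightarrow> real^'m \<Rightarrow> real^'m \<Rightarrow> real) \<Rightarrow>
     (nat \<Rightarrow> nat) \<Rightarrow> (nat \<Rightarrow> (real^'m \<Rightarrow> real) \<Rightarrow> complex Matrix.mat) \<Rightarrow>
     (nat \<Rightarrow> complex Matrix.mat) \<Rightarrow> bool" where
  "discrete_curvature \<Sigma> \<omega> N T K \<longleftrightarrow> matrix_seq_converges \<Sigma> N T K (gauss_curvature \<Sigma> \<omega>)"

text \<open>\<open>ginv\<close> is the matrix inverse of \<open>\<gamma>\<close>. The sum over the
  embedding coordinates is taken entrywise, as the matrices of all sizes share one type.\<close>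

definition discrete_laplacian ::
    "(real^'m) set \<Rightarrow> (nat \<Rightarrow> nat) \<Rightarrow> (nat \<Rightarrow> (real^'m \<Rightarrow> real) \<Rightarrow> complex Matrix.mat) \<Rightarrow>
     (nat \<Rightarrow> real) \<Rightarrow> (nat \<Rightarrow> complex Matrix.mat) \<Rightarrow> nat \<Rightarrow> complex Matrix.mat \<Rightarrow> complex Matrix.mat" where
  "discrete_laplacian \<Sigma> N T hbar ginv \<alpha> X =
     (let C = (\<lambda>j Y. commutator Y (T \<alpha> (coord_fun \<Sigma> j))) in
      complex_of_real (- 1 / (hbar (N \<alpha>))\<^sup>2) \<cdot>\<^sub>m
        Matrix.mat (N \<alpha>) (N \<alpha>)
          (\<lambda>rc. \<Sum>j\<in>UNIV. (ginv \<alpha> * C j (ginv \<alpha> * C j X)) $$ rc))"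

text \<open>The zero matrices (with arbitrary eigenvalues) and the identity matrices (with eigenvalue 0)
  qualify, and rescaling lets any such sequence converge to 0. Hence lower bounds on the
  eigenvalues need a nonzero limit function and, when positive, a nonzero limit of the eigenvalues.\<close>

definition eigenmatrix_sequence ::
    "(real^'m) set \<Rightarrow> (nat \<Rightarrow> nat) \<Rightarrow> (nat \<Rightarrow> (real^'m \<Rightarrow> real) \<Rightarrow> complex Matrix.mat) \<Rightarrow>
     (nat \<Rightarrow> real) \<Rightarrow> (nat \<Rightarrow> complex Matrix.mat) \<Rightarrow>
     (nat \<Rightarrow> complex Matrix.mat) \<Rightarrow> (nat \<Rightarrow> complex) \<Rightarrow> bool" where
  "eigenmatrix_sequence \<Sigma> N T hbar ginv u \<mu> \<longleftrightarrow>
     (\<exists>f. matrix_seq_converges \<Sigma> N T u f) \<and>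
     (\<forall>\<alpha>. discrete_laplacian \<Sigma> N T hbar ginv \<alpha> (u \<alpha>) = \<mu> \<alpha> \<cdot>\<^sub>m u \<alpha>) \<and>
     convergent \<mu>"

end

theory Submission
  imports Defs
begin

text \<open>The proof is the Lichnerowicz argument on the limit surface, arranged so that only first-order
  integration by parts is needed. All integrations by parts come from the vanishing trace of a
  commutator, which gives \<open>\<integral> {f, h} \<omega> = 0\<close>. Let \<open>G\<close> be the gradient of the limit function \<open>u\<close> and
  \<open>V\<close> its rotation by a right angle, both as vector fields along the embedding; thus
  \<open>V\<^sup>k = \<gamma>\<^sup>-\<^sup>1 {u, x\<^sup>k}\<close>. The Gauss equation gives the pointwise identity
  \<open>\<Sum>\<^sub>k {G\<^sup>k, V\<^sup>k} = \<gamma> (K |\<nabla>u|\<^sup>2 - 2 det (\<nabla>\<^sup>2 u))\<close>, where \<open>det\<close> is taken with respect to the metric, so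
  \<open>2 det (\<nabla>\<^sup>2 u) \<le> (\<Delta>u)\<^sup>2 / 2\<close>. Integrating, \<open>\<integral> K |\<nabla>u|\<^sup>2 \<gamma>\<omega> \<le> 1/2 \<integral> (\<Delta>u)\<^sup>2 \<gamma>\<omega>\<close>. The eigenvalue equation,
  tested by traces, turns the right-hand side into \<open>\<lambda>/2 \<integral> |\<nabla>u|\<^sup>2 \<gamma>\<omega>\<close>, and the operator inequality
  for the discrete curvature bounds the left-hand side below by \<open>\<kappa> \<integral> |\<nabla>u|\<^sup>2 \<gamma>\<omega>\<close>.\<close>

text \<open>Bochner's formula would bring in third derivatives of u. The brackets {G^k, V^k} replace
  it: each G^k and V^k is a smooth function on the whole surface, whereas tangent frames exist only
  locally, so every bracket integrates to zero. The constant 2 comes from the dimension: a symmetric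
  2 by 2 matrix satisfies 4 det <= tr^2, and the result is kappa B <= lambda B / 2, where B is the
  Dirichlet energy of u. The eigenvalues are complex and the eigenmatrices need not be hermitian, so
  the limit has to be shown to be real. Testing with u itself exhibits it as B divided by the
  weighted square norm of u, which is positive because u does not vanish identically. The final
  division by B fails exactly if B = 0; then the limit is 0, and the hypothesis on nonzero limits
  forces kappa <= 0. The integral is defined through an arbitrarily chosen dissection. Its
  linearity, too, is read off from traces; measure theory enters only for its positivity.\<close>

no_notation scalar_prod (infix "\<bullet>" 70)

section \<open>Calculus of partial derivatives\<close>

lemma pd_I: "(F has_derivative F') (at u) \<Longrightarrow> pd a F u = F' (axis a 1)"
  unfolding pd_def by (metis frechet_derivative_at)

text \<open>The product, inverse and chain rules for \<open>pd\<close> are obtained by inserting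
  this explicit derivative into the general rules and evaluating at the two axis vectors.\<close>

lemma has_derivative_pd:
  fixes F :: "real^2 \<Rightarrow> 'b::real_normed_vector"
  assumes "F differentiable (at u)"
  shows "(F has_derivative (\<lambda>h. h$1 *\<^sub>R pd 1 F u + h$2 *\<^sub>R pd 2 F u)) (at u)"
proof -
  let ?D = "frechet_derivative F (at u)"
  have D: "(F has_derivative ?D) (at u)"
    using assms frechet_derivative_works by blast
  have l: "linear ?D" using D has_derivative_linear by blast
  have "?D h = h$1 *\<^sub>R pd 1 F u + h$2 *\<^sub>R pd 2 F u" for h
  proof -
    have "h = h$1 *\<^sub>R axis 1 1 + h$2 *\<^sub>R axis 2 1"
      by (simp add: Finite_Cartesian_Product.vec_eq_iff forall_2 axis_def)
    then have "?D h = ?D (h$1 *\<^sub>R axis 1 1 + h$2 *\<^sub>R axis 2 1)" by simp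
    then show ?thesis using l by (simp add: linear_add linear_scale pd_def)
  qed
  then have "?D = (\<lambda>h. h$1 *\<^sub>R pd 1 F u + h$2 *\<^sub>R pd 2 F u)" by blast
  with D show ?thesis by simp
qed

text \<open>Derivatives are local. Identities in charts hold only on the parameter domain, and its
  openness is what allows them to be differentiated.\<close>

lemma pd_cong_open:
  assumes "open U" "u \<in> U" "\<And>v. v \<in> U \<Longrightarrow> F v = G v"
  shows "pd a F u = pd a G u"
proof -
  have "(F has_derivative D) (at u) \<longleftrightarrow> (G has_derivative D) (at u)" for D
    using has_derivative_transform_within_open[of F D u UNIV U G]
      has_derivative_transform_within_open[of G D u UNIV U F] assms by auto
  then show ?thesis unfolding pd_def frechet_derivative_def by simp
qed

lemma differentiable_cong_open:
  assumes "open U" "u \<in> U" "\<And>v. v \<in> U \<Longrightarrow> F v = G v"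
  shows "F differentiable (at u) \<longleftrightarrow> G differentiable (at u)"
proof -
  have "(F has_derivative D) (at u) \<longleftrightarrow> (G has_derivative D) (at u)" for D
    using has_derivative_transform_within_open[of F D u UNIV U G]
      has_derivative_transform_within_open[of G D u UNIV U F] assms by auto
  then show ?thesis unfolding differentiable_def by simp
qed

lemma Ck_on_cong:
  assumes "open U" "\<And>v. v \<in> U \<Longrightarrow> F v = G v" "Ck_on k U F"
  shows "Ck_on k U G"
  using assms(2,3)
proof (induction k arbitrary: F G)
  case 0
  then show ?case using continuous_on_cong[of U U F G] by auto
next
  case (Suc k)
  have "G differentiable (at u)" if "u \<in> U" for u
    using Suc.prems that differentiable_cong_open[OF assms(1), of u F G] by auto
  moreover have "Ck_on k U (pd a G)" for a
    using Suc.IH[of "pd a F" "pd a G"] Suc.prems pd_cong_open[OF assms(1), of _ F G] by auto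
  ultimately show ?case by simp
qed

lemma Ck_on_Suc_imp: "Ck_on (Suc k) U F \<Longrightarrow> Ck_on k U F"
proof (induction k arbitrary: F)
  case 0
  then show ?case
    by (simp add: continuous_at_imp_continuous_on differentiable_imp_continuous_within)
qed auto

lemma Ck_on_subset: "V \<subseteq> U \<Longrightarrow> Ck_on k U F \<Longrightarrow> Ck_on k V F"
  by (induction k arbitrary: F) (auto intro: continuous_on_subset)

lemma smooth_on_subset: "V \<subseteq> U \<Longrightarrow> smooth_on U F \<Longrightarrow> smooth_on V F"
  unfolding smooth_on_def using Ck_on_subset by blast

lemma smooth_on_cong:
  "open U \<Longrightarrow> (\<And>v. v \<in> U \<Longrightarrow> F v = G v) \<Longrightarrow> smooth_on U F \<Longrightarrow> smooth_on U G"
  unfolding smooth_on_def using Ck_on_cong by blast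

lemma smooth_on_differentiable: "smooth_on U F \<Longrightarrow> u \<in> U \<Longrightarrow> F differentiable (at u)"
  unfolding smooth_on_def by (metis Ck_on.simps(2))

lemma smooth_on_pd: "smooth_on U F \<Longrightarrow> smooth_on U (pd a F)"
  unfolding smooth_on_def by (metis Ck_on.simps(2))

lemma smooth_on_continuous_on: "smooth_on U F \<Longrightarrow> continuous_on U F"
  unfolding smooth_on_def by (metis Ck_on.simps(1))

lemma pd_bounded_linear:
  assumes "bounded_linear L" "F differentiable (at u)"
  shows "pd a (\<lambda>v. L (F v)) u = L (pd a F u)"
proof -
  have "((\<lambda>v. L (F v)) has_derivative (\<lambda>h. L (h$1 *\<^sub>R pd 1 F u + h$2 *\<^sub>R pd 2 F u))) (at u)"
    using bounded_linear.has_derivative[OF assms(1) has_derivative_pd[OF assms(2)]] .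
  then show ?thesis using exhaust_2[of a] by (auto simp: pd_I axis_def)
qed

lemma pd_bilinear:
  assumes "bounded_bilinear p" "F differentiable (at u)" "G differentiable (at u)"
  shows "pd a (\<lambda>v. p (F v) (G v)) u = p (F u) (pd a G u) + p (pd a F u) (G u)"
proof -
  note bounded_bilinear.FDERIV[OF assms(1) has_derivative_pd[OF assms(2)] has_derivative_pd[OF assms(3)]]
  then show ?thesis using exhaust_2[of a] by (auto simp: pd_I axis_def)
qed

lemma pd_add:
  assumes "F differentiable (at u)" "G differentiable (at u)"
  shows "pd a (\<lambda>v. F v + G v) u = pd a F u + pd a G u"
proof -
  note has_derivative_add[OF has_derivative_pd[OF assms(1)] has_derivative_pd[OF assms(2)]]
  then show ?thesis using exhaust_2[of a] by (auto simp: pd_I axis_def)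
qed

section \<open>Closure of C^k maps under algebraic operations\<close>

lemma pd_const [simp]: "pd a (\<lambda>v. c) u = 0"
  by (rule pd_I[of _ "\<lambda>h. 0", simplified]) auto

lemma Ck_on_const [simp]: "Ck_on k U (\<lambda>v. c)"
proof (induction k arbitrary: c)
  case (Suc k)
  have "pd a (\<lambda>v. c) = (\<lambda>v. 0)" for a by (rule ext) simp
  then show ?case using Suc.IH by simp
qed simp

lemma Ck_on_add:
  assumes "open U"
  shows "Ck_on k U F \<Longrightarrow> Ck_on k U G \<Longrightarrow> Ck_on k U (\<lambda>v. F v + G v)"
proof (induction k arbitrary: F G)
  case 0
  then show ?case by (simp add: continuous_on_add)
next
  case (Suc k)
  have "Ck_on k U (pd a (\<lambda>v. F v + G v))" for a
    by (rule Ck_on_cong[OF assms, of "\<lambda>v. pd a F v + pd a G v"])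
      (use Suc in \<open>auto simp: pd_add\<close>)
  then show ?case using Suc.prems by (auto intro: differentiable_add)
qed

lemma bounded_linear_differentiable:
  "bounded_linear L \<Longrightarrow> F differentiable (at u) \<Longrightarrow> (\<lambda>v. L (F v)) differentiable (at u)"
  unfolding differentiable_def using bounded_linear.has_derivative by blast

lemma bounded_bilinear_differentiable:
  "bounded_bilinear p \<Longrightarrow> F differentiable (at u) \<Longrightarrow> G differentiable (at u)
    \<Longrightarrow> (\<lambda>v. p (F v) (G v)) differentiable (at u)"
  unfolding differentiable_def using bounded_bilinear.FDERIV by blast

lemma Ck_on_bounded_linear:
  assumes "open U" "bounded_linear L"
  shows "Ck_on k U F \<Longrightarrow> Ck_on k U (\<lambda>v. L (F v))"
proof (induction k arbitrary: F)
  case 0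
  then show ?case using bounded_linear.continuous_on[OF assms(2)] by auto
next
  case (Suc k)
  have "Ck_on k U (pd a (\<lambda>v. L (F v)))" for a
    by (rule Ck_on_cong[OF assms(1), of "\<lambda>v. L (pd a F v)"])
      (use Suc assms in \<open>auto simp: pd_bounded_linear\<close>)
  then show ?case using Suc.prems assms(2) by (simp add: bounded_linear_differentiable[OF assms(2)])
qed

lemma Ck_on_bilinear:
  assumes "open U" "bounded_bilinear p"
  shows "Ck_on k U F \<Longrightarrow> Ck_on k U G \<Longrightarrow> Ck_on k U (\<lambda>v. p (F v) (G v))"
proof (induction k arbitrary: F G)
  case 0
  then show ?case using bounded_bilinear.continuous_on[OF assms(2)] by auto
next
  case (Suc k)
  have FG: "Ck_on k U F" "Ck_on k U G" using Suc.prems Ck_on_Suc_imp by blast+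
  have "Ck_on k U (pd a (\<lambda>v. p (F v) (G v)))" for a
  proof (rule Ck_on_cong[OF assms(1)])
    show "p (F v) (pd a G v) + p (pd a F v) (G v) = pd a (\<lambda>v. p (F v) (G v)) v" if "v \<in> U" for v
      using that Suc.prems by (simp add: pd_bilinear[OF assms(2)])
    have "Ck_on k U (pd a F)" "Ck_on k U (pd a G)" using Suc.prems by simp_all
    then show "Ck_on k U (\<lambda>v. p (F v) (pd a G v) + p (pd a F v) (G v))"
      by (intro Ck_on_add[OF assms(1)] Suc.IH FG)
  qed
  then show ?case using Suc.prems by (simp add: bounded_bilinear_differentiable[OF assms(2)])
qed

lemmas Ck_on_mult = Ck_on_bilinear[OF _ bounded_bilinear_mult]
lemmas Ck_on_minus = Ck_on_bounded_linear[OF _ bounded_linear_minus[OF bounded_linear_ident]]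

lemma pd_inverse:
  fixes f :: "real^2 \<Rightarrow> real"
  assumes "f differentiable (at u)" "f u \<noteq> 0"
  shows "pd a (\<lambda>v. inverse (f v)) u = - (pd a f u * (inverse (f u) * inverse (f u)))"
proof -
  note Deriv.has_derivative_inverse[OF assms(2) has_derivative_pd[OF assms(1)]]
  then show ?thesis using exhaust_2[of a] by (auto simp: pd_I axis_def)
qed

lemma pd_sqrt:
  fixes f :: "real^2 \<Rightarrow> real"
  assumes "f differentiable (at u)" "f u > 0"
  shows "pd a (\<lambda>v. sqrt (f v)) u = pd a f u * inverse (2 * sqrt (f u))"
proof -
  note has_derivative_real_sqrt[OF assms(2) has_derivative_pd[OF assms(1)]]
  then show ?thesis using exhaust_2[of a] by (auto simp: pd_I axis_def divide_simps)
qed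

text \<open>The derivative of 1/f is a polynomial in f' and 1/f, so the induction hypothesis about
  1/f itself closes the step. The same bootstrapping works for the square root, whose derivative is
  f' / (2 sqrt f).\<close>

lemma Ck_on_inverse:
  fixes f :: "real^2 \<Rightarrow> real"
  assumes "open U" "\<forall>u\<in>U. f u \<noteq> 0"
  shows "Ck_on k U f \<Longrightarrow> Ck_on k U (\<lambda>v. inverse (f v))"
proof (induction k)
  case 0
  then show ?case using assms by (simp add: continuous_on_inverse)
next
  case (Suc k)
  have i: "Ck_on k U (\<lambda>v. inverse (f v))" using Suc Ck_on_Suc_imp by blast
  have "Ck_on k U (pd a (\<lambda>v. inverse (f v)))" for a
  proof (rule Ck_on_cong[OF assms(1)])
    show "- (pd a f v * (inverse (f v) * inverse (f v))) = pd a (\<lambda>v. inverse (f v)) v" if "v \<in> U" for v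
      using that Suc.prems assms by (auto simp: pd_inverse)
    show "Ck_on k U (\<lambda>v. - (pd a f v * (inverse (f v) * inverse (f v))))"
      using i Suc.prems
      by (intro Ck_on_minus Ck_on_mult assms) auto
  qed
  then show ?case using Suc.prems assms(2) by (auto intro!: differentiable_inverse)
qed

lemma Ck_on_sqrt:
  fixes f :: "real^2 \<Rightarrow> real"
  assumes "open U" "\<forall>u\<in>U. f u > 0"
  shows "Ck_on k U f \<Longrightarrow> Ck_on k U (\<lambda>v. sqrt (f v))"
proof (induction k)
  case 0
  then show ?case by (simp add: continuous_on_real_sqrt)
next
  case (Suc k)
  have "Ck_on k U (\<lambda>v. sqrt (f v))" by (rule Suc.IH[OF Ck_on_Suc_imp[OF Suc.prems]])
  then have i: "Ck_on k U (\<lambda>v. inverse (2 * sqrt (f v)))"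
    using assms by (intro Ck_on_inverse Ck_on_mult Ck_on_const ballI) force+
  have "Ck_on k U (pd a (\<lambda>v. sqrt (f v)))" for a
  proof (rule Ck_on_cong[OF assms(1)])
    show "pd a f v * inverse (2 * sqrt (f v)) = pd a (\<lambda>v. sqrt (f v)) v" if "v \<in> U" for v
      using that Suc.prems assms by (auto simp: pd_sqrt)
    show "Ck_on k U (\<lambda>v. pd a f v * inverse (2 * sqrt (f v)))"
      using i Suc.prems by (intro Ck_on_mult assms) auto
  qed
  moreover have "(\<lambda>v. sqrt (f v)) differentiable (at u)" if "u \<in> U" for u
  proof -
    have "f u > 0" "f differentiable (at u)" using Suc.prems assms(2) that by auto
    from differentiableI[OF has_derivative_real_sqrt[OF this(1) has_derivative_pd[OF this(2)]]]
    show ?thesis .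
  qed
  ultimately show ?case by simp
qed

lemma smooth_on_const [simp]: "smooth_on U (\<lambda>v. c)"
  by (simp add: smooth_on_def)

lemma smooth_on_add:
  "open U \<Longrightarrow> smooth_on U F \<Longrightarrow> smooth_on U G \<Longrightarrow> smooth_on U (\<lambda>v. F v + G v)"
  by (simp add: smooth_on_def Ck_on_add)

lemma smooth_on_bounded_linear:
  "open U \<Longrightarrow> bounded_linear L \<Longrightarrow> smooth_on U F \<Longrightarrow> smooth_on U (\<lambda>v. L (F v))"
  by (simp add: smooth_on_def Ck_on_bounded_linear)

lemma smooth_on_bilinear:
  "open U \<Longrightarrow> bounded_bilinear p \<Longrightarrow> smooth_on U F \<Longrightarrow> smooth_on U G \<Longrightarrow> smooth_on U (\<lambda>v. p (F v) (G v))"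
  by (simp add: smooth_on_def Ck_on_bilinear)

lemmas smooth_on_mult = smooth_on_bilinear[OF _ bounded_bilinear_mult]
lemmas smooth_on_scaleR = smooth_on_bilinear[OF _ bounded_bilinear_scaleR]
lemmas smooth_on_inner = smooth_on_bilinear[OF _ bounded_bilinear_inner]
lemmas smooth_on_component = smooth_on_bounded_linear[OF _ bounded_linear_vec_nth]
lemmas smooth_on_minus = smooth_on_bounded_linear[OF _ bounded_linear_minus[OF bounded_linear_ident]]

lemma smooth_on_diff:
  "open U \<Longrightarrow> smooth_on U F \<Longrightarrow> smooth_on U G \<Longrightarrow> smooth_on U (\<lambda>v. F v - G v)"
  using smooth_on_add[of U F "\<lambda>v. - G v"] smooth_on_minus[of U G] by simp

lemma smooth_on_inverse:
  fixes f :: "real^2 \<Rightarrow> real"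
  shows "open U \<Longrightarrow> \<forall>u\<in>U. f u \<noteq> 0 \<Longrightarrow> smooth_on U f \<Longrightarrow> smooth_on U (\<lambda>v. inverse (f v))"
  by (simp add: smooth_on_def Ck_on_inverse)

lemma smooth_on_divide:
  fixes f :: "real^2 \<Rightarrow> real"
  shows "open U \<Longrightarrow> \<forall>u\<in>U. f u \<noteq> 0 \<Longrightarrow> smooth_on U g \<Longrightarrow> smooth_on U f \<Longrightarrow> smooth_on U (\<lambda>v. g v / f v)"
  using smooth_on_mult[of U g "\<lambda>v. inverse (f v)"] smooth_on_inverse[of U f] by (simp add: divide_inverse)

lemma smooth_on_sqrt:
  fixes f :: "real^2 \<Rightarrow> real"
  shows "open U \<Longrightarrow> \<forall>u\<in>U. f u > 0 \<Longrightarrow> smooth_on U f \<Longrightarrow> smooth_on U (\<lambda>v. sqrt (f v))"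
  by (simp add: smooth_on_def Ck_on_sqrt)

lemmas pd_mult = pd_bilinear[OF bounded_bilinear_mult]
lemmas pd_scaleR = pd_bilinear[OF bounded_bilinear_scaleR]
lemmas pd_inner = pd_bilinear[OF bounded_bilinear_inner]
lemmas pd_component = pd_bounded_linear[OF bounded_linear_vec_nth]
lemmas pd_minus = pd_bounded_linear[OF bounded_linear_minus[OF bounded_linear_ident]]

lemma pd_diff:
  assumes "F differentiable (at u)" "G differentiable (at u)"
  shows "pd a (\<lambda>v. F v - G v) u = pd a F u - pd a G u"
  using pd_add[OF assms(1), of "\<lambda>v. - G v" a] pd_minus[OF assms(2), of a] differentiable_minus[OF assms(2)] by simp

section \<open>Symmetry of second derivatives and transition maps\<close>

text \<open>The mean value theorem is applied in direction \<open>a\<close> only, to the increment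
  of \<open>F\<close> in direction \<open>b\<close>; the resulting increment of
  \<open>pd a F\<close> is then linearised at \<open>u\<close>. This uses differentiability of
  \<open>pd a F\<close> at the single point \<open>u\<close>, and the second difference it estimates
  is symmetric in \<open>a\<close> and \<open>b\<close>.\<close>

lemma mixed_difference_approx:
  fixes F :: "real^2 \<Rightarrow> real"
  assumes "open U" "u \<in> U" "\<And>v. v \<in> U \<Longrightarrow> F differentiable (at v)"
    and D: "pd a F differentiable (at u)" and "e > 0"
  shows "\<exists>d>0. \<forall>t. 0 < t \<and> t < d \<longrightarrow>
    \<bar>F (u + t *\<^sub>R axis a 1 + t *\<^sub>R axis b 1) - F (u + t *\<^sub>R axis a 1) - F (u + t *\<^sub>R axis b 1) + F u
      - t\<^sup>2 * pd b (pd a F) u\<bar> \<le> 4 * e * t\<^sup>2"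
proof -
  define ea eb :: "real^2" where "ea = axis a 1" and "eb = axis b 1"
  have n: "norm ea = 1" "norm eb = 1" by (simp_all add: ea_def eb_def)
  let ?P = "pd a F" and ?D = "frechet_derivative (pd a F) (at u)"
  obtain r where r: "r > 0" "ball u r \<subseteq> U" using assms openE by blast
  have PD: "(?P has_derivative ?D) (at u)" using D frechet_derivative_works by blast
  then have lin: "linear ?D" using has_derivative_linear by blast
  obtain d1 where d1: "d1 > 0"
    "\<And>y. norm (y - u) < d1 \<Longrightarrow> norm (?P y - ?P u - ?D (y - u)) \<le> e * norm (y - u)"
    using PD \<open>e > 0\<close> unfolding has_derivative_at_alt by blast
  \<comment> \<open>Halved because the far corner \<open>u + t *\<^sub>R ea + t *\<^sub>R eb\<close>
    may lie at distance up to 2 t from \<open>u\<close>.\<close>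
  define d where "d = min r d1 / 2"
  have "\<bar>F (u + t *\<^sub>R ea + t *\<^sub>R eb) - F (u + t *\<^sub>R ea) - F (u + t *\<^sub>R eb) + F u
      - t\<^sup>2 * ?D eb\<bar> \<le> 4 * e * t\<^sup>2" if t: "0 < t" "t < d" for t
  proof -
    define p where "p x = F (u + x *\<^sub>R ea + t *\<^sub>R eb) - F (u + x *\<^sub>R ea + 0 *\<^sub>R eb)" for x
    have near: "norm (x *\<^sub>R ea + y *\<^sub>R eb) \<le> \<bar>x\<bar> + \<bar>y\<bar>" for x y
      using norm_triangle_ineq[of "x *\<^sub>R ea" "y *\<^sub>R eb"] n by simp
    have der: "((\<lambda>x. F (u + x *\<^sub>R ea + y *\<^sub>R eb)) has_real_derivative ?P (u + x *\<^sub>R ea + y *\<^sub>R eb)) (at x)"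
      if "\<bar>x\<bar> \<le> t" "\<bar>y\<bar> \<le> t" for x y
    proof -
      let ?v = "u + x *\<^sub>R ea + y *\<^sub>R eb"
      have "norm (x *\<^sub>R ea + y *\<^sub>R eb) < r" using near[of x y] that t by (auto simp: d_def)
      then have "?v \<in> U" using r by (auto simp: dist_norm subset_iff algebra_simps norm_minus_commute)
      then have FD: "(F has_derivative frechet_derivative F (at ?v)) (at ?v)"
        using assms(3) frechet_derivative_works by blast
      have "((\<lambda>x. u + x *\<^sub>R ea + y *\<^sub>R eb) has_derivative (\<lambda>h. h *\<^sub>R ea)) (at x)"
        by (auto intro!: derivative_eq_intros)
      from has_derivative_compose[OF this FD]
      have "((\<lambda>x. F (u + x *\<^sub>R ea + y *\<^sub>R eb)) has_derivative (\<lambda>h. frechet_derivative F (at ?v) (h *\<^sub>R ea))) (at x)" .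
      moreover have "frechet_derivative F (at ?v) (h *\<^sub>R ea) = ?P ?v * h" for h
        using has_derivative_linear[OF FD] by (simp add: linear_scale pd_def ea_def)
      ultimately show ?thesis by (simp add: has_field_derivative_def)
    qed
    have "\<exists>z. 0 < z \<and> z < t \<and>
      p t - p 0 = (t - 0) * (?P (u + z *\<^sub>R ea + t *\<^sub>R eb) - ?P (u + z *\<^sub>R ea + 0 *\<^sub>R eb))"
      unfolding p_def using t by (intro MVT2 DERIV_diff der) auto
    then obtain z where z: "0 < z" "z < t"
      and pz: "p t - p 0 = t * (?P (u + z *\<^sub>R ea + t *\<^sub>R eb) - ?P (u + z *\<^sub>R ea))" by auto
    have 1: "\<bar>?P (u + z *\<^sub>R ea + t *\<^sub>R eb) - ?P u - ?D (z *\<^sub>R ea + t *\<^sub>R eb)\<bar> \<le> e * (2 * t)"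
    proof -
      have "norm (z *\<^sub>R ea + t *\<^sub>R eb) \<le> 2 * t" using near[of z t] z by simp
      moreover have "2 * t < d1" using t by (simp add: d_def)
      ultimately show ?thesis
        using d1(2)[of "u + z *\<^sub>R ea + t *\<^sub>R eb"] \<open>e > 0\<close>
        by (simp add: add.assoc) (meson mult_left_mono order.trans less_imp_le)
    qed
    have 2: "\<bar>?P (u + z *\<^sub>R ea) - ?P u - ?D (z *\<^sub>R ea)\<bar> \<le> e * t"
    proof -
      have "z < d1" using z t by (simp add: d_def)
      then have "\<bar>?P (u + z *\<^sub>R ea) - ?P u - ?D (z *\<^sub>R ea)\<bar> \<le> e * z"
        using d1(2)[of "u + z *\<^sub>R ea"] z n by simp
      also have "\<dots> \<le> e * t" using z \<open>e > 0\<close> by simp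
      finally show ?thesis .
    qed
    have "?D (z *\<^sub>R ea + t *\<^sub>R eb) = ?D (z *\<^sub>R ea) + t * ?D eb"
      using lin by (simp add: linear_add linear_scale)
    \<comment> \<open>The two errors add up to 3 e t; 4 e t is a convenient upper bound.\<close>
    with 1 2 have "\<bar>(?P (u + z *\<^sub>R ea + t *\<^sub>R eb) - ?P (u + z *\<^sub>R ea)) - t * ?D eb\<bar> \<le> 4 * e * t"
      by (simp add: algebra_simps)
    then have "t * \<bar>(?P (u + z *\<^sub>R ea + t *\<^sub>R eb) - ?P (u + z *\<^sub>R ea)) - t * ?D eb\<bar> \<le> t * (4 * e * t)"
      using t by (intro mult_left_mono) auto
    moreover have "t * \<bar>(?P (u + z *\<^sub>R ea + t *\<^sub>R eb) - ?P (u + z *\<^sub>R ea)) - t * ?D eb\<bar>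
      = \<bar>(p t - p 0) - t\<^sup>2 * ?D eb\<bar>"
    proof -
      have "t * \<bar>y\<bar> = \<bar>t * y\<bar>" for y using t by (simp add: abs_mult)
      then show ?thesis unfolding pz by (simp add: power2_eq_square right_diff_distrib mult.assoc)
    qed
    ultimately show ?thesis by (simp add: p_def power2_eq_square algebra_simps)
  qed
  moreover have "d > 0" using r d1 by (simp add: d_def)
  ultimately show ?thesis unfolding ea_def eb_def pd_def[of b "pd a F"] by blast
qed

lemma pd_commute_real:
  fixes F :: "real^2 \<Rightarrow> real"
  assumes "open U" "u \<in> U" "\<And>v. v \<in> U \<Longrightarrow> F differentiable (at v)"
    and "pd a F differentiable (at u)" "pd b F differentiable (at u)"
  shows "pd b (pd a F) u = pd a (pd b F) u"
proof (rule ccontr)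
  let ?x = "pd b (pd a F) u" and ?y = "pd a (pd b F) u"
  assume ne: "?x \<noteq> ?y"
  \<comment> \<open>Both iterated derivatives, times t^2, approximate the same second difference
    within 4 e t^2. So they differ by at most 8 e, which is half of their assumed distance.\<close>
  define e where "e = \<bar>?x - ?y\<bar> / 16"
  have e: "e > 0" using ne by (simp add: e_def)
  obtain d where d: "d > 0" "\<And>t. 0 < t \<Longrightarrow> t < d \<Longrightarrow> \<bar>F (u + t *\<^sub>R axis a 1 + t *\<^sub>R axis b 1) - F (u + t *\<^sub>R axis a 1) - F (u + t *\<^sub>R axis b 1) + F u
      - t\<^sup>2 * ?x\<bar> \<le> 4 * e * t\<^sup>2"
    using mixed_difference_approx[OF assms(1-4) e, of b] by blast
  obtain d' where d': "d' > 0" "\<And>t. 0 < t \<Longrightarrow> t < d' \<Longrightarrow> \<bar>F (u + t *\<^sub>R axis b 1 + t *\<^sub>R axis a 1) - F (u + t *\<^sub>R axis b 1) - F (u + t *\<^sub>R axis a 1) + F u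
      - t\<^sup>2 * ?y\<bar> \<le> 4 * e * t\<^sup>2"
    using mixed_difference_approx[OF assms(1-3,5) e, of a] by blast
  define t where "t = min d d' / 2"
  have t: "t > 0" "t < d" "t < d'" using d d' by (auto simp: t_def)
  have "F (u + t *\<^sub>R axis b 1 + t *\<^sub>R axis a 1) = F (u + t *\<^sub>R axis a 1 + t *\<^sub>R axis b 1)"
    by (simp only: ac_simps)
  moreover have tri: "\<bar>p - q\<bar> \<le> 2 * c"
    if "\<bar>x1 - x2 - x3 + x0 - p\<bar> \<le> c" "\<bar>x1 - x3 - x2 + x0 - q\<bar> \<le> c" for p q c x0 x1 x2 x3 :: real
    using that by linarith
  ultimately have "\<bar>t\<^sup>2 * ?x - t\<^sup>2 * ?y\<bar> \<le> 2 * (4 * e * t\<^sup>2)"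
    using tri[OF d(2)[OF t(1,2)]] d'(2)[OF t(1,3)] by simp
  then have "t\<^sup>2 * \<bar>?x - ?y\<bar> \<le> t\<^sup>2 * (8 * e)"
    by (simp add: abs_mult mult_ac flip: right_diff_distrib)
  then have "\<bar>?x - ?y\<bar> \<le> 8 * e" using t by simp
  then show False using ne by (simp add: e_def)
qed

lemma pd_commute:
  assumes "open U" "u \<in> U" "smooth_on U F"
  shows "pd b (pd a F) u = pd a (pd b (F :: real^2 \<Rightarrow> real)) u"
  using assms by (intro pd_commute_real[of U]) (auto intro: smooth_on_differentiable smooth_on_pd)

lemma pd_component_open:
  assumes "open U" "u \<in> U" "smooth_on U F"
  shows "pd a F u $ j = pd a (\<lambda>v. F v $ j) u"
  by (simp add: pd_component[OF smooth_on_differentiable[OF assms(3,2)]])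

lemma pd_commute_vec:
  fixes F :: "real^2 \<Rightarrow> real^'m"
  assumes "open U" "u \<in> U" "smooth_on U F"
  shows "pd b (pd a F) u = pd a (pd b F) u"
proof -
  have "pd b (pd a F) u $ j = pd a (pd b F) u $ j" for j
  proof -
    have c: "pd b (pd a F) u $ j = pd b (pd a (\<lambda>v. F v $ j)) u" for a b
    proof -
      have "pd b (pd a F) u $ j = pd b (\<lambda>v. pd a F v $ j) u"
        using assms by (intro pd_component_open[of U]) (auto intro: smooth_on_pd)
      also have "\<dots> = pd b (pd a (\<lambda>v. F v $ j)) u"
        using assms by (intro pd_cong_open[of U]) (auto intro: pd_component_open)
      finally show ?thesis .
    qed
    show ?thesis unfolding c using assms by (intro pd_commute[of U]) (auto intro: smooth_on_component)
  qed
  then show ?thesis by (simp add: Finite_Cartesian_Product.vec_eq_iff)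
qed

text \<open>The differentiability part of the inverse function theorem, for a map already known to
  be continuous. Near \<open>\<tau> v\<close> the map \<open>F\<close> is almost the identity, so
  increments of \<tau> are almost those of the composition. Continuity is first upgraded to a
  Lipschitz bound, which then controls the remainder.\<close>

lemma has_derivative_of_composition_id:
  fixes F :: "'b::real_normed_vector \<Rightarrow> 'b" and \<tau> :: "'a::real_normed_vector \<Rightarrow> 'b"
  assumes F: "(F has_derivative (\<lambda>h. h)) (at (\<tau> v))" and c: "isCont \<tau> v"
    and G: "((\<lambda>w. F (\<tau> w)) has_derivative G') (at v)"
  shows "(\<tau> has_derivative G') (at v)"
  unfolding has_derivative_at_alt
proof (intro conjI allI impI)
  show bl: "bounded_linear G'" using G has_derivative_bounded_linear by blast
  obtain B where B: "B > 0" "\<And>h. norm (G' h) \<le> norm h * B"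
    using bounded_linear.pos_bounded[OF bl] by blast
  fix e :: real assume e: "e > 0"
  \<comment> \<open>The bound 1/2 lets the error of \<open>F\<close> be absorbed, which gives the
    Lipschitz constant 2 (B + 1) below; the other bound makes \<open>e1\<close> times that constant
    at most e / 2.\<close>
  define e1 where "e1 = min (1/2) (e / (4 * (B + 1)))"
  define e2 where "e2 = min 1 (e / 2)"
  have e1: "e1 > 0" "e1 \<le> 1/2" "e1 * (2 * (B + 1)) \<le> e / 2"
  proof -
    show "e1 > 0" "e1 \<le> 1/2" using e B by (auto simp: e1_def min_def)
    have "e1 * (2 * (B + 1)) \<le> e / (4 * (B + 1)) * (2 * (B + 1))"
      using B by (intro mult_right_mono) (auto simp: e1_def)
    also have "\<dots> = e / 2" using B by (simp add: field_simps)
    finally show "e1 * (2 * (B + 1)) \<le> e / 2" .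
  qed
  have e2: "e2 > 0" "e2 \<le> 1" "e2 \<le> e / 2" using e by (auto simp: e2_def)
  obtain d1 where d1: "d1 > 0"
    "\<And>y. norm (y - \<tau> v) < d1 \<Longrightarrow> norm (F y - F (\<tau> v) - (y - \<tau> v)) \<le> e1 * norm (y - \<tau> v)"
    using F e1(1) unfolding has_derivative_at_alt by blast
  obtain d2 where d2: "d2 > 0"
    "\<And>w. norm (w - v) < d2 \<Longrightarrow> norm (F (\<tau> w) - F (\<tau> v) - G' (w - v)) \<le> e2 * norm (w - v)"
    using G e2(1) unfolding has_derivative_at_alt by blast
  obtain d3 where d3: "d3 > 0" "\<And>w. norm (w - v) < d3 \<Longrightarrow> norm (\<tau> w - \<tau> v) < d1"
    using c d1(1) unfolding continuous_at_eps_delta dist_norm by blast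
  show "\<exists>d>0. \<forall>w. norm (w - v) < d \<longrightarrow> norm (\<tau> w - \<tau> v - G' (w - v)) \<le> e * norm (w - v)"
  proof (intro exI[of _ "min d2 d3"] conjI allI impI)
    show "0 < min d2 d3" using d2 d3 by simp
    fix w assume w: "norm (w - v) < min d2 d3"
    have a: "norm (F (\<tau> w) - F (\<tau> v) - (\<tau> w - \<tau> v)) \<le> e1 * norm (\<tau> w - \<tau> v)"
      using d1(2) d3(2) w by simp
    have b: "norm (F (\<tau> w) - F (\<tau> v) - G' (w - v)) \<le> e2 * norm (w - v)"
      using d2(2) w by simp
    have "norm (\<tau> w - \<tau> v) \<le> norm (F (\<tau> w) - F (\<tau> v)) + norm (F (\<tau> w) - F (\<tau> v) - (\<tau> w - \<tau> v))"
      by (metis norm_minus_commute norm_triangle_sub add.commute)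
    moreover have "e1 * norm (\<tau> w - \<tau> v) \<le> 1/2 * norm (\<tau> w - \<tau> v)"
      using e1 by (intro mult_right_mono) auto
    ultimately have "norm (\<tau> w - \<tau> v) \<le> 2 * norm (F (\<tau> w) - F (\<tau> v))" using a by linarith
    also have "norm (F (\<tau> w) - F (\<tau> v)) \<le> norm (G' (w - v)) + e2 * norm (w - v)"
      using b norm_triangle_sub[of "F (\<tau> w) - F (\<tau> v)" "G' (w - v)"] by linarith
    also have "\<dots> \<le> norm (w - v) * B + 1 * norm (w - v)"
      using B(2) e2 by (intro add_mono mult_right_mono) auto
    finally have t: "norm (\<tau> w - \<tau> v) \<le> 2 * (B + 1) * norm (w - v)" by (simp add: algebra_simps)
    have "norm (\<tau> w - \<tau> v - G' (w - v)) \<le> e1 * norm (\<tau> w - \<tau> v) + e2 * norm (w - v)"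
      using a b norm_triangle_ineq4[of "F (\<tau> w) - F (\<tau> v) - G' (w - v)" "F (\<tau> w) - F (\<tau> v) - (\<tau> w - \<tau> v)"]
      by (simp add: algebra_simps)
    also have "\<dots> \<le> e1 * (2 * (B + 1) * norm (w - v)) + e / 2 * norm (w - v)"
      using t e1 e2 by (intro add_mono mult_left_mono mult_right_mono) auto
    also have "\<dots> \<le> e / 2 * norm (w - v) + e / 2 * norm (w - v)"
      using mult_right_mono[OF e1(3), of "norm (w - v)"] by (simp add: algebra_simps)
    finally show "norm (\<tau> w - \<tau> v - G' (w - v)) \<le> e * norm (w - v)" by simp
  qed
qed

section \<open>Transition maps between parametrizations\<close>

lemma local_paramD:
  assumes "local_param \<Sigma> U \<phi>"
  shows "open U" "smooth_on U \<phi>" "\<phi> ` U \<subseteq> \<Sigma>" "u \<in> U \<Longrightarrow> \<phi> u \<in> \<Sigma>"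
  using assms unfolding local_param_def by (auto dest: openin_imp_subset)

text \<open>A linear left inverse \<open>L\<close> of the derivative of \<phi> makes the composition
  of \<open>L\<close> with \<phi> tangent to the identity, while near \<open>v\<close> the maps
  \<open>L (\<phi> (\<psi> (\<phi>' w)))\<close> and \<open>L (\<phi>' w)\<close> agree and the
  latter is differentiable. So \<open>has_derivative_of_composition_id\<close> applies although
  \<psi> is only known to be continuous.\<close>

lemma local_param_transition:
  assumes P: "local_param \<Sigma> U \<phi>" and Q: "local_param \<Sigma> U' \<phi>'"
    and h: "homeomorphism U (\<phi> ` U) \<phi> \<psi>"
    and v: "v \<in> U'" "\<phi>' v \<in> \<phi> ` U"
  shows "\<exists>V. open V \<and> v \<in> V \<and> V \<subseteq> U' \<and> (\<forall>w\<in>V. \<psi> (\<phi>' w) \<in> U \<and> \<phi> (\<psi> (\<phi>' w)) = \<phi>' w)"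
    and "(\<lambda>w. \<psi> (\<phi>' w)) differentiable (at v)"
proof -
  obtain Q where Q: "open Q" "\<phi> ` U = \<Sigma> \<inter> Q"
    using P unfolding local_param_def openin_open by auto
  note p = local_paramD[OF P] and q = local_paramD[OF assms(2)]
  define V where "V = U' \<inter> \<phi>' -` Q"
  have V: "open V" "v \<in> V" "V \<subseteq> U'"
    using continuous_open_preimage[OF smooth_on_continuous_on[OF q(2)] q(1) Q(1)] v Q
    by (auto simp: V_def)
  have im: "\<phi>' w \<in> \<phi> ` U" if "w \<in> V" for w
    using that Q(2) q(4)[of w] by (auto simp: V_def)
  have inv: "\<psi> (\<phi>' w) \<in> U \<and> \<phi> (\<psi> (\<phi>' w)) = \<phi>' w" if "w \<in> V" for w
    using im[OF that] h unfolding homeomorphism_def by auto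
  then show "\<exists>V. open V \<and> v \<in> V \<and> V \<subseteq> U' \<and> (\<forall>w\<in>V. \<psi> (\<phi>' w) \<in> U \<and> \<phi> (\<psi> (\<phi>' w)) = \<phi>' w)"
    using V by blast
  let ?\<tau> = "\<lambda>w. \<psi> (\<phi>' w)"
  have "continuous_on V ?\<tau>"
  proof (rule continuous_on_compose2[of "\<phi> ` U" \<psi>])
    show "continuous_on (\<phi> ` U) \<psi>" using h unfolding homeomorphism_def by simp
    show "continuous_on V \<phi>'" using continuous_on_subset[OF smooth_on_continuous_on[OF q(2)] V(3)] .
  qed (use im in auto)
  then have cont: "isCont ?\<tau> v" using continuous_on_eq_continuous_at[OF V(1), of ?\<tau>] V(2) by blast
  have u: "?\<tau> v \<in> U" using inv V by blast
  let ?A = "frechet_derivative \<phi> (at (?\<tau> v))"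
  have A: "(\<phi> has_derivative ?A) (at (?\<tau> v))"
    using smooth_on_differentiable[OF p(2) u] frechet_derivative_works by blast
  have "linear ?A" "inj ?A"
    using A has_derivative_linear P u unfolding local_param_def by blast+
  then obtain L where L: "linear L" "L \<circ> ?A = id"
    using linear_injective_left_inverse by blast
  have bL: "bounded_linear L" using L by (simp add: linear_conv_bounded_linear)
  have "((\<lambda>y. L (\<phi> y)) has_derivative (\<lambda>h. L (?A h))) (at (?\<tau> v))"
    using bounded_linear.has_derivative[OF bL A] .
  then have F: "((\<lambda>y. L (\<phi> y)) has_derivative (\<lambda>h. h)) (at (?\<tau> v))"
    using L(2) by (simp add: fun_eq_iff)
  let ?G = "frechet_derivative \<phi>' (at v)"
  have "(\<phi>' has_derivative ?G) (at v)"
    using smooth_on_differentiable[OF q(2) v(1)] frechet_derivative_works by blast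
  then have "((\<lambda>w. L (\<phi>' w)) has_derivative (\<lambda>h. L (?G h))) (at v)"
    using bounded_linear.has_derivative[OF bL] by blast
  then have "((\<lambda>w. L (\<phi> (?\<tau> w))) has_derivative (\<lambda>h. L (?G h))) (at v)"
    by (rule has_derivative_transform_within_open[where s=V]) (use V inv in auto)
  from has_derivative_of_composition_id[OF F cont this]
  show "?\<tau> differentiable (at v)" by (rule differentiableI)
qed

text \<open>The Jacobian of the transition map is characterised by its effect on the parametrization
  and on scalar functions. Functions on the surface are extended by zero and have no ambient
  derivative, so the chain rule has to be phrased for the compositions
  \<open>f \<circ> \<phi>\<close>.\<close>

definition jacobi_matrix ::
    "(real^2 \<Rightarrow> real^'m) \<Rightarrow> real^2 \<Rightarrow> (real^2 \<Rightarrow> real^'m) \<Rightarrow> real^2 \<Rightarrow> (2 \<Rightarrow> 2 \<Rightarrow> real) \<Rightarrow> bool" where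
  "jacobi_matrix \<phi> u \<phi>' v A \<longleftrightarrow>
     (\<forall>a. pd a \<phi>' v = A a 1 *\<^sub>R pd 1 \<phi> u + A a 2 *\<^sub>R pd 2 \<phi> u) \<and>
     (\<forall>f :: real^'m \<Rightarrow> real. (f \<circ> \<phi>) differentiable (at u) \<longrightarrow>
        (\<forall>a. pd a (f \<circ> \<phi>') v = A a 1 * pd 1 (f \<circ> \<phi>) u + A a 2 * pd 2 (f \<circ> \<phi>) u))"

lemma jacobi_matrix_exists:
  fixes \<Sigma> :: "(real^'m) set"
  assumes P: "local_param \<Sigma> U \<phi>" and Q: "local_param \<Sigma> U' \<phi>'"
    and uv: "u \<in> U" "v \<in> U'" "\<phi> u = \<phi>' v"
  shows "\<exists>A. jacobi_matrix \<phi> u \<phi>' v A"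
proof -
  obtain \<psi> where h: "homeomorphism U (\<phi> ` U) \<phi> \<psi>" using P unfolding local_param_def by blast
  have v: "\<phi>' v \<in> \<phi> ` U" using uv by (metis imageI)
  let ?\<tau> = "\<lambda>w. \<psi> (\<phi>' w)"
  obtain V where V: "open V" "v \<in> V" "\<And>w. w \<in> V \<Longrightarrow> \<phi> (?\<tau> w) = \<phi>' w"
    using local_param_transition(1)[OF P Q h uv(2) v] by blast
  have d: "?\<tau> differentiable (at v)" using local_param_transition(2)[OF P Q h uv(2) v] .
  have \<tau>v: "?\<tau> v = u" using h uv unfolding homeomorphism_def by metis
  define A where "A a b = pd a ?\<tau> v $ b" for a b :: 2
  have ch: "pd a F' v = A a 1 *\<^sub>R pd 1 F u + A a 2 *\<^sub>R pd 2 F u"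
    if "F differentiable (at u)" "\<And>w. w \<in> V \<Longrightarrow> F' w = F (?\<tau> w)" for F F' :: "real^2 \<Rightarrow> 'c::real_normed_vector" and a
  proof -
    have "((\<lambda>w. F (?\<tau> w)) has_derivative (\<lambda>h. (h $ 1 *\<^sub>R pd 1 ?\<tau> v + h $ 2 *\<^sub>R pd 2 ?\<tau> v)$1 *\<^sub>R pd 1 F u
       + (h $ 1 *\<^sub>R pd 1 ?\<tau> v + h $ 2 *\<^sub>R pd 2 ?\<tau> v)$2 *\<^sub>R pd 2 F u)) (at v)"
      by (rule has_derivative_compose[OF has_derivative_pd[OF d]])
        (simp only: \<tau>v has_derivative_pd[OF that(1)])
    note pd_I[OF this, of a]
    moreover have "pd a F' v = pd a (\<lambda>w. F (?\<tau> w)) v"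
      using V that(2) by (intro pd_cong_open[of V])
    ultimately show ?thesis using exhaust_2[of a] by (auto simp: axis_def A_def)
  qed
  have "\<forall>a. pd a (f \<circ> \<phi>') v = A a 1 * pd 1 (f \<circ> \<phi>) u + A a 2 * pd 2 (f \<circ> \<phi>) u"
    if "(f \<circ> \<phi>) differentiable (at u)" for f :: "real^'m \<Rightarrow> real"
    using ch[OF that, of "f \<circ> \<phi>'"] V(3) by simp
  moreover have "\<forall>a. pd a \<phi>' v = A a 1 *\<^sub>R pd 1 \<phi> u + A a 2 *\<^sub>R pd 2 \<phi> u"
    using ch[of \<phi> \<phi>'] V(3) smooth_on_differentiable[OF local_paramD(2)[OF P] uv(1)] by simp
  ultimately have "jacobi_matrix \<phi> u \<phi>' v A" unfolding jacobi_matrix_def by blast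
  then show ?thesis by blast
qed

section \<open>Chart independence and smooth functions on the surface\<close>

lemma local_param_restrict:
  assumes P: "local_param \<Sigma> U \<phi>" and V: "open V" "V \<subseteq> U"
  shows "local_param \<Sigma> V \<phi>"
proof -
  obtain \<psi> where h: "homeomorphism U (\<phi> ` U) \<phi> \<psi>" using P unfolding local_param_def by blast
  have "openin (top_of_set U) V" using V by (simp add: open_subset)
  then have "openin (top_of_set (\<phi> ` U)) (\<phi> ` V)"
    using homeomorphism_imp_open_map[OF h] by blast
  then have "openin (top_of_set \<Sigma>) (\<phi> ` V)"
    using P openin_trans unfolding local_param_def by blast
  moreover have "homeomorphism V (\<phi> ` V) \<phi> \<psi>"
    using homeomorphism_of_subsets[OF h V(2)] by blast
  moreover have "smooth_on V \<phi>" using P V smooth_on_subset unfolding local_param_def by blast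
  ultimately show ?thesis using P V unfolding local_param_def by blast
qed

section \<open>Reversing the orientation of a chart\<close>

definition swap2 :: "real^2 \<Rightarrow> real^2" where
  "swap2 v = (\<chi> i. if i = 1 then v $ 2 else v $ 1)"

lemma swap2_swap2 [simp]: "swap2 (swap2 v) = v"
  by (simp add: swap2_def Finite_Cartesian_Product.vec_eq_iff forall_2)

lemma linear_swap2: "linear swap2"
  by (rule linearI) (simp_all add: swap2_def Finite_Cartesian_Product.vec_eq_iff)

lemma bounded_linear_swap2: "bounded_linear swap2"
  using linear_swap2 by (simp add: linear_conv_bounded_linear)

lemma swap2_has_derivative: "(swap2 has_derivative swap2) (at u)"
  using bounded_linear_imp_has_derivative[OF bounded_linear_swap2] .

lemma swap2_vimage: "swap2 -` U = swap2 ` U"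
  by (auto simp: image_iff) (metis swap2_swap2)

lemma continuous_on_swap2: "continuous_on S swap2"
  using linear_continuous_on[OF bounded_linear_swap2] .

lemma open_swap2_image: "open U \<Longrightarrow> open (swap2 ` U)"
  using continuous_on_open_vimage[of UNIV swap2] continuous_on_swap2[of UNIV]
  by (simp flip: swap2_vimage)

lemma pd_swap2:
  assumes "F differentiable (at (swap2 u))"
  shows "pd 1 (\<lambda>v. F (swap2 v)) u = pd 2 F (swap2 u)" "pd 2 (\<lambda>v. F (swap2 v)) u = pd 1 F (swap2 u)"
    "(\<lambda>v. F (swap2 v)) differentiable (at u)"
proof -
  note * = has_derivative_compose[OF swap2_has_derivative has_derivative_pd[OF assms]]
  show "pd 1 (\<lambda>v. F (swap2 v)) u = pd 2 F (swap2 u)" "pd 2 (\<lambda>v. F (swap2 v)) u = pd 1 F (swap2 u)"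
    using pd_I[OF *, of 1] pd_I[OF *, of 2] by (simp_all add: axis_def swap2_def)
  show "(\<lambda>v. F (swap2 v)) differentiable (at u)" using * by (rule differentiableI)
qed

lemma Ck_on_swap2:
  assumes "open U"
  shows "Ck_on k U F \<Longrightarrow> Ck_on k (swap2 ` U) (\<lambda>v. F (swap2 v))"
proof (induction k arbitrary: F)
  case 0
  then have "continuous_on U F" by simp
  then have "continuous_on (swap2 ` U) (\<lambda>v. F (swap2 v))"
    by (rule continuous_on_compose2[OF _ continuous_on_swap2]) auto
  then show ?case by simp
next
  case (Suc k)
  have d: "F differentiable (at (swap2 v))" if "v \<in> swap2 ` U" for v using that Suc.prems by auto
  have "Ck_on k (swap2 ` U) (pd 1 (\<lambda>v. F (swap2 v)))"
    by (rule Ck_on_cong[OF open_swap2_image[OF assms] _ Suc.IH[of "pd 2 F"]])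
      (use d Suc.prems in \<open>simp_all add: pd_swap2\<close>)
  moreover have "Ck_on k (swap2 ` U) (pd 2 (\<lambda>v. F (swap2 v)))"
    by (rule Ck_on_cong[OF open_swap2_image[OF assms] _ Suc.IH[of "pd 1 F"]])
      (use d Suc.prems in \<open>simp_all add: pd_swap2\<close>)
  moreover have "(\<lambda>v. F (swap2 v)) differentiable (at u)" if "u \<in> swap2 ` U" for u
    using pd_swap2(3)[OF d[OF that]] .
  ultimately show ?case by (simp add: forall_2 del: ball_simps)
qed

lemma local_param_swap2:
  assumes P: "local_param \<Sigma> U \<phi>"
  shows "local_param \<Sigma> (swap2 ` U) (\<lambda>v. \<phi> (swap2 v))"
proof -
  note p = local_paramD[OF P]
  obtain \<psi> where h: "homeomorphism U (\<phi> ` U) \<phi> \<psi>" using P unfolding local_param_def by blast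
  have im: "(\<lambda>v. \<phi> (swap2 v)) ` swap2 ` U = \<phi> ` U" by (simp add: image_image)
  have "homeomorphism (swap2 ` U) U swap2 swap2"
    by (rule homeomorphismI) (auto intro: continuous_on_swap2)
  from homeomorphism_compose[OF this h]
  have "homeomorphism (swap2 ` U) (\<phi> ` U) (\<lambda>v. \<phi> (swap2 v)) (swap2 \<circ> \<psi>)" by (simp add: o_def)
  moreover have "inj (frechet_derivative (\<lambda>v. \<phi> (swap2 v)) (at u))" if "u \<in> swap2 ` U" for u
  proof -
    have u: "swap2 u \<in> U" using that by auto
    have "(\<phi> has_derivative frechet_derivative \<phi> (at (swap2 u))) (at (swap2 u))"
      using smooth_on_differentiable[OF p(2) u] frechet_derivative_works by blast
    from frechet_derivative_at[OF has_derivative_compose[OF swap2_has_derivative this]]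
    have "frechet_derivative (\<lambda>v. \<phi> (swap2 v)) (at u) = (\<lambda>h. frechet_derivative \<phi> (at (swap2 u)) (swap2 h))"
      by simp
    moreover have "inj (frechet_derivative \<phi> (at (swap2 u)))" using P u unfolding local_param_def by blast
    ultimately show ?thesis by (simp add: inj_def) (metis swap2_swap2)
  qed
  moreover have "smooth_on (swap2 ` U) (\<lambda>v. \<phi> (swap2 v))"
    using p(1,2) Ck_on_swap2 unfolding smooth_on_def by blast
  ultimately show ?thesis
    using P open_swap2_image[OF p(1)] im unfolding local_param_def by auto
qed

lemma symplectic_form_flip:
  assumes "symplectic_form \<Sigma> \<omega>" "p \<in> \<Sigma>"
  shows "\<omega> p v w = - \<omega> p w v"
proof -
  have b: "bilinear (\<omega> p)" and a: "\<And>v. \<omega> p v v = 0" using assms unfolding symplectic_form_def by auto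
  have "\<omega> p (v + w) (v + w) = \<omega> p v w + \<omega> p w v"
    unfolding bilinear_ladd[OF b] bilinear_radd[OF b] by (simp add: a)
  then have "\<omega> p v w + \<omega> p w v = 0" using a[of "v + w"] by simp
  then show ?thesis by linarith
qed

text \<open>The sign of \<open>rho\<close> may vary over a disconnected parameter domain, so the
  domain is cut down to the open set where \<open>rho\<close> has the sign found at the given point.
  If that sign is negative, the two parameters are exchanged.\<close>

lemma oriented_param_exists:
  assumes S: "closed_surface \<Sigma>" and W: "symplectic_form \<Sigma> \<omega>" and p: "p \<in> \<Sigma>"
  obtains U \<phi> u where "oriented_param \<Sigma> \<omega> U \<phi>" "u \<in> U" "\<phi> u = p"
proof -
  obtain U \<phi> where P: "local_param \<Sigma> U \<phi>" "p \<in> \<phi> ` U" using S p unfolding closed_surface_def by blast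
  then obtain u where u: "u \<in> U" "\<phi> u = p" by blast
  have U: "open U" "smooth_on U \<phi>" using local_paramD[OF P(1)] by auto
  have r: "smooth_on U (rho \<omega> \<phi>)" "rho \<omega> \<phi> u \<noteq> 0" using W P u unfolding symplectic_form_def by auto
  note c = smooth_on_continuous_on[OF r(1)]
  show ?thesis
  proof (cases "rho \<omega> \<phi> u > 0")
    case True
    define V where "V = U \<inter> rho \<omega> \<phi> -` {0<..}"
    have "open V" unfolding V_def by (rule continuous_open_preimage[OF c U(1)]) simp
    then have "oriented_param \<Sigma> \<omega> V \<phi>"
      using local_param_restrict[OF P(1)] unfolding oriented_param_def V_def by auto
    then show ?thesis using that u True unfolding V_def by blast
  next
    case False
    define V where "V = U \<inter> rho \<omega> \<phi> -` {..<0}"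
    have "open V" unfolding V_def by (rule continuous_open_preimage[OF c U(1)]) simp
    then have PV: "local_param \<Sigma> V \<phi>"
      using local_param_restrict[OF P(1)] unfolding V_def by auto
    have "rho \<omega> (\<lambda>v. \<phi> (swap2 v)) w > 0" if "w \<in> swap2 ` V" for w
    proof -
      have w: "swap2 w \<in> V" using that by auto
      have "\<phi> differentiable (at (swap2 w))"
        using smooth_on_differentiable[OF local_paramD(2)[OF PV] w] .
      then have "rho \<omega> (\<lambda>v. \<phi> (swap2 v)) w = - rho \<omega> \<phi> (swap2 w)"
        using symplectic_form_flip[OF W local_paramD(4)[OF PV w], of "pd 2 \<phi> (swap2 w)"]
        by (simp add: rho_def pd_swap2)
      then show ?thesis using w by (simp add: V_def)
    qed
    then have "oriented_param \<Sigma> \<omega> (swap2 ` V) (\<lambda>v. \<phi> (swap2 v))"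
      using local_param_swap2[OF PV] unfolding oriented_param_def by blast
    moreover have "swap2 u \<in> swap2 ` V" using u r False by (auto simp: V_def)
    ultimately show ?thesis using that u(2) by (metis swap2_swap2)
  qed
qed

lemma param_at_works:
  assumes "closed_surface \<Sigma>" "symplectic_form \<Sigma> \<omega>" "p \<in> \<Sigma>"
  obtains U \<phi> u where "param_at \<Sigma> \<omega> p = (\<phi>, u)" "oriented_param \<Sigma> \<omega> U \<phi>" "u \<in> U" "\<phi> u = p"
proof -
  obtain U \<phi> u where "oriented_param \<Sigma> \<omega> U \<phi>" "u \<in> U" "\<phi> u = p"
    using oriented_param_exists[OF assms] .
  then have "\<exists>x. case x of (\<phi>, u) \<Rightarrow> \<exists>U. oriented_param \<Sigma> \<omega> U \<phi> \<and> u \<in> U \<and> \<phi> u = p" by auto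
  from someI_ex[OF this] show ?thesis
    using that unfolding param_at_def[symmetric] by (cases "param_at \<Sigma> \<omega> p") auto
qed

lemma rho_change:
  assumes W: "symplectic_form \<Sigma> \<omega>" and p: "\<phi> u \<in> \<Sigma>" "\<phi>' v = \<phi> u"
    and J: "jacobi_matrix \<phi> u \<phi>' v A"
  shows "rho \<omega> \<phi>' v = (A 1 1 * A 2 2 - A 1 2 * A 2 1) * rho \<omega> \<phi> u"
proof -
  have A: "pd a \<phi>' v = A a 1 *\<^sub>R pd 1 \<phi> u + A a 2 *\<^sub>R pd 2 \<phi> u" for a
    using J unfolding jacobi_matrix_def by blast
  have b: "bilinear (\<omega> (\<phi> u))" and a: "\<And>v. \<omega> (\<phi> u) v v = 0" using assms unfolding symplectic_form_def by auto
  have f: "\<omega> (\<phi> u) (pd 2 \<phi> u) (pd 1 \<phi> u) = - \<omega> (\<phi> u) (pd 1 \<phi> u) (pd 2 \<phi> u)"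
    using symplectic_form_flip[OF W p(1)] .
  show ?thesis unfolding rho_def p(2) A
    by (simp add: bilinear_ladd[OF b] bilinear_radd[OF b] bilinear_lmul[OF b] bilinear_rmul[OF b] a f algebra_simps)
qed

lemma smooth_fun_comp: "f \<in> smooth_fun \<Sigma> \<Longrightarrow> local_param \<Sigma> U \<phi> \<Longrightarrow> smooth_on U (f \<circ> \<phi>)"
  unfolding smooth_fun_def by blast

lemma rho_nonzero: "symplectic_form \<Sigma> \<omega> \<Longrightarrow> local_param \<Sigma> U \<phi> \<Longrightarrow> u \<in> U \<Longrightarrow> rho \<omega> \<phi> u \<noteq> 0"
  unfolding symplectic_form_def by blast

text \<open>A change of chart multiplies the numerator and \<open>rho\<close> by the same Jacobian
  determinant, whatever its sign. Hence the bracket may be computed in any local parametrization,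
  oriented or not.\<close>

lemma poisson_bracket_local:
  fixes \<Sigma> :: "(real^'m) set"
  assumes S: "closed_surface \<Sigma>" and W: "symplectic_form \<Sigma> \<omega>"
    and P: "local_param \<Sigma> U \<phi>" "u \<in> U" and f: "f \<in> smooth_fun \<Sigma>" "h \<in> smooth_fun \<Sigma>"
  shows "poisson_bracket \<Sigma> \<omega> f h (\<phi> u)
    = (pd 1 (f \<circ> \<phi>) u * pd 2 (h \<circ> \<phi>) u - pd 2 (f \<circ> \<phi>) u * pd 1 (h \<circ> \<phi>) u) / rho \<omega> \<phi> u"
proof -
  have p: "\<phi> u \<in> \<Sigma>" using local_paramD(4)[OF P] .
  obtain U' \<phi>' v where q: "param_at \<Sigma> \<omega> (\<phi> u) = (\<phi>', v)" "oriented_param \<Sigma> \<omega> U' \<phi>'" "v \<in> U'" "\<phi>' v = \<phi> u"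
    using param_at_works[OF S W p] .
  have P': "local_param \<Sigma> U' \<phi>'" using q unfolding oriented_param_def by blast
  obtain A where A: "jacobi_matrix \<phi> u \<phi>' v A"
    using jacobi_matrix_exists[OF P(1) P' P(2) q(3) q(4)[symmetric]] by blast
  have d: "(f \<circ> \<phi>) differentiable (at u)" "(h \<circ> \<phi>) differentiable (at u)"
    using f P smooth_fun_comp smooth_on_differentiable by blast+
  let ?d = "A 1 1 * A 2 2 - A 1 2 * A 2 1"
  have r: "rho \<omega> \<phi>' v = ?d * rho \<omega> \<phi> u" using rho_change[where A=A, OF W p q(4) A] .
  have nz: "?d \<noteq> 0" using r rho_nonzero[OF W P' q(3)] by auto
  have "pd 1 (f \<circ> \<phi>') v * pd 2 (h \<circ> \<phi>') v - pd 2 (f \<circ> \<phi>') v * pd 1 (h \<circ> \<phi>') v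
    = ?d * (pd 1 (f \<circ> \<phi>) u * pd 2 (h \<circ> \<phi>) u - pd 2 (f \<circ> \<phi>) u * pd 1 (h \<circ> \<phi>) u)"
    using A d unfolding jacobi_matrix_def by (simp add: algebra_simps)
  then show ?thesis unfolding poisson_bracket_def using p q(1) r nz by simp
qed

lemma gmat_det: "Determinants.det (gmat \<phi> u)
  = (pd 1 \<phi> u \<bullet> pd 1 \<phi> u) * (pd 2 \<phi> u \<bullet> pd 2 \<phi> u) - (pd 1 \<phi> u \<bullet> pd 2 \<phi> u)\<^sup>2"
  by (simp add: det_2 gmat_def power2_eq_square inner_commute)

lemma gmat_det_pos:
  assumes P: "local_param \<Sigma> U \<phi>" "u \<in> U"
  shows "Determinants.det (gmat \<phi> u) > 0"
proof (rule ccontr)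
  let ?a = "pd 1 \<phi> u" and ?b = "pd 2 \<phi> u"
  assume "\<not> Determinants.det (gmat \<phi> u) > 0"
  moreover have "(?a \<bullet> ?b)\<^sup>2 \<le> (?a \<bullet> ?a) * (?b \<bullet> ?b)" by (rule Cauchy_Schwarz_ineq)
  ultimately have z: "(?a \<bullet> ?a) * (?b \<bullet> ?b) = (?a \<bullet> ?b)\<^sup>2" unfolding gmat_det by simp
  \<comment> \<open>Up to a factor this is the component of \<open>?a\<close> orthogonal to
    \<open>?b\<close>; its squared length is that of \<open>?b\<close> times the Gram determinant.
    If the determinant vanishes, the coefficients of \<open>?w\<close> give a kernel vector of the
    injective derivative.\<close>
  let ?w = "(?b \<bullet> ?b) *\<^sub>R ?a - (?a \<bullet> ?b) *\<^sub>R ?b"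
  have "?w \<bullet> ?w = (?b \<bullet> ?b) * ((?a \<bullet> ?a) * (?b \<bullet> ?b) - (?a \<bullet> ?b)\<^sup>2)"
    by (simp add: inner_diff_left inner_diff_right inner_commute power2_eq_square algebra_simps)
  then have w: "?w = 0" using z by simp
  have dd: "\<phi> differentiable (at u)"
    using P local_paramD(2) smooth_on_differentiable by blast
  have D: "frechet_derivative \<phi> (at u) = (\<lambda>h. h$1 *\<^sub>R ?a + h$2 *\<^sub>R ?b)"
    using frechet_derivative_at[OF has_derivative_pd[OF dd]] by simp
  have inj: "inj (frechet_derivative \<phi> (at u))" using P unfolding local_param_def by blast
  define h :: "real^2" where "h = vector [?b \<bullet> ?b, - (?a \<bullet> ?b)]"
  have "frechet_derivative \<phi> (at u) h = frechet_derivative \<phi> (at u) 0"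
    using w by (simp add: D h_def)
  then have "h = 0" using inj by (metis injD)
  then have "?b = 0" by (simp add: h_def Finite_Cartesian_Product.vec_eq_iff forall_2)
  then have "frechet_derivative \<phi> (at u) (axis 2 1) = frechet_derivative \<phi> (at u) 0"
    by (simp add: D axis_def)
  then have "axis 2 1 = (0 :: real^2)" using inj by (metis injD)
  then show False by (simp add: axis_eq_0_iff)
qed

text \<open>The square root scales by the absolute value of the Jacobian determinant,
  \<open>rho\<close> by the determinant itself. Both charts being oriented makes the determinant
  positive, so the two factors cancel.\<close>

lemma gamma_fun_local:
  fixes \<Sigma> :: "(real^'m) set"
  assumes S: "closed_surface \<Sigma>" and W: "symplectic_form \<Sigma> \<omega>"
    and P: "oriented_param \<Sigma> \<omega> U \<phi>" "u \<in> U"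
  shows "gamma_fun \<Sigma> \<omega> (\<phi> u) = sqrt (Determinants.det (gmat \<phi> u)) / rho \<omega> \<phi> u"
proof -
  have P1: "local_param \<Sigma> U \<phi>" using P unfolding oriented_param_def by blast
  have p: "\<phi> u \<in> \<Sigma>" using local_paramD(4)[OF P1 P(2)] .
  obtain U' \<phi>' v where q: "param_at \<Sigma> \<omega> (\<phi> u) = (\<phi>', v)" "oriented_param \<Sigma> \<omega> U' \<phi>'" "v \<in> U'" "\<phi>' v = \<phi> u"
    using param_at_works[OF S W p] .
  have P': "local_param \<Sigma> U' \<phi>'" using q unfolding oriented_param_def by blast
  obtain A where A: "jacobi_matrix \<phi> u \<phi>' v A"
    using jacobi_matrix_exists[OF P1 P' P(2) q(3) q(4)[symmetric]] by blast
  let ?d = "A 1 1 * A 2 2 - A 1 2 * A 2 1"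
  have r: "rho \<omega> \<phi>' v = ?d * rho \<omega> \<phi> u" using rho_change[where A=A, OF W p q(4) A] .
  have "rho \<omega> \<phi>' v > 0" "rho \<omega> \<phi> u > 0" using q P unfolding oriented_param_def by auto
  then have pos: "?d > 0" using r by (simp add: zero_less_mult_iff)
  have "Determinants.det (gmat \<phi>' v) = ?d\<^sup>2 * Determinants.det (gmat \<phi> u)"
    unfolding gmat_det A[unfolded jacobi_matrix_def, THEN conjunct1, rule_format]
    by (simp add: inner_add_left inner_add_right inner_commute power2_eq_square algebra_simps)
  then have "sqrt (Determinants.det (gmat \<phi>' v)) = ?d * sqrt (Determinants.det (gmat \<phi> u))"
    using pos by (simp add: real_sqrt_mult)
  then show ?thesis unfolding gamma_fun_def using p q(1) r pos by simp
qed

lemma gamma_fun_pos: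
  assumes S: "closed_surface \<Sigma>" and W: "symplectic_form \<Sigma> \<omega>" and p: "p \<in> \<Sigma>"
  shows "gamma_fun \<Sigma> \<omega> p > 0"
proof -
  obtain U \<phi> u where P: "oriented_param \<Sigma> \<omega> U \<phi>" "u \<in> U" "\<phi> u = p"
    using oriented_param_exists[OF assms] .
  then have "rho \<omega> \<phi> u > 0" "local_param \<Sigma> U \<phi>" unfolding oriented_param_def by auto
  then show ?thesis using gamma_fun_local[OF S W P(1,2)] gmat_det_pos[of \<Sigma> U \<phi> u] P by simp
qed

section \<open>The algebra of smooth functions on the surface\<close>

lemma smooth_funI:
  "(\<And>x. x \<notin> \<Sigma> \<Longrightarrow> f x = 0) \<Longrightarrow> (\<And>U \<phi>. local_param \<Sigma> U \<phi> \<Longrightarrow> smooth_on U (f \<circ> \<phi>)) \<Longrightarrow> f \<in> smooth_fun \<Sigma>"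
  unfolding smooth_fun_def by blast

lemma smooth_fun_outside: "f \<in> smooth_fun \<Sigma> \<Longrightarrow> x \<notin> \<Sigma> \<Longrightarrow> f x = 0"
  unfolding smooth_fun_def by blast

lemma smooth_fun_add:
  assumes "f \<in> smooth_fun \<Sigma>" "h \<in> smooth_fun \<Sigma>"
  shows "(\<lambda>x. f x + h x) \<in> smooth_fun \<Sigma>"
proof (rule smooth_funI)
  fix U \<phi> assume P: "local_param \<Sigma> U \<phi>"
  show "smooth_on U ((\<lambda>x. f x + h x) \<circ> \<phi>)"
    using smooth_on_add[OF local_paramD(1)[OF P] smooth_fun_comp[OF assms(1) P] smooth_fun_comp[OF assms(2) P]]
    by (simp add: o_def)
qed (use assms in \<open>simp add: smooth_fun_outside\<close>)

lemma smooth_fun_mult: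
  assumes "f \<in> smooth_fun \<Sigma>" "h \<in> smooth_fun \<Sigma>"
  shows "(\<lambda>x. f x * h x) \<in> smooth_fun \<Sigma>"
proof (rule smooth_funI)
  fix U \<phi> assume P: "local_param \<Sigma> U \<phi>"
  show "smooth_on U ((\<lambda>x. f x * h x) \<circ> \<phi>)"
    using smooth_on_mult[OF local_paramD(1)[OF P] smooth_fun_comp[OF assms(1) P] smooth_fun_comp[OF assms(2) P]]
    by (simp add: o_def)
qed (use assms in \<open>simp add: smooth_fun_outside\<close>)

lemma smooth_fun_cmult:
  assumes "f \<in> smooth_fun \<Sigma>"
  shows "(\<lambda>x. c * f x) \<in> smooth_fun \<Sigma>"
proof (rule smooth_funI)
  fix U \<phi> assume P: "local_param \<Sigma> U \<phi>"
  show "smooth_on U ((\<lambda>x. c * f x) \<circ> \<phi>)"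
    using smooth_on_mult[OF local_paramD(1)[OF P] smooth_on_const smooth_fun_comp[OF assms(1) P], of c]
    by (simp add: o_def)
qed (use assms in \<open>simp add: smooth_fun_outside\<close>)

lemma smooth_fun_zero: "(\<lambda>x. 0) \<in> smooth_fun \<Sigma>"
  by (rule smooth_funI) (simp_all add: o_def)

lemma smooth_fun_sum:
  "(\<And>i. i \<in> I \<Longrightarrow> f i \<in> smooth_fun \<Sigma>) \<Longrightarrow> (\<lambda>x. \<Sum>i\<in>I. f i x) \<in> smooth_fun \<Sigma>"
  by (induction I rule: infinite_finite_induct) (simp_all add: smooth_fun_zero smooth_fun_add)

lemma smooth_fun_sqrt:
  assumes "f \<in> smooth_fun \<Sigma>" "\<And>x. x \<in> \<Sigma> \<Longrightarrow> f x > 0"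
  shows "(\<lambda>x. sqrt (f x)) \<in> smooth_fun \<Sigma>"
proof (rule smooth_funI)
  fix U \<phi> assume P: "local_param \<Sigma> U \<phi>"
  show "smooth_on U ((\<lambda>x. sqrt (f x)) \<circ> \<phi>)"
    using smooth_on_sqrt[OF local_paramD(1)[OF P] _ smooth_fun_comp[OF assms(1) P]] assms(2) local_paramD(4)[OF P]
    by (simp add: o_def)
qed (use assms in \<open>simp add: smooth_fun_outside\<close>)

lemma coord_fun_comp: "local_param \<Sigma> U \<phi> \<Longrightarrow> u \<in> U \<Longrightarrow> (coord_fun \<Sigma> j \<circ> \<phi>) u = \<phi> u $ j"
  using local_paramD(4) by (fastforce simp: coord_fun_def)

lemma coord_fun_smooth: "coord_fun \<Sigma> j \<in> smooth_fun \<Sigma>"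
proof (rule smooth_funI)
  fix U \<phi> assume P: "local_param \<Sigma> U \<phi>"
  show "smooth_on U (coord_fun \<Sigma> j \<circ> \<phi>)"
    by (rule smooth_on_cong[OF local_paramD(1)[OF P] _ smooth_on_component[OF local_paramD(1)[OF P] local_paramD(2)[OF P], of j]])
      (simp add: coord_fun_comp[OF P, unfolded o_def])
qed (simp add: coord_fun_def)

lemma pd_coord_fun:
  assumes P: "local_param \<Sigma> U \<phi>" "u \<in> U"
  shows "pd a (coord_fun \<Sigma> j \<circ> \<phi>) u = pd a \<phi> u $ j"
  using pd_cong_open[OF local_paramD(1)[OF P(1)] P(2), of "coord_fun \<Sigma> j \<circ> \<phi>" "\<lambda>v. \<phi> v $ j"]
    coord_fun_comp[OF P(1)] pd_component_open[OF local_paramD(1)[OF P(1)] P(2) local_paramD(2)[OF P(1)]]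
  by simp

lemma poisson_bracket_smooth:
  assumes S: "closed_surface \<Sigma>" and W: "symplectic_form \<Sigma> \<omega>"
    and f: "f \<in> smooth_fun \<Sigma>" "h \<in> smooth_fun \<Sigma>"
  shows "poisson_bracket \<Sigma> \<omega> f h \<in> smooth_fun \<Sigma>"
proof (rule smooth_funI)
  fix U \<phi> assume P: "local_param \<Sigma> U \<phi>"
  have r: "smooth_on U (rho \<omega> \<phi>)" "\<forall>u\<in>U. rho \<omega> \<phi> u \<noteq> 0"
    using W P unfolding symplectic_form_def by auto
  have "smooth_on U (\<lambda>u. (pd 1 (f \<circ> \<phi>) u * pd 2 (h \<circ> \<phi>) u - pd 2 (f \<circ> \<phi>) u * pd 1 (h \<circ> \<phi>) u) / rho \<omega> \<phi> u)"
    by (intro smooth_on_divide smooth_on_diff smooth_on_mult smooth_on_pd local_paramD(1)[OF P]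
        smooth_fun_comp[OF f(1) P] smooth_fun_comp[OF f(2) P] r)
  then show "smooth_on U (poisson_bracket \<Sigma> \<omega> f h \<circ> \<phi>)"
    by (rule smooth_on_cong[OF local_paramD(1)[OF P], rotated]) (simp add: poisson_bracket_local[OF S W P _ f])
qed (simp add: poisson_bracket_def)

lemma poisson_bracket_mult:
  assumes S: "closed_surface \<Sigma>" and W: "symplectic_form \<Sigma> \<omega>"
    and f: "f \<in> smooth_fun \<Sigma>" "k \<in> smooth_fun \<Sigma>" "h \<in> smooth_fun \<Sigma>"
  shows "poisson_bracket \<Sigma> \<omega> (\<lambda>x. f x * k x) h
    = (\<lambda>x. f x * poisson_bracket \<Sigma> \<omega> k h x + poisson_bracket \<Sigma> \<omega> f h x * k x)"
proof
  fix x
  show "poisson_bracket \<Sigma> \<omega> (\<lambda>x. f x * k x) h x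
    = f x * poisson_bracket \<Sigma> \<omega> k h x + poisson_bracket \<Sigma> \<omega> f h x * k x"
  proof (cases "x \<in> \<Sigma>")
    case True
    obtain U \<phi> u where q: "oriented_param \<Sigma> \<omega> U \<phi>" "u \<in> U" "\<phi> u = x"
      using oriented_param_exists[OF S W True] .
    then have P: "local_param \<Sigma> U \<phi>" unfolding oriented_param_def by blast
    have d: "(f \<circ> \<phi>) differentiable (at u)" "(k \<circ> \<phi>) differentiable (at u)"
      using f P q(2) smooth_fun_comp smooth_on_differentiable by blast+
    have m: "pd a ((\<lambda>x. f x * k x) \<circ> \<phi>) u = f x * pd a (k \<circ> \<phi>) u + pd a (f \<circ> \<phi>) u * k x" for a
      using pd_mult[OF d] q(3) by (simp add: o_def)
    have ff: "f (\<phi> u) = f x" "k (\<phi> u) = k x" using q(3) by auto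
    have "poisson_bracket \<Sigma> \<omega> (\<lambda>x. f x * k x) h (\<phi> u)
      = f x * poisson_bracket \<Sigma> \<omega> k h (\<phi> u) + poisson_bracket \<Sigma> \<omega> f h (\<phi> u) * k x"
      unfolding poisson_bracket_local[OF S W P q(2) smooth_fun_mult[OF f(1,2)] f(3)]
        poisson_bracket_local[OF S W P q(2) f(1,3)] poisson_bracket_local[OF S W P q(2) f(2,3)] m ff
      using rho_nonzero[OF W P q(2)] by (simp add: divide_simps) (simp add: algebra_simps)
    then show ?thesis unfolding q(3) .
  qed (simp add: poisson_bracket_def)
qed

section \<open>Operator norm and trace\<close>

lemma l2norm_eq: "l2norm v = L2_set (\<lambda>i. cmod (vec_index v i)) {..<dim_vec v}"
  by (simp add: l2norm_def L2_set_def)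

lemma l2norm_nonneg [simp]: "l2norm v \<ge> 0"
  by (simp add: l2norm_eq L2_set_nonneg)

lemma l2norm_zero [simp]: "l2norm (0\<^sub>v n) = 0"
  by (simp add: l2norm_def)

lemma l2norm_smult: "l2norm (c \<cdot>\<^sub>v v) = cmod c * l2norm v"
proof -
  have "(\<Sum>i<dim_vec v. (cmod (c * vec_index v i))\<^sup>2) = (cmod c)\<^sup>2 * (\<Sum>i<dim_vec v. (cmod (vec_index v i))\<^sup>2)"
    by (simp add: norm_mult power_mult_distrib sum_distrib_left)
  then show ?thesis by (simp add: l2norm_def real_sqrt_mult)
qed

lemma l2norm_add_le:
  assumes "dim_vec v = dim_vec w"
  shows "l2norm (v + w) \<le> l2norm v + l2norm w"
proof -
  have "l2norm (v + w) \<le> L2_set (\<lambda>i. cmod (vec_index v i) + cmod (vec_index w i)) {..<dim_vec v}"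
    unfolding l2norm_eq using assms by (auto intro!: L2_set_mono norm_triangle_ineq)
  also have "\<dots> \<le> l2norm v + l2norm w"
    unfolding l2norm_eq using assms by (simp add: L2_set_triangle_ineq)
  finally show ?thesis .
qed

lemma cmod_vec_index_le_l2norm:
  assumes "i < dim_vec v" shows "cmod (vec_index v i) \<le> l2norm v"
  unfolding l2norm_eq using assms by (intro member_le_L2_set) auto

lemma mult_mat_vec_index_sum:
  assumes "i < dim_row A" "v \<in> carrier_vec (dim_col A)"
  shows "vec_index (A *\<^sub>v v) i = (\<Sum>j<dim_col A. A $$ (i, j) * vec_index v j)"
  using assms by (simp add: scalar_prod_def atLeast0LessThan)

text \<open>\<open>Sup\<close> on the reals behaves as a supremum only for bounded sets; the sum of
  the absolute values of all entries serves as a crude bound.\<close>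

lemma op_norm_bdd:
  "bdd_above {l2norm (A *\<^sub>v v) |v. v \<in> carrier_vec (dim_col A) \<and> l2norm v \<le> 1}"
proof -
  have "l2norm (A *\<^sub>v v) \<le> (\<Sum>i<dim_row A. \<Sum>j<dim_col A. cmod (A $$ (i, j)))"
    if v: "v \<in> carrier_vec (dim_col A)" "l2norm v \<le> 1" for v
  proof -
    have "l2norm (A *\<^sub>v v) \<le> (\<Sum>i<dim_row A. cmod (vec_index (A *\<^sub>v v) i))"
      unfolding l2norm_eq dim_mult_mat_vec by (rule L2_set_le_sum) auto
    also have "\<dots> \<le> (\<Sum>i<dim_row A. \<Sum>j<dim_col A. cmod (A $$ (i, j)))"
    proof (intro sum_mono)
      fix i assume i: "i \<in> {..<dim_row A}"
      have "cmod (vec_index (A *\<^sub>v v) i) \<le> (\<Sum>j<dim_col A. cmod (A $$ (i, j) * vec_index v j))"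
        using i v by (simp only: mult_mat_vec_index_sum lessThan_iff norm_sum)
      also have "\<dots> \<le> (\<Sum>j<dim_col A. cmod (A $$ (i, j)))"
      proof (intro sum_mono)
        fix j assume "j \<in> {..<dim_col A}"
        then have "cmod (vec_index v j) \<le> 1"
          using cmod_vec_index_le_l2norm[of j v] v by auto
        then show "cmod (A $$ (i, j) * vec_index v j) \<le> cmod (A $$ (i, j))"
          by (simp add: norm_mult mult_left_le)
      qed
      finally show "cmod (vec_index (A *\<^sub>v v) i) \<le> (\<Sum>j<dim_col A. cmod (A $$ (i, j)))" .
    qed
    finally show ?thesis .
  qed
  then show ?thesis by (auto intro!: bdd_aboveI)
qed

lemma op_norm_bound:
  assumes "\<And>v. v \<in> carrier_vec (dim_col A) \<Longrightarrow> l2norm v \<le> 1 \<Longrightarrow> l2norm (A *\<^sub>v v) \<le> c"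
  shows "op_norm A \<le> c"
  unfolding op_norm_def
proof (rule cSup_least)
  have "0\<^sub>v (dim_col A) \<in> carrier_vec (dim_col A) \<and> l2norm (0\<^sub>v (dim_col A)) \<le> 1" by simp
  then show "{l2norm (A *\<^sub>v v) |v. v \<in> carrier_vec (dim_col A) \<and> l2norm v \<le> 1} \<noteq> {}" by blast
qed (use assms in auto)

lemma l2norm_mult_mat_vec_le_unit:
  assumes "v \<in> carrier_vec (dim_col A)" "l2norm v \<le> 1"
  shows "l2norm (A *\<^sub>v v) \<le> op_norm A"
  unfolding op_norm_def using assms by (intro cSup_upper[OF _ op_norm_bdd]) auto

lemma op_norm_nonneg [simp]: "op_norm A \<ge> 0"
  using l2norm_mult_mat_vec_le_unit[of "0\<^sub>v (dim_col A)" A] l2norm_nonneg[of "A *\<^sub>v 0\<^sub>v (dim_col A)"]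
  by (simp del: l2norm_nonneg)

lemma l2norm_mult_mat_vec_le:
  assumes v: "v \<in> carrier_vec (dim_col A)"
  shows "l2norm (A *\<^sub>v v) \<le> op_norm A * l2norm v"
proof (cases "l2norm v = 0")
  case True
  then have "vec_index v i = 0" if "i < dim_vec v" for i
    using cmod_vec_index_le_l2norm[OF that] by simp
  then have "v = 0\<^sub>v (dim_col A)" using v by auto
  then have "A *\<^sub>v v = 0\<^sub>v (dim_row A)" by auto
  then show ?thesis using True by simp
next
  case False
  let ?c = "complex_of_real (1 / l2norm v)"
  have n: "l2norm v > 0" using False l2norm_nonneg[of v] by linarith
  have "l2norm (?c \<cdot>\<^sub>v v) \<le> 1" using n by (simp add: l2norm_smult norm_divide)
  then have "l2norm (A *\<^sub>v (?c \<cdot>\<^sub>v v)) \<le> op_norm A"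
    using v by (intro l2norm_mult_mat_vec_le_unit) auto
  moreover have "A *\<^sub>v (?c \<cdot>\<^sub>v v) = ?c \<cdot>\<^sub>v (A *\<^sub>v v)"
    using v by (intro mult_mat_vec[of A "dim_row A" "dim_col A"]) auto
  ultimately have "l2norm (A *\<^sub>v v) / l2norm v \<le> op_norm A"
    using n by (simp add: l2norm_smult norm_divide)
  then show ?thesis using n by (simp add: divide_le_eq)
qed

lemma op_norm_mult_le:
  assumes "A \<in> carrier_mat n k" "B \<in> carrier_mat k m"
  shows "op_norm (A * B) \<le> op_norm A * op_norm B"
proof (rule op_norm_bound)
  fix v assume v: "v \<in> carrier_vec (dim_col (A * B))" "l2norm v \<le> 1"
  then have v': "v \<in> carrier_vec m" using assms by simp
  have "l2norm ((A * B) *\<^sub>v v) = l2norm (A *\<^sub>v (B *\<^sub>v v))"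
    using assms v' by (simp add: assoc_mult_mat_vec)
  also have "\<dots> \<le> op_norm A * l2norm (B *\<^sub>v v)"
    using assms v' by (intro l2norm_mult_mat_vec_le) auto
  also have "\<dots> \<le> op_norm A * op_norm B"
    using assms v v' by (intro mult_left_mono l2norm_mult_mat_vec_le_unit) auto
  finally show "l2norm ((A * B) *\<^sub>v v) \<le> op_norm A * op_norm B" .
qed

lemma op_norm_add_le:
  assumes "A \<in> carrier_mat n m" "B \<in> carrier_mat n m"
  shows "op_norm (A + B) \<le> op_norm A + op_norm B"
proof (rule op_norm_bound)
  fix v assume v: "v \<in> carrier_vec (dim_col (A + B))" "l2norm v \<le> 1"
  then have v': "v \<in> carrier_vec m" using assms by simp
  have "l2norm ((A + B) *\<^sub>v v) = l2norm (A *\<^sub>v v + B *\<^sub>v v)"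
    using assms v' by (simp add: add_mult_distrib_mat_vec)
  also have "\<dots> \<le> l2norm (A *\<^sub>v v) + l2norm (B *\<^sub>v v)" using assms by (intro l2norm_add_le) auto
  also have "\<dots> \<le> op_norm A + op_norm B"
    using assms v v' by (intro add_mono l2norm_mult_mat_vec_le_unit) auto
  finally show "l2norm ((A + B) *\<^sub>v v) \<le> op_norm A + op_norm B" .
qed

lemma op_norm_smult_le: "op_norm (c \<cdot>\<^sub>m A) \<le> cmod c * op_norm A"
proof (rule op_norm_bound)
  fix v assume v: "v \<in> carrier_vec (dim_col (c \<cdot>\<^sub>m A))" "l2norm v \<le> 1"
  have "(c \<cdot>\<^sub>m A) *\<^sub>v v = c \<cdot>\<^sub>v (A *\<^sub>v v)"
    using v by (intro eq_vecI) (auto simp: scalar_prod_def sum_distrib_left mult.assoc)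
  then show "l2norm ((c \<cdot>\<^sub>m A) *\<^sub>v v) \<le> cmod c * op_norm A"
    using v l2norm_mult_mat_vec_le_unit[of v A] by (simp add: l2norm_smult mult_left_mono)
qed

lemma op_norm_diff_triangle:
  assumes "A \<in> carrier_mat n m" "B \<in> carrier_mat n m" "C \<in> carrier_mat n m"
  shows "op_norm (A - C) \<le> op_norm (A - B) + op_norm (B - C)"
proof -
  have "A - C = (A - B) + (B - C)" using assms by auto
  then show ?thesis using assms op_norm_add_le[of "A - B" n m "B - C"] by (simp add: minus_carrier_mat)
qed

lemma op_norm_self_diff [simp]: "op_norm (A - A) = 0"
proof -
  have "A - A = 0 \<cdot>\<^sub>m A" by auto
  then show ?thesis using op_norm_smult_le[of 0 A] op_norm_nonneg[of "0 \<cdot>\<^sub>m A"] by simp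
qed

text \<open>Each diagonal entry is a component of the image of a unit vector. The dimension factor
  is harmless in the limits, because the trace is multiplied there by
  \<open>hbar (N \<alpha>)\<close>.\<close>

lemma cmod_mtrace_le:
  assumes A: "A \<in> carrier_mat n n"
  shows "cmod (mtrace A) \<le> real n * op_norm A"
proof -
  have "cmod (A $$ (i, i)) \<le> op_norm A" if i: "i < n" for i
  proof -
    have "l2norm (unit_vec n i) = 1"
      using i by (simp add: l2norm_def unit_vec_def if_distrib[of cmod] if_distrib[of "\<lambda>x. x\<^sup>2"] cong: if_cong)
    then have "l2norm (A *\<^sub>v unit_vec n i) \<le> op_norm A"
      using A by (intro l2norm_mult_mat_vec_le_unit) auto
    moreover have "vec_index (A *\<^sub>v unit_vec n i) i = A $$ (i, i)"
      using A i by (simp add: mult_mat_vec_def)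
    ultimately show ?thesis
      using cmod_vec_index_le_l2norm[of i "A *\<^sub>v unit_vec n i"] A i by simp
  qed
  then have "(\<Sum>i<n. cmod (A $$ (i, i))) \<le> (\<Sum>i<n. op_norm A)" by (intro sum_mono) auto
  moreover have "cmod (mtrace A) \<le> (\<Sum>i<n. cmod (A $$ (i, i)))"
    using A by (simp add: mtrace_def norm_sum)
  ultimately show ?thesis by simp
qed

section \<open>Traces of products and commutators\<close>

lemma mtrace_add:
  "A \<in> carrier_mat n n \<Longrightarrow> B \<in> carrier_mat n n \<Longrightarrow> mtrace (A + B) = mtrace A + mtrace B"
  by (simp add: mtrace_def sum.distrib)

lemma mtrace_diff:
  "A \<in> carrier_mat n n \<Longrightarrow> B \<in> carrier_mat n n \<Longrightarrow> mtrace (A - B) = mtrace A - mtrace B"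
  by (simp add: mtrace_def sum_subtractf)

lemma mtrace_smult: "A \<in> carrier_mat n n \<Longrightarrow> mtrace (c \<cdot>\<^sub>m A) = c * mtrace A"
  by (simp add: mtrace_def sum_distrib_left)

lemma mult_mat_index_sum:
  assumes "A \<in> carrier_mat n k" "B \<in> carrier_mat k m" "i < n" "j < m"
  shows "(A * B) $$ (i, j) = (\<Sum>l<k. A $$ (i, l) * B $$ (l, j))"
  using assms by (simp add: scalar_prod_def atLeast0LessThan)

lemma mtrace_mult_sum:
  assumes "A \<in> carrier_mat n k" "B \<in> carrier_mat k n"
  shows "mtrace (A * B) = (\<Sum>i<n. \<Sum>l<k. A $$ (i, l) * B $$ (l, i))"
proof -
  have "mtrace (A * B) = (\<Sum>i<n. (A * B) $$ (i, i))" using assms by (simp add: mtrace_def)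
  also have "\<dots> = (\<Sum>i<n. \<Sum>l<k. A $$ (i, l) * B $$ (l, i))"
    by (intro sum.cong refl mult_mat_index_sum[OF assms]) auto
  finally show ?thesis .
qed

lemma mtrace_mult_comm:
  assumes "A \<in> carrier_mat n k" "B \<in> carrier_mat k n"
  shows "mtrace (A * B) = mtrace (B * A)"
  unfolding mtrace_mult_sum[OF assms] mtrace_mult_sum[OF assms(2,1)]
  by (subst sum.swap) (simp add: mult.commute)

lemma commutator_carrier [simp]:
  "A \<in> carrier_mat n n \<Longrightarrow> B \<in> carrier_mat n n \<Longrightarrow> commutator A B \<in> carrier_mat n n"
  by (simp add: commutator_def minus_carrier_mat)

lemma mtrace_commutator:
  assumes "A \<in> carrier_mat n n" "B \<in> carrier_mat n n"
  shows "mtrace (commutator A B) = 0"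
  using assms mtrace_mult_comm[OF assms] by (simp add: commutator_def mtrace_diff[of _ n])

text \<open>Integration by parts for matrices: cyclicity of the trace moves the commutator to the
  other factor, at the price of a sign.\<close>

lemma mtrace_mult_commutator:
  assumes "A \<in> carrier_mat n n" "B \<in> carrier_mat n n" "X \<in> carrier_mat n n"
  shows "mtrace (A * commutator B X) = - mtrace (commutator A X * B)"
proof -
  have "mtrace (A * (B * X)) = mtrace (X * A * B)"
    using assms mtrace_mult_comm[of "A * B" n n X] by (simp add: assoc_mult_mat[of _ n n _ n _ n])
  moreover have "A * commutator B X = A * (B * X) - A * (X * B)"
    using assms by (simp add: commutator_def mult_minus_distrib_mat[of _ n n _ n])
  moreover have "commutator A X * B = A * (X * B) - X * A * B"
    using assms by (simp add: commutator_def minus_mult_distrib_mat[of _ n n _ _ n] assoc_mult_mat[of _ n n _ n _ n])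
  ultimately show ?thesis using assms by (simp add: mtrace_diff[of _ n])
qed

text \<open>Handles the entrywise sum over the embedding coordinates in
  \<open>discrete_laplacian\<close>.\<close>

lemma mtrace_mult_mat_sum:
  assumes "A \<in> carrier_mat n n" "\<And>j. j \<in> J \<Longrightarrow> M j \<in> carrier_mat n n"
  shows "mtrace (A * Matrix.mat n n (\<lambda>rc. \<Sum>j\<in>J. M j $$ rc)) = (\<Sum>j\<in>J. mtrace (A * M j))"
proof -
  have "mtrace (A * Matrix.mat n n (\<lambda>rc. \<Sum>j\<in>J. M j $$ rc))
     = (\<Sum>i<n. \<Sum>l<n. \<Sum>j\<in>J. A $$ (i, l) * M j $$ (l, i))"
    using assms(1) by (subst mtrace_mult_sum[of _ n n]) (auto simp: sum_distrib_left)
  also have "\<dots> = (\<Sum>j\<in>J. \<Sum>i<n. \<Sum>l<n. A $$ (i, l) * M j $$ (l, i))"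
    by (subst sum.swap[of _ _ J], subst sum.swap[of _ _ J]) simp
  also have "\<dots> = (\<Sum>j\<in>J. mtrace (A * M j))"
    using assms by (intro sum.cong refl) (simp add: mtrace_mult_sum[of _ n n])
  finally show ?thesis .
qed

text \<open>Since \<open>A\<close> is hermitian, the i-th diagonal entry of
  \<open>A * (P * A)\<close> is the quadratic form of \<open>P\<close> at the i-th column of
  \<open>A\<close>.\<close>

lemma Re_mtrace_hermitian_conj_nonneg:
  assumes A: "A \<in> carrier_mat n n" "mat_adjoint A = A" and P: "P \<in> carrier_mat n n" "pos_semidef P"
  shows "Re (mtrace (A * (P * A))) \<ge> 0"
proof -
  have adj: "cnj (A $$ (k, i)) = A $$ (i, k)" if "i < n" "k < n" for i k
  proof -
    have "mat_adjoint A $$ (i, k) = cnj (A $$ (k, i))"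
      using A(1) that by (simp add: mat_adjoint_def mat_of_rows_def)
    then show ?thesis using A(2) by simp
  qed
  have d: "(A * (P * A)) $$ (i, i) = (P *\<^sub>v col A i) \<bullet>c col A i" if i: "i < n" for i
  proof -
    have "(A * (P * A)) $$ (i, i) = (\<Sum>k<n. A $$ (i, k) * (P * A) $$ (k, i))"
      using A(1) P(1) i by (intro mult_mat_index_sum) auto
    also have "\<dots> = (\<Sum>k<n. vec_index (P *\<^sub>v col A i) k * cnj (vec_index (col A i) k))"
      using A(1) P(1) i adj by (intro sum.cong refl) (auto simp: mult.commute)
    also have "\<dots> = (P *\<^sub>v col A i) \<bullet>c col A i"
      using A(1) P(1) i by (simp add: scalar_prod_def atLeast0LessThan)
    finally show ?thesis .
  qed
  have "Re ((A * (P * A)) $$ (i, i)) \<ge> 0" if "i < n" for i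
    unfolding d[OF that] using P A(1) that unfolding pos_semidef_def by auto
  then have "(\<Sum>i<n. Re ((A * (P * A)) $$ (i, i))) \<ge> 0" by (intro sum_nonneg) auto
  then show ?thesis using A(1) by (simp add: mtrace_def)
qed

section \<open>Positivity of the integral\<close>

text \<open>Compactness gives finitely many charts restricted to closed balls, and their images are
  made disjoint by discarding what earlier images already cover. Closed balls have compact images,
  so the discarded preimages are closed and the remaining pieces are Borel.\<close>

lemma dissection_exists:
  assumes S: "closed_surface \<Sigma>" and W: "symplectic_form \<Sigma> \<omega>"
  shows "\<exists>d. dissection \<Sigma> \<omega> d"
proof -
  have "\<exists>\<phi> U u r. oriented_param \<Sigma> \<omega> U \<phi> \<and> cball u r \<subseteq> U \<and> p \<in> \<phi> ` ball u r" if p: "p \<in> \<Sigma>" for p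
  proof -
    obtain U \<phi> u where P: "oriented_param \<Sigma> \<omega> U \<phi>" "u \<in> U" "\<phi> u = p"
      using oriented_param_exists[OF S W p] .
    then have "open U" using local_paramD(1) unfolding oriented_param_def by blast
    then obtain r where r: "r > 0" "cball u r \<subseteq> U" using P open_contains_cball by blast
    then have "u \<in> ball u r" by simp
    then show ?thesis using P r by blast
  qed
  then obtain \<phi> U u r where ch: "\<And>p. p \<in> \<Sigma> \<Longrightarrow> oriented_param \<Sigma> \<omega> (U p) (\<phi> p)"
    "\<And>p. p \<in> \<Sigma> \<Longrightarrow> cball (u p) (r p) \<subseteq> U p" "\<And>p. p \<in> \<Sigma> \<Longrightarrow> p \<in> \<phi> p ` ball (u p) (r p)" by metis
  define Nb where "Nb p = \<phi> p ` ball (u p) (r p)" for p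
  have "openin (top_of_set \<Sigma>) (Nb p)" if p: "p \<in> \<Sigma>" for p
  proof -
    have L: "local_param \<Sigma> (U p) (\<phi> p)" using ch(1)[OF p] unfolding oriented_param_def by blast
    have "ball (u p) (r p) \<subseteq> U p" using ch(2)[OF p] ball_subset_cball by blast
    from local_param_restrict[OF L open_ball this]
    show ?thesis unfolding Nb_def local_param_def by blast
  qed
  moreover have "\<Sigma> \<subseteq> \<Union>(Nb ` \<Sigma>)" using ch(3) unfolding Nb_def by blast
  moreover have "compact \<Sigma>" using S unfolding closed_surface_def by blast
  ultimately obtain C where C: "C \<subseteq> Nb ` \<Sigma>" "finite C" "\<Sigma> \<subseteq> \<Union>C"
    unfolding compact_eq_openin_cover by (metis (no_types, lifting) imageE)
  then obtain F where F: "F \<subseteq> \<Sigma>" "finite F" "C = Nb ` F" using finite_subset_image by metis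
  then obtain xs where xs: "set xs = F" using finite_list by blast
  define B where "B i = cball (u (xs ! i)) (r (xs ! i))" for i
  define \<Phi> where "\<Phi> i = \<phi> (xs ! i)" for i
  define n where "n = length xs"
  have o: "oriented_param \<Sigma> \<omega> (U (xs ! i)) (\<Phi> i)" and BU: "B i \<subseteq> U (xs ! i)" if "i < n" for i
    using ch(1,2) F xs that unfolding B_def \<Phi>_def n_def by (meson nth_mem subsetD)+
  have cont: "continuous_on (B i) (\<Phi> i)" and im: "\<Phi> i ` B i \<subseteq> \<Sigma>" if "i < n" for i
  proof -
    have L: "local_param \<Sigma> (U (xs ! i)) (\<Phi> i)" using o[OF that] unfolding oriented_param_def by blast
    show "continuous_on (B i) (\<Phi> i)"
      using continuous_on_subset[OF smooth_on_continuous_on[OF local_paramD(2)[OF L]] BU[OF that]] .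
    show "\<Phi> i ` B i \<subseteq> \<Sigma>" using local_paramD(3)[OF L] BU[OF that] by blast
  qed
  have cB: "compact (B i)" for i by (simp add: B_def)
  define D where "D i = B i - (\<Union>j<i. B i \<inter> \<Phi> i -` (\<Phi> j ` B j))" for i
  have DB: "D i \<subseteq> B i" for i by (auto simp: D_def)
  have "D i \<in> sets borel" if i: "i < n" for i
  proof -
    have "closed (B i \<inter> \<Phi> i -` (\<Phi> j ` B j))" if "j < i" for j
    proof (rule continuous_closed_preimage[OF cont[OF i]])
      show "closed (B i)" by (simp add: B_def)
      show "closed (\<Phi> j ` B j)"
        using compact_continuous_image[OF cont cB] that i by (simp add: compact_imp_closed)
    qed
    then have "closed (\<Union>j<i. B i \<inter> \<Phi> i -` (\<Phi> j ` B j))" by (intro closed_UN) auto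
    then show ?thesis unfolding D_def B_def by (intro sets.Diff borel_closed) auto
  qed
  moreover have cl: "closure (D i) \<subseteq> B i" for i
    using closure_minimal[OF DB] by (simp add: B_def)
  moreover have "compact (closure (D i))" for i
    using compact_Int_closed[OF cB closed_closure] cl by (metis inf.absorb_iff2)
  moreover have "disjoint_family_on (\<lambda>i. \<Phi> i ` D i) {..<n}"
  proof -
    have "\<Phi> i ` D i \<inter> \<Phi> j ` D j = {}" if "j < i" for i j
      using that by (auto simp: D_def)
    then show ?thesis unfolding disjoint_family_on_def by (metis inf_commute linorder_neqE_nat)
  qed
  moreover have "(\<Union>i<n. \<Phi> i ` D i) = \<Sigma>"
  proof
    show "(\<Union>i<n. \<Phi> i ` D i) \<subseteq> \<Sigma>" using im DB by blast
    show "\<Sigma> \<subseteq> (\<Union>i<n. \<Phi> i ` D i)"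
    proof
      fix x assume "x \<in> \<Sigma>"
      then obtain p where "p \<in> F" "x \<in> Nb p" using C F by blast
      then obtain i where i: "i < n" "x \<in> \<Phi> i ` B i"
      proof -
        obtain i where "i < n" "xs ! i = p" using xs \<open>p \<in> F\<close> unfolding n_def by (metis in_set_conv_nth)
        moreover have "x \<in> \<phi> p ` cball (u p) (r p)"
          using \<open>x \<in> Nb p\<close> ball_subset_cball unfolding Nb_def by blast
        ultimately show ?thesis using that unfolding \<Phi>_def B_def by blast
      qed
      \<comment> \<open>The first image containing \<open>x\<close> is the one from which
        \<open>x\<close> has not been discarded.\<close>
      define k where "k = (LEAST i. i < n \<and> x \<in> \<Phi> i ` B i)"
      have k: "k < n" "x \<in> \<Phi> k ` B k" using LeastI[of "\<lambda>i. i < n \<and> x \<in> \<Phi> i ` B i"] i unfolding k_def by blast+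
      have "x \<notin> \<Phi> j ` B j" if "j < k" for j
        using not_less_Least[of j "\<lambda>i. i < n \<and> x \<in> \<Phi> i ` B i"] that k(1) unfolding k_def[symmetric] by auto
      then have "x \<in> \<Phi> k ` D k" using k(2) unfolding D_def by blast
      then show "x \<in> (\<Union>i<n. \<Phi> i ` D i)" using k(1) by blast
    qed
  qed
  ultimately have "dissection \<Sigma> \<omega> (n, \<Phi>, D)"
    unfolding dissection_def prod.case using o order_trans[OF cl BU] by blast
  then show ?thesis by blast
qed

text \<open>The choice operator sees only the surface and the form, so one dissection serves all
  functions.\<close>

lemma form_integral_dissection:
  assumes S: "closed_surface \<Sigma>" and W: "symplectic_form \<Sigma> \<omega>"
  shows "\<exists>n \<phi> D. dissection \<Sigma> \<omega> (n, \<phi>, D) \<and> (\<forall>f. form_integral \<Sigma> \<omega> f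
    = (\<Sum>i<n. set_lebesgue_integral lborel (D i) (\<lambda>u. f (\<phi> i u) * rho \<omega> (\<phi> i) u)))"
proof -
  obtain n \<phi> D where d: "(SOME d. dissection \<Sigma> \<omega> d) = (n, \<phi>, D)" by (metis prod_cases3)
  have "dissection \<Sigma> \<omega> (n, \<phi>, D)" using someI_ex[OF dissection_exists[OF S W]] unfolding d .
  then show ?thesis unfolding form_integral_def d prod.case by blast
qed

text \<open>A non-integrable function has integral 0 by convention. Integrability is therefore what
  allows a vanishing integral of a nonnegative function to be turned into vanishing almost
  everywhere.\<close>

lemma dissection_integrable:
  assumes W: "symplectic_form \<Sigma> \<omega>" and d: "dissection \<Sigma> \<omega> (n, \<phi>, D)" and i: "i < n"
    and f: "f \<in> smooth_fun \<Sigma>"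
  shows "set_integrable lborel (D i) (\<lambda>u. f (\<phi> i u) * rho \<omega> (\<phi> i) u)"
proof -
  obtain U where U: "oriented_param \<Sigma> \<omega> U (\<phi> i)" "compact (closure (D i))" "closure (D i) \<subseteq> U" "D i \<in> sets borel"
    using d i unfolding dissection_def by auto
  then have L: "local_param \<Sigma> U (\<phi> i)" unfolding oriented_param_def by blast
  have "continuous_on U (f \<circ> \<phi> i)" "continuous_on U (rho \<omega> (\<phi> i))"
    using smooth_fun_comp[OF f L] W L smooth_on_continuous_on unfolding symplectic_form_def by blast+
  then have "continuous_on (closure (D i)) (\<lambda>u. f (\<phi> i u) * rho \<omega> (\<phi> i) u)"
    using U(3) by (intro continuous_on_mult) (auto simp: o_def intro: continuous_on_subset)
  then have "set_integrable lborel (closure (D i)) (\<lambda>u. f (\<phi> i u) * rho \<omega> (\<phi> i) u)"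
    unfolding set_integrable_def using borel_integrable_compact[OF U(2)] by blast
  then show ?thesis by (rule set_integrable_subset) (use U(4) closure_subset in auto)
qed

lemma form_integral_nonneg:
  assumes S: "closed_surface \<Sigma>" and W: "symplectic_form \<Sigma> \<omega>"
    and f: "\<And>x. x \<in> \<Sigma> \<Longrightarrow> f x \<ge> 0"
  shows "form_integral \<Sigma> \<omega> f \<ge> 0"
proof -
  obtain n \<phi> D where d: "dissection \<Sigma> \<omega> (n, \<phi>, D)"
    "form_integral \<Sigma> \<omega> f = (\<Sum>i<n. set_lebesgue_integral lborel (D i) (\<lambda>u. f (\<phi> i u) * rho \<omega> (\<phi> i) u))"
    using form_integral_dissection[OF S W] by blast
  have "f (\<phi> i u) * rho \<omega> (\<phi> i) u \<ge> 0" if iu: "i < n" "u \<in> D i" for i u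
  proof -
    obtain U where U: "oriented_param \<Sigma> \<omega> U (\<phi> i)" "closure (D i) \<subseteq> U"
      using d(1) iu(1) unfolding dissection_def prod.case by blast
    then have "u \<in> U" using iu(2) closure_subset by blast
    with U have "rho \<omega> (\<phi> i) u > 0" "\<phi> i u \<in> \<Sigma>" unfolding oriented_param_def using local_paramD(4)[of \<Sigma> U "\<phi> i" u] by auto
    then show ?thesis using f by simp
  qed
  then show ?thesis unfolding d(2) set_lebesgue_integral_def
    by (intro sum_nonneg integral_nonneg_AE AE_I2) (auto simp: indicator_def)
qed

text \<open>A null set of the parameter domains of the dissection stays null in any other chart, because
  the transition maps are differentiable.\<close>

lemma form_integral_eq_0_imp:
  assumes S: "closed_surface \<Sigma>" and W: "symplectic_form \<Sigma> \<omega>"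
    and f: "f \<in> smooth_fun \<Sigma>" "\<And>x. x \<in> \<Sigma> \<Longrightarrow> f x \<ge> 0"
    and I: "form_integral \<Sigma> \<omega> f = 0" and p: "p \<in> \<Sigma>"
  shows "f p = 0"
proof (rule ccontr)
  assume "f p \<noteq> 0"
  then have fp: "f p > 0" using f(2)[OF p] by simp
  obtain n \<phi> D where d: "dissection \<Sigma> \<omega> (n, \<phi>, D)"
    "form_integral \<Sigma> \<omega> f = (\<Sum>i<n. set_lebesgue_integral lborel (D i) (\<lambda>u. f (\<phi> i u) * rho \<omega> (\<phi> i) u))"
    using form_integral_dissection[OF S W] by blast
  have cov: "(\<Union>i<n. \<phi> i ` D i) = \<Sigma>"
    and ex: "\<forall>i. \<exists>U. i < n \<longrightarrow> oriented_param \<Sigma> \<omega> U (\<phi> i) \<and> closure (D i) \<subseteq> U"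
    using d(1) unfolding dissection_def by auto
  from choice[OF ex] obtain V where
    V: "\<And>i. i < n \<Longrightarrow> oriented_param \<Sigma> \<omega> (V i) (\<phi> i) \<and> closure (D i) \<subseteq> V i" by blast
  have VL: "local_param \<Sigma> (V i) (\<phi> i)" and Vr: "u \<in> D i \<Longrightarrow> rho \<omega> (\<phi> i) u > 0" "u \<in> D i \<Longrightarrow> u \<in> V i"
    if "i < n" for i u
    using V[OF that] closure_subset[of "D i"] unfolding oriented_param_def by blast+
  define g where "g i u = indicator (D i) u *\<^sub>R (f (\<phi> i u) * rho \<omega> (\<phi> i) u)" for i u
  have g0: "g i u \<ge> 0" if "i < n" for i u
    using Vr[OF that, of u] local_paramD(4)[OF VL[OF that], of u] f(2)[of "\<phi> i u"] by (auto simp: g_def indicator_def)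
  have gi: "integrable lborel (g i)" if "i < n" for i
    using dissection_integrable[OF W d(1) that f(1)] unfolding set_integrable_def g_def .
  have "(\<Sum>i<n. integral\<^sup>L lborel (g i)) = 0"
    using I d(2) unfolding set_lebesgue_integral_def g_def by simp
  moreover have "integral\<^sup>L lborel (g i) \<ge> 0" if "i < n" for i using g0[OF that] by simp
  ultimately have int0: "integral\<^sup>L lborel (g i) = 0" if "i < n" for i
    using that by (subst (asm) sum_nonneg_eq_0_iff) auto
  define Z where "Z i = {u. g i u \<noteq> 0}" for i
  have Z: "negligible (Z i)" if "i < n" for i
  proof -
    have ae: "AE u in lborel. g i u = 0"
      using int0[OF that] integral_nonneg_eq_0_iff_AE[OF gi[OF that]] g0[OF that] by simp
    have "g i \<in> borel_measurable lborel" using gi[OF that] by (rule borel_measurable_integrable)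
    then have "{u \<in> space lborel. \<not> g i u = 0} \<in> sets lborel" by measurable
    from AE_iff_null[OF this] ae have "Z i \<in> null_sets lborel" by (simp add: Z_def)
    then show ?thesis unfolding negligible_iff_null_sets by (rule null_sets_completionI)
  qed
  have Zi: "u \<in> Z i" if "i < n" "u \<in> D i" "f (\<phi> i u) \<noteq> 0" for i u
    using Vr(1)[OF that(1,2)] that by (simp add: Z_def g_def)
  have ZD: "u \<in> D i" if "u \<in> Z i" for u i using that by (auto simp: Z_def g_def indicator_def)
  obtain U \<psi>0 u where P: "oriented_param \<Sigma> \<omega> U \<psi>0" "u \<in> U" "\<psi>0 u = p"
    using oriented_param_exists[OF S W p] .
  then have L: "local_param \<Sigma> U \<psi>0" unfolding oriented_param_def by blast
  obtain \<psi> where h: "homeomorphism U (\<psi>0 ` U) \<psi>0 \<psi>" using L unfolding local_param_def by blast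
  \<comment> \<open>By continuity \<open>f\<close> is positive on a whole neighbourhood of
    \<open>p\<close>, and \<open>Q\<close> is the part of the chart where this happens. It will be
    covered by the images of the null sets \<open>Z i\<close> under transition maps, which is
    impossible for a nonempty open set.\<close>
  define Q where "Q = U \<inter> (f \<circ> \<psi>0) -` {0<..}"
  have "open Q" unfolding Q_def
    by (rule continuous_open_preimage[OF smooth_on_continuous_on[OF smooth_fun_comp[OF f(1) L]] local_paramD(1)[OF L]]) simp
  moreover have "u \<in> Q" using P fp by (simp add: Q_def)
  moreover have "negligible Q"
  proof (rule negligible_subset)
    let ?Y = "\<lambda>i. {v \<in> Z i. \<phi> i v \<in> \<psi>0 ` U}"
    show "negligible (\<Union>i<n. (\<lambda>v. \<psi> (\<phi> i v)) ` ?Y i)"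
    proof (intro negligible_Union)
      show "finite ((\<lambda>i. (\<lambda>v. \<psi> (\<phi> i v)) ` ?Y i) ` {..<n})" by simp
      fix T assume "T \<in> (\<lambda>i. (\<lambda>v. \<psi> (\<phi> i v)) ` ?Y i) ` {..<n}"
      then obtain i where i: "i < n" "T = (\<lambda>v. \<psi> (\<phi> i v)) ` ?Y i" by blast
      have "(\<lambda>v. \<psi> (\<phi> i v)) differentiable (at v)" if "v \<in> ?Y i" for v
        using local_param_transition(2)[OF L VL[OF i(1)] h] Vr(2)[OF i(1)] ZD that by blast
      then have "(\<lambda>v. \<psi> (\<phi> i v)) differentiable_on ?Y i"
        unfolding differentiable_on_def using differentiable_at_withinI by blast
      moreover have "negligible (?Y i)" by (rule negligible_subset[OF Z[OF i(1)]]) blast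
      ultimately show "negligible T" unfolding i(2) by (intro negligible_differentiable_image_negligible order_refl)
    qed
    show "Q \<subseteq> (\<Union>i<n. (\<lambda>v. \<psi> (\<phi> i v)) ` ?Y i)"
    proof
      fix w assume w: "w \<in> Q"
      then have "\<psi>0 w \<in> \<Sigma>" using local_paramD(4)[OF L] by (simp add: Q_def)
      then obtain i v where iv: "i < n" "v \<in> D i" "\<phi> i v = \<psi>0 w"
        unfolding cov[symmetric] by auto
      have "v \<in> ?Y i" using Zi[OF iv(1,2)] iv(3) w by (auto simp: Q_def)
      moreover have "\<psi> (\<phi> i v) = w" using h w iv(3) unfolding homeomorphism_def Q_def by auto
      ultimately show "w \<in> (\<Union>i<n. (\<lambda>v. \<psi> (\<phi> i v)) ` ?Y i)" using iv(1) by blast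
    qed
  qed
  ultimately show False using open_not_negligible by blast
qed

section \<open>The curvature inequality\<close>

text \<open>This is tr^2 >= 4 det for a symmetric form with entries \<open>H11\<close>,
  \<open>H12\<close>, \<open>H22\<close>, taken relative to the metric with coefficients
  \<open>E\<close>, \<open>F\<close>, \<open>G\<close>, with denominators cleared.\<close>

lemma four_det_le_trace_square:
  fixes E F G H11 H12 H22 :: real
  assumes "E > 0" "E * G - F\<^sup>2 \<ge> 0"
  shows "4 * (E * G - F\<^sup>2) * (H11 * H22 - H12\<^sup>2) \<le> (H11 * G - 2 * H12 * F + H22 * E)\<^sup>2"
proof -
  \<comment> \<open>With denominators cleared, this is tr^2 - 4 det = (h11 - h22)^2 + 4 h12^2 in the
    Gram-Schmidt frame a, E b - F a, whose vectors have squared lengths E and E (E G - F^2).\<close>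
  have "E\<^sup>2 * ((H11 * G - 2 * H12 * F + H22 * E)\<^sup>2 - 4 * (E * G - F\<^sup>2) * (H11 * H22 - H12\<^sup>2))
    = ((E * G - F\<^sup>2) * H11 - (E\<^sup>2 * H22 - 2 * E * F * H12 + F\<^sup>2 * H11))\<^sup>2
      + 4 * (E * G - F\<^sup>2) * (E * H12 - F * H11)\<^sup>2"
    by (simp add: power2_eq_square algebra_simps)
  also have "\<dots> \<ge> 0" using assms by (intro add_nonneg_nonneg mult_nonneg_nonneg) auto
  finally show ?thesis using assms by (simp add: zero_le_mult_iff)
qed

text \<open>Here \<open>G1, G2\<close> and \<open>V1, V2\<close> are the components of a gradient and of its rotation by a right
  angle with respect to the frame \<open>a, b\<close>; a trailing index \<open>c\<close> stands for the derivative in the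
  direction \<open>c\<close>. The \<open>k\<close> are the Christoffel symbols, the \<open>n\<close> the second fundamental form, and
  \<open>g1c, g2c\<close> in the proof the components of the covariant derivative of the gradient.\<close>

lemma rotated_gradient_inequality:
  fixes a b n11 n12 n22 :: "'a::real_inner"
  fixes k111 k112 k122 k211 k212 k222 :: real
  defines "E \<equiv> a \<bullet> a" and "F \<equiv> a \<bullet> b" and "G \<equiv> b \<bullet> b"
  assumes n: "n11 \<bullet> a = 0" "n11 \<bullet> b = 0" "n12 \<bullet> a = 0" "n12 \<bullet> b = 0" "n22 \<bullet> a = 0" "n22 \<bullet> b = 0"
    and s: "s > 0" "s\<^sup>2 = E * G - F\<^sup>2" and E: "E > 0"
    and a1: "a1 = k111 *\<^sub>R a + k211 *\<^sub>R b + n11" and a2: "a2 = k112 *\<^sub>R a + k212 *\<^sub>R b + n12"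
    and b2: "b2 = k122 *\<^sub>R a + k222 *\<^sub>R b + n22"
    and sd: "2 * s * s1 = 2 * (a \<bullet> a1) * G + E * (2 * (b \<bullet> a2)) - 2 * F * (a1 \<bullet> b + a \<bullet> a2)"
            "2 * s * s2 = 2 * (a \<bullet> a2) * G + E * (2 * (b \<bullet> b2)) - 2 * F * (a2 \<bullet> b + a \<bullet> b2)"
    and V: "V1 * s = - (G1 * F + G2 * G)" "V2 * s = G1 * E + G2 * F"
    and V1d: "V11 * s + V1 * s1 = - (G11 * F + G1 * (a1 \<bullet> b + a \<bullet> a2) + G21 * G + G2 * (2 * (b \<bullet> a2)))"
             "V12 * s + V1 * s2 = - (G12 * F + G1 * (a2 \<bullet> b + a \<bullet> b2) + G22 * G + G2 * (2 * (b \<bullet> b2)))"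
    and V2d: "V21 * s + V2 * s1 = G11 * E + G1 * (2 * (a \<bullet> a1)) + G21 * F + G2 * (a1 \<bullet> b + a \<bullet> a2)"
             "V22 * s + V2 * s2 = G12 * E + G1 * (2 * (a \<bullet> a2)) + G22 * F + G2 * (a2 \<bullet> b + a \<bullet> b2)"
    and sym: "G11 * F + G1 * (a1 \<bullet> b + a \<bullet> a2) + G21 * G + G2 * (2 * (b \<bullet> a2))
            = G12 * E + G1 * (2 * (a \<bullet> a2)) + G22 * F + G2 * (a2 \<bullet> b + a \<bullet> b2)"
    and K: "K * s\<^sup>2 = n11 \<bullet> n22 - n12 \<bullet> n12"
    and grad: "Gr1 = G11 *\<^sub>R a + G1 *\<^sub>R a1 + (G21 *\<^sub>R b + G2 *\<^sub>R a2)"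
              "Gr2 = G12 *\<^sub>R a + G1 *\<^sub>R a2 + (G22 *\<^sub>R b + G2 *\<^sub>R b2)"
    and rot: "Rt1 = V11 *\<^sub>R a + V1 *\<^sub>R a1 + (V21 *\<^sub>R b + V2 *\<^sub>R a2)"
             "Rt2 = V12 *\<^sub>R a + V1 *\<^sub>R a2 + (V22 *\<^sub>R b + V2 *\<^sub>R b2)"
    and R: "R = V1 *\<^sub>R a + V2 *\<^sub>R b"
    and L: "L * s = Rt1 \<bullet> b - Rt2 \<bullet> a"
  shows "s * (K * (R \<bullet> R) - L\<^sup>2 / 2) \<le> Gr1 \<bullet> Rt2 - Gr2 \<bullet> Rt1"
proof -
  have ip: "b \<bullet> a = F" "a \<bullet> b = F" "a \<bullet> a = E" "b \<bullet> b = G" by (simp_all add: E_def F_def G_def inner_commute)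
  note n' = n n[THEN trans[OF inner_commute]]
  have p: "a \<bullet> a1 = k111 * E + k211 * F" "a1 \<bullet> b = k111 * F + k211 * G"
    "a \<bullet> a2 = k112 * E + k212 * F" "a2 \<bullet> b = k112 * F + k212 * G" "b \<bullet> a2 = k112 * F + k212 * G"
    "a \<bullet> b2 = k122 * E + k222 * F" "b \<bullet> b2 = k122 * F + k222 * G"
    by (simp_all add: a1 a2 b2 inner_add_left inner_add_right ip n')
  \<comment> \<open>The logarithmic derivative of the area density is a contraction of the
    Christoffel symbols.\<close>
  have "2 * s * s1 = 2 * s\<^sup>2 * (k111 + k212)" unfolding sd(1) p s(2) by Groebner_Basis.algebra
  then have "(2 * s) * s1 = (2 * s) * (s * (k111 + k212))" by (simp add: power2_eq_square)
  then have s1: "s1 = s * (k111 + k212)" using s(1) by simp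
  have "2 * s * s2 = 2 * s\<^sup>2 * (k112 + k222)" unfolding sd(2) p s(2) by Groebner_Basis.algebra
  then have "(2 * s) * s2 = (2 * s) * (s * (k112 + k222))" by (simp add: power2_eq_square)
  then have s2: "s2 = s * (k112 + k222)" using s(1) by simp
  define g11 where "g11 = G11 + k111 * G1 + k112 * G2"
  define g21 where "g21 = G21 + k211 * G1 + k212 * G2"
  define g12 where "g12 = G12 + k112 * G1 + k122 * G2"
  define g22 where "g22 = G22 + k212 * G1 + k222 * G2"
  define v11 where "v11 = V11 + k111 * V1 + k112 * V2"
  define v21 where "v21 = V21 + k211 * V1 + k212 * V2"
  define v12 where "v12 = V12 + k112 * V1 + k122 * V2"
  define v22 where "v22 = V22 + k212 * V1 + k222 * V2"
  \<comment> \<open>Lowering the index of the covariant derivative of the gradient gives the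
    Hessian. Its symmetry comes from \<open>sym\<close>, which expresses the equality of the mixed
    derivatives of the function.\<close>
  define H11 where "H11 = g11 * E + g21 * F"
  define H12 where "H12 = g11 * F + g21 * G"
  define H21 where "H21 = g12 * E + g22 * F"
  define H22 where "H22 = g12 * F + g22 * G"
  have H: "H21 = H12" using sym unfolding p H12_def H21_def g11_def g21_def g12_def g22_def by Groebner_Basis.algebra
  \<comment> \<open>Rotation by a right angle is parallel, so the covariant derivative of the
    rotated gradient is the rotated Hessian.\<close>
  have v: "s * v11 = - H12" "s * v21 = H11" "s * v12 = - H22" "s * v22 = H21"
    using V V1d V2d unfolding p s1 s2 v11_def v21_def v12_def v22_def H11_def H12_def H21_def H22_def
      g11_def g21_def g12_def g22_def by Groebner_Basis.algebra+
  have Gr: "Gr1 = (g11 *\<^sub>R a + g21 *\<^sub>R b) + (G1 *\<^sub>R n11 + G2 *\<^sub>R n12)"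
           "Gr2 = (g12 *\<^sub>R a + g22 *\<^sub>R b) + (G1 *\<^sub>R n12 + G2 *\<^sub>R n22)"
    unfolding grad a1 a2 b2 g11_def g21_def g12_def g22_def by (simp_all add: algebra_simps)
  have Rt: "Rt1 = (v11 *\<^sub>R a + v21 *\<^sub>R b) + (V1 *\<^sub>R n11 + V2 *\<^sub>R n12)"
           "Rt2 = (v12 *\<^sub>R a + v22 *\<^sub>R b) + (V1 *\<^sub>R n12 + V2 *\<^sub>R n22)"
    unfolding rot a1 a2 b2 v11_def v21_def v12_def v22_def by (simp_all add: algebra_simps)
  define N where "N = n11 \<bullet> n22 - n12 \<bullet> n12"
  \<comment> \<open>Tangential and normal parts are orthogonal. The tangential parts produce the
    Hessian terms; the normal parts, with the components of the gradient and of its rotation as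
    coefficients, produce the multiple of \<open>N\<close>.\<close>
  have tang: "Gr1 \<bullet> Rt2 - Gr2 \<bullet> Rt1 = (v12 * H11 + v22 * H12) - (v11 * H21 + v21 * H22) + (G1 * V2 - G2 * V1) * N"
    unfolding Gr Rt N_def H11_def H12_def H21_def H22_def
    by (simp add: inner_add_left inner_add_right ip n' inner_commute[of n12 n11] inner_commute[of n22 n11]
        inner_commute[of n22 n12]) (simp add: algebra_simps)
  have RR: "R \<bullet> R = V1\<^sup>2 * E + 2 * V1 * V2 * F + V2\<^sup>2 * G"
    unfolding R by (simp add: inner_add_left inner_add_right ip power2_eq_square algebra_simps)
  have "s\<^sup>2 * (R \<bullet> R) = (V1 * s)\<^sup>2 * E + 2 * (V1 * s) * (V2 * s) * F + (V2 * s)\<^sup>2 * G"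
    unfolding RR by Groebner_Basis.algebra
  also have "\<dots> = s\<^sup>2 * (G1\<^sup>2 * E + 2 * G1 * G2 * F + G2\<^sup>2 * G)"
    unfolding V s(2) by Groebner_Basis.algebra
  finally have RR': "R \<bullet> R = G1\<^sup>2 * E + 2 * G1 * G2 * F + G2\<^sup>2 * G" using s(1) by simp
  \<comment> \<open>The area spanned by a vector and its rotation by a right angle is its squared
    length.\<close>
  have GV: "s * (G1 * V2 - G2 * V1) = R \<bullet> R"
  proof -
    have "s * (G1 * V2 - G2 * V1) = G1 * (V2 * s) - G2 * (V1 * s)" by Groebner_Basis.algebra
    then show ?thesis unfolding RR' V by Groebner_Basis.algebra
  qed
  have "s * (Gr1 \<bullet> Rt2 - Gr2 \<bullet> Rt1) = (s * v12) * H11 + (s * v22) * H12 - ((s * v11) * H21 + (s * v21) * H22)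
      + (s * (G1 * V2 - G2 * V1)) * N" unfolding tang by Groebner_Basis.algebra
  also have "\<dots> = - 2 * (H11 * H22 - H12\<^sup>2) + (R \<bullet> R) * N" unfolding v GV H by Groebner_Basis.algebra
  finally have lhs: "s * (Gr1 \<bullet> Rt2 - Gr2 \<bullet> Rt1) = - 2 * (H11 * H22 - H12\<^sup>2) + (R \<bullet> R) * (K * s\<^sup>2)"
    unfolding N_def K .
  have "L * s = v11 * F + v21 * G - (v12 * E + v22 * F)"
    unfolding L Rt by (simp add: inner_add_left inner_add_right ip n')
  then have "L * s\<^sup>2 = (s * v11) * F + (s * v21) * G - ((s * v12) * E + (s * v22) * F)" by Groebner_Basis.algebra
  then have Ls: "L * s\<^sup>2 = H11 * G - 2 * H12 * F + H22 * E" unfolding v H by simp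
  have "E * G - F\<^sup>2 \<ge> 0" unfolding s(2)[symmetric] by simp
  from four_det_le_trace_square[OF E this, of H11 H22 H12]
  have "4 * s\<^sup>2 * (H11 * H22 - H12\<^sup>2) \<le> (L * s\<^sup>2)\<^sup>2" unfolding Ls unfolding s(2) .
  then have "s\<^sup>2 * (4 * (H11 * H22 - H12\<^sup>2)) \<le> s\<^sup>2 * (s\<^sup>2 * L\<^sup>2)" by (simp add: power2_eq_square mult_ac)
  then have "4 * (H11 * H22 - H12\<^sup>2) \<le> s\<^sup>2 * L\<^sup>2" by (rule mult_left_le_imp_le) (use s(1) in simp)
  then have "s * (s * (K * (R \<bullet> R) - L\<^sup>2 / 2)) \<le> s * (Gr1 \<bullet> Rt2 - Gr2 \<bullet> Rt1)"
    unfolding lhs by (simp add: power2_eq_square algebra_simps)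
  then show ?thesis using s(1) by simp
qed

section \<open>Christoffel symbols, second fundamental form and the Gauss equation\<close>

lemma pd_gmat:
  assumes P: "local_param \<Sigma> U \<phi>" "u \<in> U"
  shows "pd c (\<lambda>v. gmat \<phi> v $ a $ b) u = pd a \<phi> u \<bullet> pd c (pd b \<phi>) u + pd c (pd a \<phi>) u \<bullet> pd b \<phi> u"
proof -
  have "pd a \<phi> differentiable (at u)" for a
    using smooth_on_differentiable[OF smooth_on_pd[OF local_paramD(2)[OF P(1)]] P(2)] .
  then show ?thesis unfolding gmat_def by (simp add: pd_inner)
qed

text \<open>For an induced metric the three derivatives of the metric coefficients combine, by the
  symmetry of second derivatives, to twice the inner product on the right. So the Christoffel
  symbols are the tangential coefficients of the second derivatives of \<phi>.\<close>

lemma christoffel_lowered: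
  assumes P: "local_param \<Sigma> U \<phi>" "u \<in> U"
  shows "(\<Sum>c\<in>UNIV. gmat \<phi> u $ d $ c * christoffel \<phi> c a b u) = pd d \<phi> u \<bullet> pd a (pd b \<phi>) u"
proof -
  let ?g = "gmat \<phi> u"
  define q where "q d = pd d \<phi> u \<bullet> pd a (pd b \<phi>) u" for d
  have cm: "pd a (pd b \<phi>) u = pd b (pd a \<phi>) u" for a b
    using pd_commute_vec[OF local_paramD(1)[OF P(1)] P(2) local_paramD(2)[OF P(1)]] .
  have br: "pd a (\<lambda>v. gmat \<phi> v $ b $ d) u + pd b (\<lambda>v. gmat \<phi> v $ a $ d) u - pd d (\<lambda>v. gmat \<phi> v $ a $ b) u = 2 * q d" for d
    unfolding pd_gmat[OF P] q_def cm[of d a] cm[of d b] cm[of b a] by (simp add: inner_commute)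
  have ch: "christoffel \<phi> c a b u = (\<Sum>e\<in>UNIV. matrix_inv ?g $ c $ e * q e)" for c
    unfolding christoffel_def br by (simp add: sum_distrib_left)
  have "invertible ?g" using gmat_det_pos[OF P] by (simp add: invertible_det_nz)
  then have inv: "?g ** matrix_inv ?g = Finite_Cartesian_Product.mat 1"
    unfolding invertible_def matrix_inv_def by (rule someI2_ex) blast
  have "(\<Sum>c\<in>UNIV. ?g $ d $ c * christoffel \<phi> c a b u) = (?g *v (matrix_inv ?g *v (\<chi> e. q e))) $ d"
    unfolding ch by (simp add: matrix_vector_mult_def)
  also have "\<dots> = q d" by (simp add: matrix_vector_mul_assoc inv)
  finally show ?thesis unfolding q_def .
qed

lemma christoffel_relations:
  assumes P: "local_param \<Sigma> U \<phi>" "u \<in> U"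
  shows "(pd 1 \<phi> u \<bullet> pd 1 \<phi> u) * christoffel \<phi> 1 a b u + (pd 1 \<phi> u \<bullet> pd 2 \<phi> u) * christoffel \<phi> 2 a b u
      = pd 1 \<phi> u \<bullet> pd a (pd b \<phi>) u"
    "(pd 1 \<phi> u \<bullet> pd 2 \<phi> u) * christoffel \<phi> 1 a b u + (pd 2 \<phi> u \<bullet> pd 2 \<phi> u) * christoffel \<phi> 2 a b u
      = pd 2 \<phi> u \<bullet> pd a (pd b \<phi>) u"
  using christoffel_lowered[OF P, of 1 a b] christoffel_lowered[OF P, of 2 a b]
  by (simp_all add: sum_2 gmat_def inner_commute)

lemma gmat_det_expand_pos:
  assumes P: "local_param \<Sigma> U \<phi>" "u \<in> U"
  shows "(pd 1 \<phi> u \<bullet> pd 1 \<phi> u) * (pd 2 \<phi> u \<bullet> pd 2 \<phi> u) - (pd 1 \<phi> u \<bullet> pd 2 \<phi> u)\<^sup>2 > 0"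
  using gmat_det_pos[OF P] unfolding gmat_det .

lemma cramer2:
  fixes E F G p q x y :: real
  assumes "E * x + F * y = p" "F * x + G * y = q" "E * G - F\<^sup>2 \<noteq> 0"
  shows "x = (G * p - F * q) / (E * G - F\<^sup>2)" "y = (E * q - F * p) / (E * G - F\<^sup>2)"
proof -
  have "x * (E * G - F\<^sup>2) = G * p - F * q" unfolding assms(1,2)[symmetric] by Groebner_Basis.algebra
  moreover have "y * (E * G - F\<^sup>2) = E * q - F * p" unfolding assms(1,2)[symmetric] by Groebner_Basis.algebra
  ultimately show "x = (G * p - F * q) / (E * G - F\<^sup>2)" "y = (E * q - F * p) / (E * G - F\<^sup>2)"
    using assms(3) by (simp_all add: eq_divide_eq)
qed

text \<open>\<open>riemann\<close> differentiates the Christoffel symbols. Cramer's rule writes them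
  as quotients of inner products of derivatives of \<phi> by the Gram determinant, which has no
  zeros.\<close>

lemma smooth_on_christoffel:
  assumes P: "local_param \<Sigma> U \<phi>"
  shows "smooth_on U (christoffel \<phi> c a b)"
proof -
  note U = local_paramD(1)[OF P] and s = local_paramD(2)[OF P]
  let ?E = "\<lambda>u. pd 1 \<phi> u \<bullet> pd 1 \<phi> u" and ?F = "\<lambda>u. pd 1 \<phi> u \<bullet> pd 2 \<phi> u" and ?G = "\<lambda>u. pd 2 \<phi> u \<bullet> pd 2 \<phi> u"
  let ?D = "\<lambda>u. ?E u * ?G u - (?F u)\<^sup>2"
  have nz: "\<forall>u\<in>U. ?D u \<noteq> 0" using gmat_det_expand_pos[OF P] by force
  have D: "smooth_on U ?D" unfolding power2_eq_square
    by (intro smooth_on_diff smooth_on_mult smooth_on_inner smooth_on_pd U s)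
  have 1: "smooth_on U (christoffel \<phi> 1 a b)"
    by (rule smooth_on_cong[OF U, where F="\<lambda>u. (?G u * (pd 1 \<phi> u \<bullet> pd a (pd b \<phi>) u) - ?F u * (pd 2 \<phi> u \<bullet> pd a (pd b \<phi>) u)) / ?D u"])
      (use cramer2(1)[OF christoffel_relations[OF P]] nz in simp,
        intro D smooth_on_divide nz smooth_on_diff smooth_on_mult smooth_on_inner smooth_on_pd U s)
  have 2: "smooth_on U (christoffel \<phi> 2 a b)"
    by (rule smooth_on_cong[OF U, where F="\<lambda>u. (?E u * (pd 2 \<phi> u \<bullet> pd a (pd b \<phi>) u) - ?F u * (pd 1 \<phi> u \<bullet> pd a (pd b \<phi>) u)) / ?D u"])
      (use cramer2(2)[OF christoffel_relations[OF P]] nz in simp,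
        intro D smooth_on_divide nz smooth_on_diff smooth_on_mult smooth_on_inner smooth_on_pd U s)
  show ?thesis using 1 2 exhaust_2[of c] by auto
qed

lemma christoffel_sym:
  assumes P: "local_param \<Sigma> U \<phi>" "u \<in> U"
  shows "christoffel \<phi> c a b u = christoffel \<phi> c b a u"
proof -
  have nz: "(pd 1 \<phi> u \<bullet> pd 1 \<phi> u) * (pd 2 \<phi> u \<bullet> pd 2 \<phi> u) - (pd 1 \<phi> u \<bullet> pd 2 \<phi> u)\<^sup>2 \<noteq> 0"
    using gmat_det_expand_pos[OF P] by simp
  have cm: "pd a (pd b \<phi>) u = pd b (pd a \<phi>) u"
    using pd_commute_vec[OF local_paramD(1)[OF P(1)] P(2) local_paramD(2)[OF P(1)]] .
  show ?thesis
    using cramer2[OF christoffel_relations[OF P, of a b] nz] cramer2[OF christoffel_relations[OF P, of b a] nz]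
      exhaust_2[of c] by (auto simp: cm)
qed

text \<open>The normal part of a second derivative of \<phi>. It stays vector valued because the
  codimension is arbitrary and there is no distinguished unit normal.\<close>

definition second_fundamental :: "(real^2 \<Rightarrow> real^'m) \<Rightarrow> 2 \<Rightarrow> 2 \<Rightarrow> real^2 \<Rightarrow> real^'m" where
  "second_fundamental \<phi> a b u
     = pd a (pd b \<phi>) u - christoffel \<phi> 1 a b u *\<^sub>R pd 1 \<phi> u - christoffel \<phi> 2 a b u *\<^sub>R pd 2 \<phi> u"

lemma second_fundamental_normal:
  assumes P: "local_param \<Sigma> U \<phi>" "u \<in> U"
  shows "second_fundamental \<phi> a b u \<bullet> pd 1 \<phi> u = 0" "second_fundamental \<phi> a b u \<bullet> pd 2 \<phi> u = 0"
  using christoffel_relations[OF P, of a b]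
  by (simp_all add: second_fundamental_def inner_diff_left inner_commute algebra_simps)

text \<open>The first Christoffel relation is differentiated for the index pair (2,2) in direction 1
  and for (1,2) in direction 2. In the difference the third derivatives of \<phi> cancel, and the
  rest follows by polynomial algebra from the undifferentiated relations.\<close>

lemma gauss_equation:
  assumes P: "local_param \<Sigma> U \<phi>" "u \<in> U"
  shows "(\<Sum>e\<in>UNIV. gmat \<phi> u $ 1 $ e * riemann \<phi> e 2 1 2 u)
    = second_fundamental \<phi> 1 1 u \<bullet> second_fundamental \<phi> 2 2 u
      - second_fundamental \<phi> 1 2 u \<bullet> second_fundamental \<phi> 1 2 u"
proof -
  note U = local_paramD(1)[OF P(1)] and s = local_paramD(2)[OF P(1)]
  let ?k = "christoffel \<phi>"
  have cd: "?k c a b differentiable (at u)" for c a b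
    using smooth_on_differentiable[OF smooth_on_christoffel[OF P(1)] P(2)] .
  have pdd: "pd a \<phi> differentiable (at u)" "pd a (pd b \<phi>) differentiable (at u)" for a b
    using smooth_on_differentiable[OF _ P(2)] smooth_on_pd s by blast+
  have dE: "(\<lambda>v. pd a \<phi> v \<bullet> pd b \<phi> v) differentiable (at u)" for a b
    by (rule bounded_bilinear_differentiable[OF bounded_bilinear_inner pdd(1) pdd(1)])
  have dm: "(\<lambda>v. pd a \<phi> v \<bullet> pd b \<phi> v * ?k c d e v) differentiable (at u)" for a b c d e
    by (rule bounded_bilinear_differentiable[OF bounded_bilinear_mult dE cd])
  have rel: "pd c (\<lambda>v. (pd 1 \<phi> v \<bullet> pd 1 \<phi> v) * ?k 1 a b v + (pd 1 \<phi> v \<bullet> pd 2 \<phi> v) * ?k 2 a b v) u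
      = pd c (\<lambda>v. pd 1 \<phi> v \<bullet> pd a (pd b \<phi>) v) u" for a b c
    using christoffel_relations(1)[OF P(1)] by (intro pd_cong_open[OF U P(2)]) auto
  have cm: "pd 2 (pd 1 \<phi>) u = pd 1 (pd 2 \<phi>) u"
    by (rule pd_commute_vec[OF U P(2) s])
  have cm3: "pd 2 (pd 1 (pd 2 \<phi>)) u = pd 1 (pd 2 (pd 2 \<phi>)) u"
    by (rule pd_commute_vec[OF U P(2) smooth_on_pd[OF s]])
  let ?a = "pd 1 \<phi> u" and ?b = "pd 2 \<phi> u"
  let ?a1 = "pd 1 (pd 1 \<phi>) u" and ?a2 = "pd 1 (pd 2 \<phi>) u" and ?b2 = "pd 2 (pd 2 \<phi>) u"
  note r1 = rel[of 1 2 2, simplified pd_add[OF dm dm] pd_mult[OF dE cd] pd_inner[OF pdd(1) pdd(1)] pd_inner[OF pdd(1) pdd(2)]]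
  note r2 = rel[of 2 1 2, simplified pd_add[OF dm dm] pd_mult[OF dE cd] pd_inner[OF pdd(1) pdd(1)] pd_inner[OF pdd(1) pdd(2)] cm cm3]
  note c = christoffel_relations[OF P, of 1 1] christoffel_relations[OF P, of 1 2] christoffel_relations[OF P, of 2 2]
  have ii: "?b \<bullet> ?a = ?a \<bullet> ?b" "?a1 \<bullet> ?a = ?a \<bullet> ?a1" "?a1 \<bullet> ?b = ?b \<bullet> ?a1" "?a2 \<bullet> ?a = ?a \<bullet> ?a2"
    "?a2 \<bullet> ?b = ?b \<bullet> ?a2" "?b2 \<bullet> ?a = ?a \<bullet> ?b2" "?b2 \<bullet> ?b = ?b \<bullet> ?b2" "?b2 \<bullet> ?a1 = ?a1 \<bullet> ?b2" "?b2 \<bullet> ?a2 = ?a2 \<bullet> ?b2"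
    "?a2 \<bullet> ?a1 = ?a1 \<bullet> ?a2"
    by (simp_all add: inner_commute)
  note sy = christoffel_sym[OF P, of _ 2 1]
  show ?thesis
    using r1 r2 c
    unfolding second_fundamental_def riemann_def sum_2 gmat_def vec_lambda_beta cm sy
      inner_diff_left inner_diff_right inner_scaleR_left inner_scaleR_right ii
    by Groebner_Basis.algebra
qed

section \<open>Gradient, rotated gradient and Laplacian in terms of Poisson brackets\<close>

definition rot_grad ::
    "(real^'m) set \<Rightarrow> (real^'m \<Rightarrow> real^'m \<Rightarrow> real^'m \<Rightarrow> real) \<Rightarrow> (real^'m \<Rightarrow> real) \<Rightarrow> 'm \<Rightarrow> real^'m \<Rightarrow> real" where
  "rot_grad \<Sigma> \<omega> f k = (\<lambda>x. 1 / gamma_fun \<Sigma> \<omega> x * poisson_bracket \<Sigma> \<omega> f (coord_fun \<Sigma> k) x)"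

text \<open>Applied to the coordinate functions, \<open>rot_grad\<close> gives the matrix of the
  tangential projection followed by the rotation. Contracting it with the rotated gradient rotates a
  second time, which is minus the identity on tangent vectors; hence the sign. Written this way, the
  components are smooth on the whole surface.\<close>

definition grad ::
    "(real^'m) set \<Rightarrow> (real^'m \<Rightarrow> real^'m \<Rightarrow> real^'m \<Rightarrow> real) \<Rightarrow> (real^'m \<Rightarrow> real) \<Rightarrow> 'm \<Rightarrow> real^'m \<Rightarrow> real" where
  "grad \<Sigma> \<omega> f k = (\<lambda>x. \<Sum>i\<in>UNIV. (- 1) * (rot_grad \<Sigma> \<omega> f i x * rot_grad \<Sigma> \<omega> (coord_fun \<Sigma> i) k x))"

text \<open>The classical counterpart of the discrete Laplacian: each commutator divided by i hbar
  becomes a bracket, which turns the prefactor -1/hbar^2 into 1.\<close>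

definition laplace ::
    "(real^'m) set \<Rightarrow> (real^'m \<Rightarrow> real^'m \<Rightarrow> real^'m \<Rightarrow> real) \<Rightarrow> (real^'m \<Rightarrow> real) \<Rightarrow> real^'m \<Rightarrow> real" where
  "laplace \<Sigma> \<omega> f = (\<lambda>x. \<Sum>j\<in>UNIV. rot_grad \<Sigma> \<omega> (rot_grad \<Sigma> \<omega> f j) j x)"

lemma rot_grad_smooth:
  assumes "closed_surface \<Sigma>" "symplectic_form \<Sigma> \<omega>" "(\<lambda>x. 1 / gamma_fun \<Sigma> \<omega> x) \<in> smooth_fun \<Sigma>" "f \<in> smooth_fun \<Sigma>"
  shows "rot_grad \<Sigma> \<omega> f k \<in> smooth_fun \<Sigma>"
  unfolding rot_grad_def
  by (intro smooth_fun_mult poisson_bracket_smooth coord_fun_smooth assms)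

lemma grad_smooth:
  assumes "closed_surface \<Sigma>" "symplectic_form \<Sigma> \<omega>" "(\<lambda>x. 1 / gamma_fun \<Sigma> \<omega> x) \<in> smooth_fun \<Sigma>" "f \<in> smooth_fun \<Sigma>"
  shows "grad \<Sigma> \<omega> f k \<in> smooth_fun \<Sigma>"
  unfolding grad_def
  by (intro smooth_fun_sum smooth_fun_cmult smooth_fun_mult rot_grad_smooth coord_fun_smooth assms)

lemma laplace_smooth:
  assumes "closed_surface \<Sigma>" "symplectic_form \<Sigma> \<omega>" "(\<lambda>x. 1 / gamma_fun \<Sigma> \<omega> x) \<in> smooth_fun \<Sigma>" "f \<in> smooth_fun \<Sigma>"
  shows "laplace \<Sigma> \<omega> f \<in> smooth_fun \<Sigma>"
  unfolding laplace_def
  by (intro smooth_fun_sum rot_grad_smooth assms)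

text \<open>\<open>rho\<close> cancels between the bracket and \<open>gamma_fun\<close>, so apart
  from the orientation the rotated gradient depends on the metric alone.\<close>

lemma rot_grad_local:
  assumes S: "closed_surface \<Sigma>" and W: "symplectic_form \<Sigma> \<omega>"
    and P: "oriented_param \<Sigma> \<omega> U \<phi>" "u \<in> U" and f: "f \<in> smooth_fun \<Sigma>"
  shows "rot_grad \<Sigma> \<omega> f k (\<phi> u)
    = (pd 1 (f \<circ> \<phi>) u * pd 2 \<phi> u $ k - pd 2 (f \<circ> \<phi>) u * pd 1 \<phi> u $ k) / sqrt (Determinants.det (gmat \<phi> u))"
proof -
  have L: "local_param \<Sigma> U \<phi>" and r: "rho \<omega> \<phi> u > 0" using P unfolding oriented_param_def by auto
  show ?thesis
    unfolding rot_grad_def gamma_fun_local[OF S W P] poisson_bracket_local[OF S W L P(2) f coord_fun_smooth]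
      pd_coord_fun[OF L P(2)] using r by simp
qed

text \<open>This is \<open>rotated_gradient_inequality\<close> at a single point of a chart, divided
  by \<open>rho\<close>. Most of the proof obtains the hypotheses of that lemma by differentiating
  relations that hold throughout the chart.\<close>

lemma curvature_inequality:
  fixes \<Sigma> :: "(real^'m) set"
  assumes S: "closed_surface \<Sigma>" and W: "symplectic_form \<Sigma> \<omega>"
    and ginv: "(\<lambda>x. 1 / gamma_fun \<Sigma> \<omega> x) \<in> smooth_fun \<Sigma>" and f: "f \<in> smooth_fun \<Sigma>" and p: "p \<in> \<Sigma>"
  shows "gamma_fun \<Sigma> \<omega> p * (gauss_curvature \<Sigma> \<omega> p * (\<Sum>k\<in>UNIV. (rot_grad \<Sigma> \<omega> f k p)\<^sup>2) - (laplace \<Sigma> \<omega> f p)\<^sup>2 / 2)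
    \<le> (\<Sum>k\<in>UNIV. poisson_bracket \<Sigma> \<omega> (grad \<Sigma> \<omega> f k) (rot_grad \<Sigma> \<omega> f k) p)"
proof -
  \<comment> \<open>The chart is the one selected by \<open>param_at\<close>, in which
    \<open>gauss_curvature\<close> is evaluated by definition.\<close>
  obtain U \<phi> u where q: "param_at \<Sigma> \<omega> p = (\<phi>, u)" "oriented_param \<Sigma> \<omega> U \<phi>" "u \<in> U" "\<phi> u = p"
    using param_at_works[OF S W p] .
  have P: "local_param \<Sigma> U \<phi>" and r: "rho \<omega> \<phi> u > 0" using q unfolding oriented_param_def by auto
  note U = local_paramD(1)[OF P] and sm = local_paramD(2)[OF P]
  note cong = pd_cong_open[OF U q(3)]
  define a b where "a = pd 1 \<phi>" and "b = pd 2 \<phi>"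
  define E where "E v = a v \<bullet> a v" for v
  define F where "F v = a v \<bullet> b v" for v
  define G where "G v = b v \<bullet> b v" for v
  define D where "D v = E v * G v - F v * F v" for v
  define s where "s v = sqrt (D v)" for v
  define w1 w2 where "w1 = pd 1 (f \<circ> \<phi>)" and "w2 = pd 2 (f \<circ> \<phi>)"
  \<comment> \<open>The differential with components \<open>w1\<close>, \<open>w2\<close>, with its
    index raised by the inverse metric; \<open>V1\<close> and \<open>V2\<close> are the components
    of its rotation.\<close>
  define G1 where "G1 v = (w1 v * G v - w2 v * F v) / D v" for v
  define G2 where "G2 v = (w2 v * E v - w1 v * F v) / D v" for v
  define V1 where "V1 v = - w2 v / s v" for v
  define V2 where "V2 v = w1 v / s v" for v
  define Gr where "Gr v = G1 v *\<^sub>R a v + G2 v *\<^sub>R b v" for v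
  define Rt where "Rt v = V1 v *\<^sub>R a v + V2 v *\<^sub>R b v" for v
  have Dpos: "D v > 0" and det: "Determinants.det (gmat \<phi> v) = D v" if "v \<in> U" for v
    using gmat_det_pos[OF P that] unfolding gmat_det D_def E_def F_def G_def a_def b_def by (auto simp: power2_eq_square)
  have spos: "s v > 0" and ss: "s v * s v = D v" if "v \<in> U" for v using Dpos[OF that] by (simp_all add: s_def)
  have Dnz: "\<forall>v\<in>U. D v \<noteq> 0" and snz: "\<forall>v\<in>U. s v \<noteq> 0" using Dpos spos by force+
  have sa: "smooth_on U a" "smooth_on U b" unfolding a_def b_def using sm smooth_on_pd by blast+
  have sE: "smooth_on U E" "smooth_on U F" "smooth_on U G"
    unfolding E_def[abs_def] F_def[abs_def] G_def[abs_def] by (intro smooth_on_inner U sa)+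
  have sD: "smooth_on U D" unfolding D_def[abs_def] by (intro smooth_on_diff smooth_on_mult U sE)
  have sS: "smooth_on U s" unfolding s_def[abs_def] using smooth_on_sqrt[OF U _ sD] Dpos by blast
  have sw: "smooth_on U w1" "smooth_on U w2"
    unfolding w1_def w2_def using smooth_fun_comp[OF f P] smooth_on_pd by blast+
  have sG: "smooth_on U G1" "smooth_on U G2"
    unfolding G1_def[abs_def] G2_def[abs_def] by (intro smooth_on_divide smooth_on_diff smooth_on_mult Dnz U sE sw sD)+
  have sV: "smooth_on U V1" "smooth_on U V2"
    unfolding V1_def[abs_def] V2_def[abs_def] by (intro smooth_on_divide smooth_on_minus snz U sw sS)+
  have sGr: "smooth_on U Gr" and sRt: "smooth_on U Rt"
    unfolding Gr_def[abs_def] Rt_def[abs_def] by (intro smooth_on_add smooth_on_scaleR U sa sG sV)+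
  have d: "F differentiable (at u)" if "smooth_on U F" for F :: "real^2 \<Rightarrow> 'c::real_normed_vector"
    using smooth_on_differentiable[OF that q(3)] .
  note dd = d[OF sa(1)] d[OF sa(2)] d[OF sE(1)] d[OF sE(2)] d[OF sE(3)] d[OF sD] d[OF sS] d[OF sw(1)] d[OF sw(2)]
    d[OF sG(1)] d[OF sG(2)] d[OF sV(1)] d[OF sV(2)]
  have dm: "(\<lambda>v. f v * g v) differentiable (at u)"
    if "f differentiable (at u)" "g differentiable (at u)" for f g :: "real^2 \<Rightarrow> real"
    using bounded_bilinear_differentiable[OF bounded_bilinear_mult that] .
  have ds: "(\<lambda>v. f v *\<^sub>R g v) differentiable (at u)"
    if "f differentiable (at u)" "g differentiable (at u)" for f and g :: "real^2 \<Rightarrow> real^'m"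
    using bounded_bilinear_differentiable[OF bounded_bilinear_scaleR that] .
  have cm: "pd 2 a u = pd 1 b u" unfolding a_def b_def by (rule pd_commute_vec[OF U q(3) sm])
  have cw: "pd 2 w1 u = pd 1 w2 u" unfolding w1_def w2_def by (rule pd_commute[OF U q(3) smooth_fun_comp[OF f P]])
  let ?a1 = "pd 1 a u" and ?a2 = "pd 1 b u" and ?b2 = "pd 2 b u"
  have dE: "pd 1 E u = 2 * (a u \<bullet> ?a1)" "pd 2 E u = 2 * (a u \<bullet> ?a2)"
    "pd 1 F u = ?a1 \<bullet> b u + a u \<bullet> ?a2" "pd 2 F u = ?a2 \<bullet> b u + a u \<bullet> ?b2"
    "pd 1 G u = 2 * (b u \<bullet> ?a2)" "pd 2 G u = 2 * (b u \<bullet> ?b2)"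
    unfolding E_def[abs_def] F_def[abs_def] G_def[abs_def]
    by (simp_all add: pd_inner dd cm inner_commute)
  \<comment> \<open>Differentiating \<open>s v * s v = D v\<close>, and later the product relations
    for \<open>w1\<close>, \<open>w2\<close>, \<open>V1\<close> and \<open>V2\<close>, gives the
    derivative identities directly in the denominator-free form that the frame inequality
    expects.\<close>
  have dS: "2 * s u * pd c s u = pd c E u * G u + E u * pd c G u - 2 * F u * pd c F u" for c
  proof -
    have "pd c (\<lambda>v. s v * s v) u = pd c (\<lambda>v. E v * G v - F v * F v) u"
      using ss by (intro cong) (simp add: D_def)
    then show ?thesis by (simp add: pd_mult pd_diff dm dd)
  qed
  have w1: "w1 v = G1 v * E v + G2 v * F v" and w2: "w2 v = G1 v * F v + G2 v * G v" if "v \<in> U" for v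
  proof -
    have "D v * w1 v = (w1 v * G v - w2 v * F v) * E v + (w2 v * E v - w1 v * F v) * F v"
         "D v * w2 v = (w1 v * G v - w2 v * F v) * F v + (w2 v * E v - w1 v * F v) * G v"
      by (simp_all add: D_def algebra_simps)
    moreover have "w1 v = D v * w1 v / D v" "w2 v = D v * w2 v / D v" using Dpos[OF that] by simp_all
    ultimately show "w1 v = G1 v * E v + G2 v * F v" "w2 v = G1 v * F v + G2 v * G v"
      unfolding G1_def G2_def by (simp_all only: add_divide_distrib times_divide_eq_left)
  qed
  have dw1: "pd c w1 u = pd c G1 u * E u + G1 u * pd c E u + pd c G2 u * F u + G2 u * pd c F u" for c
  proof -
    have "pd c w1 u = pd c (\<lambda>v. G1 v * E v + G2 v * F v) u" using w1 by (intro cong)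
    then show ?thesis by (simp add: pd_mult pd_add dm dd)
  qed
  have dw2: "pd c w2 u = pd c G1 u * F u + G1 u * pd c F u + pd c G2 u * G u + G2 u * pd c G u" for c
  proof -
    have "pd c w2 u = pd c (\<lambda>v. G1 v * F v + G2 v * G v) u" using w2 by (intro cong)
    then show ?thesis by (simp add: pd_mult pd_add dm dd)
  qed
  have V1s: "V1 v * s v = - w2 v" and V2s: "V2 v * s v = w1 v" if "v \<in> U" for v
    using spos[OF that] by (simp_all add: V1_def V2_def)
  have dV1: "pd c V1 u * s u + V1 u * pd c s u = - pd c w2 u" for c
  proof -
    have "pd c (\<lambda>v. V1 v * s v) u = pd c (\<lambda>v. - w2 v) u" using V1s by (intro cong)
    then show ?thesis by (simp add: pd_mult pd_minus dd)
  qed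
  have dV2: "pd c V2 u * s u + V2 u * pd c s u = pd c w1 u" for c
  proof -
    have "pd c (\<lambda>v. V2 v * s v) u = pd c w1 u" using V2s by (intro cong)
    then show ?thesis by (simp add: pd_mult dd)
  qed
  have dGr: "pd c Gr u = pd c G1 u *\<^sub>R a u + G1 u *\<^sub>R pd c a u + (pd c G2 u *\<^sub>R b u + G2 u *\<^sub>R pd c b u)" for c
    unfolding Gr_def[abs_def] by (simp add: pd_add pd_scaleR ds dd)
  have dRt: "pd c Rt u = pd c V1 u *\<^sub>R a u + V1 u *\<^sub>R pd c a u + (pd c V2 u *\<^sub>R b u + V2 u *\<^sub>R pd c b u)" for c
    unfolding Rt_def[abs_def] by (simp add: pd_add pd_scaleR ds dd)
  have rg: "rot_grad \<Sigma> \<omega> f k (\<phi> v) = Rt v $ k" if "v \<in> U" for k v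
    unfolding rot_grad_local[OF S W q(2) that f] det[OF that]
    by (simp add: Rt_def V1_def V2_def a_def b_def w1_def w2_def s_def diff_divide_distrib)
  have gr: "grad \<Sigma> \<omega> f k (\<phi> v) = Gr v $ k" if v: "v \<in> U" for k v
  proof -
    have "grad \<Sigma> \<omega> f k (\<phi> v) = (\<Sum>i\<in>UNIV. (- 1) * (Rt v $ i * ((a v $ i * b v $ k - b v $ i * a v $ k) / s v)))"
      unfolding grad_def rg[OF v] rot_grad_local[OF S W q(2) v coord_fun_smooth] pd_coord_fun[OF P v] det[OF v]
      by (simp add: a_def b_def s_def)
    also have "\<dots> = (\<Sum>i\<in>UNIV. (Rt v $ i * b v $ i) * (a v $ k / s v) - (Rt v $ i * a v $ i) * (b v $ k / s v))"
      by (intro sum.cong refl) (simp add: field_simps diff_divide_distrib)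
    also have "\<dots> = (Rt v \<bullet> b v) * (a v $ k / s v) - (Rt v \<bullet> a v) * (b v $ k / s v)"
      by (simp add: sum_subtractf inner_vec_def sum_distrib_right sum_divide_distrib)
    also have "Rt v \<bullet> b v = (w1 v * G v - w2 v * F v) / s v"
      by (simp add: Rt_def V1_def V2_def inner_add_left inner_diff_left F_def G_def diff_divide_distrib)
    also have "Rt v \<bullet> a v = (w1 v * F v - w2 v * E v) / s v"
      by (simp add: Rt_def V1_def V2_def inner_add_left inner_diff_left F_def E_def inner_commute[of "b v"] diff_divide_distrib)
    finally show ?thesis unfolding Gr_def G1_def G2_def ss[OF v, symmetric]
      by (simp add: diff_divide_distrib algebra_simps)
  qed
  have prg: "pd c (rot_grad \<Sigma> \<omega> f k \<circ> \<phi>) u = pd c Rt u $ k" for c k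
  proof -
    have "pd c (rot_grad \<Sigma> \<omega> f k \<circ> \<phi>) u = pd c (\<lambda>v. Rt v $ k) u" using rg by (intro cong) simp
    then show ?thesis by (simp add: pd_component d[OF sRt])
  qed
  have pgr: "pd c (grad \<Sigma> \<omega> f k \<circ> \<phi>) u = pd c Gr u $ k" for c k
  proof -
    have "pd c (grad \<Sigma> \<omega> f k \<circ> \<phi>) u = pd c (\<lambda>v. Gr v $ k) u" using gr by (intro cong) simp
    then show ?thesis by (simp add: pd_component d[OF sGr])
  qed
  note rs = rot_grad_smooth[OF S W ginv f]
  have lap: "laplace \<Sigma> \<omega> f p * s u = pd 1 Rt u \<bullet> b u - pd 2 Rt u \<bullet> a u"
  proof -
    have "laplace \<Sigma> \<omega> f p = (\<Sum>j\<in>UNIV. (pd 1 Rt u $ j * b u $ j - pd 2 Rt u $ j * a u $ j) / s u)"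
      unfolding laplace_def q(4)[symmetric] rot_grad_local[OF S W q(2,3) rs] prg det[OF q(3)]
      by (simp add: a_def b_def s_def)
    also have "\<dots> = (pd 1 Rt u \<bullet> b u - pd 2 Rt u \<bullet> a u) / s u"
      by (simp add: inner_vec_def sum_subtractf flip: sum_divide_distrib)
    finally show ?thesis using spos[OF q(3)] by simp
  qed
  have br: "(\<Sum>k\<in>UNIV. poisson_bracket \<Sigma> \<omega> (grad \<Sigma> \<omega> f k) (rot_grad \<Sigma> \<omega> f k) p)
    = (pd 1 Gr u \<bullet> pd 2 Rt u - pd 2 Gr u \<bullet> pd 1 Rt u) / rho \<omega> \<phi> u"
    unfolding q(4)[symmetric] poisson_bracket_local[OF S W P q(3) grad_smooth[OF S W ginv f] rs] prg pgr
    by (simp add: inner_vec_def sum_subtractf flip: sum_divide_distrib)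
  have R2: "(\<Sum>k\<in>UNIV. (rot_grad \<Sigma> \<omega> f k p)\<^sup>2) = Rt u \<bullet> Rt u"
    unfolding q(4)[symmetric] rg[OF q(3)] by (simp add: inner_vec_def power2_eq_square)
  have gam: "gamma_fun \<Sigma> \<omega> p = s u / rho \<omega> \<phi> u"
    using gamma_fun_local[OF S W q(2,3)] det[OF q(3)] q(4) by (simp add: s_def)
  let ?n = "\<lambda>a b. second_fundamental \<phi> a b u"
  have K: "gauss_curvature \<Sigma> \<omega> p * (s u)\<^sup>2 = ?n 1 1 \<bullet> ?n 2 2 - ?n 1 2 \<bullet> ?n 1 2"
    unfolding gauss_curvature_def using p q(1) Dpos[OF q(3)]
    by (simp add: gauss_equation[OF P q(3)] det[OF q(3)] power2_eq_square ss[OF q(3)])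
  have Epos: "E u > 0"
  proof -
    have "E u \<noteq> 0"
    proof
      assume "E u = 0"
      then have "D u \<le> 0" by (simp add: D_def)
      then show False using Dpos[OF q(3)] by simp
    qed
    then show ?thesis by (simp add: E_def)
  qed
  note nn = second_fundamental_normal[OF P q(3), folded a_def b_def]
  have sf: "pd c (pd e \<phi>) u = christoffel \<phi> 1 c e u *\<^sub>R a u + christoffel \<phi> 2 c e u *\<^sub>R b u + ?n c e" for c e
    unfolding second_fundamental_def a_def b_def by simp
  have "s u * (gauss_curvature \<Sigma> \<omega> p * (Rt u \<bullet> Rt u) - (laplace \<Sigma> \<omega> f p)\<^sup>2 / 2)
    \<le> pd 1 Gr u \<bullet> pd 2 Rt u - pd 2 Gr u \<bullet> pd 1 Rt u"
  proof (rule rotated_gradient_inequality)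
    show "(s u)\<^sup>2 = (a u \<bullet> a u) * (b u \<bullet> b u) - (a u \<bullet> b u)\<^sup>2"
      using ss[OF q(3)] by (simp add: D_def E_def F_def G_def power2_eq_square)
    show "?a1 = christoffel \<phi> 1 1 1 u *\<^sub>R a u + christoffel \<phi> 2 1 1 u *\<^sub>R b u + ?n 1 1"
         "?a2 = christoffel \<phi> 1 1 2 u *\<^sub>R a u + christoffel \<phi> 2 1 2 u *\<^sub>R b u + ?n 1 2"
         "?b2 = christoffel \<phi> 1 2 2 u *\<^sub>R a u + christoffel \<phi> 2 2 2 u *\<^sub>R b u + ?n 2 2"
      using sf[of 1 1] sf[of 1 2] sf[of 2 2] unfolding a_def[symmetric] b_def[symmetric] by auto
    show "2 * s u * pd 1 s u = 2 * (a u \<bullet> ?a1) * (b u \<bullet> b u) + (a u \<bullet> a u) * (2 * (b u \<bullet> ?a2)) - 2 * (a u \<bullet> b u) * (?a1 \<bullet> b u + a u \<bullet> ?a2)"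
         "2 * s u * pd 2 s u = 2 * (a u \<bullet> ?a2) * (b u \<bullet> b u) + (a u \<bullet> a u) * (2 * (b u \<bullet> ?b2)) - 2 * (a u \<bullet> b u) * (?a2 \<bullet> b u + a u \<bullet> ?b2)"
      using dS[of 1] dS[of 2] unfolding dE unfolding E_def F_def G_def by auto
    show "V1 u * s u = - (G1 u * (a u \<bullet> b u) + G2 u * (b u \<bullet> b u))" "V2 u * s u = G1 u * (a u \<bullet> a u) + G2 u * (a u \<bullet> b u)"
      using V1s[OF q(3)] V2s[OF q(3)] w1[OF q(3)] w2[OF q(3)] by (simp_all add: E_def F_def G_def)
    show "pd 1 V1 u * s u + V1 u * pd 1 s u = - (pd 1 G1 u * (a u \<bullet> b u) + G1 u * (?a1 \<bullet> b u + a u \<bullet> ?a2) + pd 1 G2 u * (b u \<bullet> b u) + G2 u * (2 * (b u \<bullet> ?a2)))"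
         "pd 2 V1 u * s u + V1 u * pd 2 s u = - (pd 2 G1 u * (a u \<bullet> b u) + G1 u * (?a2 \<bullet> b u + a u \<bullet> ?b2) + pd 2 G2 u * (b u \<bullet> b u) + G2 u * (2 * (b u \<bullet> ?b2)))"
         "pd 1 V2 u * s u + V2 u * pd 1 s u = pd 1 G1 u * (a u \<bullet> a u) + G1 u * (2 * (a u \<bullet> ?a1)) + pd 1 G2 u * (a u \<bullet> b u) + G2 u * (?a1 \<bullet> b u + a u \<bullet> ?a2)"
         "pd 2 V2 u * s u + V2 u * pd 2 s u = pd 2 G1 u * (a u \<bullet> a u) + G1 u * (2 * (a u \<bullet> ?a2)) + pd 2 G2 u * (a u \<bullet> b u) + G2 u * (?a2 \<bullet> b u + a u \<bullet> ?b2)"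
      unfolding dV1 dV2 dw1 dw2 dE by (simp_all add: E_def F_def G_def)
    show "pd 1 G1 u * (a u \<bullet> b u) + G1 u * (?a1 \<bullet> b u + a u \<bullet> ?a2) + pd 1 G2 u * (b u \<bullet> b u) + G2 u * (2 * (b u \<bullet> ?a2))
       = pd 2 G1 u * (a u \<bullet> a u) + G1 u * (2 * (a u \<bullet> ?a2)) + pd 2 G2 u * (a u \<bullet> b u) + G2 u * (?a2 \<bullet> b u + a u \<bullet> ?b2)"
      using cw unfolding dw1 dw2 dE by (simp add: E_def F_def G_def)
    show "pd 1 Gr u = pd 1 G1 u *\<^sub>R a u + G1 u *\<^sub>R ?a1 + (pd 1 G2 u *\<^sub>R b u + G2 u *\<^sub>R ?a2)"
         "pd 2 Gr u = pd 2 G1 u *\<^sub>R a u + G1 u *\<^sub>R ?a2 + (pd 2 G2 u *\<^sub>R b u + G2 u *\<^sub>R ?b2)"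
      unfolding dGr cm by (rule refl)+
    show "pd 1 Rt u = pd 1 V1 u *\<^sub>R a u + V1 u *\<^sub>R ?a1 + (pd 1 V2 u *\<^sub>R b u + V2 u *\<^sub>R ?a2)"
         "pd 2 Rt u = pd 2 V1 u *\<^sub>R a u + V1 u *\<^sub>R ?a2 + (pd 2 V2 u *\<^sub>R b u + V2 u *\<^sub>R ?b2)"
      unfolding dRt cm by (rule refl)+
  qed (use nn spos[OF q(3)] Epos K lap in \<open>auto simp: E_def Rt_def\<close>)
  then show ?thesis unfolding gam br R2 using r by (simp add: divide_right_mono)
qed

section \<open>Limits of traces\<close>

locale matrix_regularization =
  fixes \<Sigma> :: "(real^'m) set"
    and \<omega> :: "real^'m \<Rightarrow> real^'m \<Rightarrow> real^'m \<Rightarrow> real"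
    and N :: "nat \<Rightarrow> nat"
    and T :: "nat \<Rightarrow> (real^'m \<Rightarrow> real) \<Rightarrow> complex Matrix.mat"
    and hbar :: "nat \<Rightarrow> real"
  assumes surface: "closed_surface \<Sigma>"
    and symplectic: "symplectic_form \<Sigma> \<omega>"
    and regularization: "Ck_matrix_regularization 2 \<Sigma> \<omega> N T hbar"
begin

abbreviation tends :: "(nat \<Rightarrow> complex Matrix.mat) \<Rightarrow> (real^'m \<Rightarrow> real) \<Rightarrow> bool" where
  "tends \<equiv> matrix_seq_converges \<Sigma> N T"

abbreviation bracket :: "(real^'m \<Rightarrow> real) \<Rightarrow> (real^'m \<Rightarrow> real) \<Rightarrow> real^'m \<Rightarrow> real" where
  "bracket \<equiv> poisson_bracket \<Sigma> \<omega>"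

abbreviation deriv_mat :: "nat \<Rightarrow> (real^'m \<Rightarrow> real) \<Rightarrow> complex Matrix.mat \<Rightarrow> complex Matrix.mat" where
  "deriv_mat \<alpha> f X \<equiv> (1 / (\<i> * complex_of_real (hbar (N \<alpha>)))) \<cdot>\<^sub>m commutator X (T \<alpha> f)"

lemma hbar_pos: "hbar (N \<alpha>) > 0"
  using regularization unfolding Ck_matrix_regularization_def by auto

lemma T_carrier [simp]: "f \<in> smooth_fun \<Sigma> \<Longrightarrow> T \<alpha> f \<in> carrier_mat (N \<alpha>) (N \<alpha>)"
  and T_adjoint: "f \<in> smooth_fun \<Sigma> \<Longrightarrow> mat_adjoint (T \<alpha> f) = T \<alpha> f"
  using regularization unfolding Ck_matrix_regularization_def by auto

lemma T_linear:
  "f \<in> smooth_fun \<Sigma> \<Longrightarrow> h \<in> smooth_fun \<Sigma> \<Longrightarrow>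
    T \<alpha> (\<lambda>x. a * f x + b * h x) = complex_of_real a \<cdot>\<^sub>m T \<alpha> f + complex_of_real b \<cdot>\<^sub>m T \<alpha> h"
  using regularization unfolding Ck_matrix_regularization_def by blast

lemma tends_carrier: "tends X f \<Longrightarrow> X \<alpha> \<in> carrier_mat (N \<alpha>) (N \<alpha>)"
  and tends_smooth: "tends X f \<Longrightarrow> f \<in> smooth_fun \<Sigma>"
  unfolding matrix_seq_converges_def by auto

lemma tends_T: "f \<in> smooth_fun \<Sigma> \<Longrightarrow> tends (\<lambda>\<alpha>. T \<alpha> f) f"
  unfolding matrix_seq_converges_def by simp

lemma tends_bounded:
  assumes "tends X f"
  shows "\<exists>B. \<forall>\<alpha>. op_norm (X \<alpha>) \<le> B"
proof -
  have f: "f \<in> smooth_fun \<Sigma>" using tends_smooth[OF assms] .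
  have "convergent (\<lambda>\<alpha>. op_norm (T \<alpha> f))"
    using regularization f unfolding Ck_matrix_regularization_def by blast
  moreover have "convergent (\<lambda>\<alpha>. op_norm (X \<alpha> - T \<alpha> f))"
    using assms unfolding matrix_seq_converges_def convergent_def by blast
  ultimately have "Bseq (\<lambda>\<alpha>. op_norm (X \<alpha> - T \<alpha> f) + op_norm (T \<alpha> f))"
    by (intro convergent_imp_Bseq convergent_add)
  then obtain B where B: "B > 0" "\<And>\<alpha>. norm (op_norm (X \<alpha> - T \<alpha> f) + op_norm (T \<alpha> f)) \<le> B"
    using BseqE by blast
  have "op_norm (X \<alpha>) \<le> B" for \<alpha>
  proof -
    have "X \<alpha> - T \<alpha> f + T \<alpha> f = X \<alpha>" using tends_carrier[OF assms, of \<alpha>] T_carrier[OF f, of \<alpha>] by auto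
    then have "op_norm (X \<alpha>) \<le> op_norm (X \<alpha> - T \<alpha> f) + op_norm (T \<alpha> f)"
      using op_norm_add_le[of "X \<alpha> - T \<alpha> f" "N \<alpha>" "N \<alpha>" "T \<alpha> f"] f by (simp add: minus_carrier_mat)
    then show ?thesis using B(2)[of \<alpha>] by simp
  qed
  then show ?thesis by blast
qed

text \<open>The factors are replaced by \<open>T \<alpha> f\<close> and \<open>T \<alpha> h\<close>
  one at a time, the other factor being bounded in norm; the last error is the asymptotic
  multiplicativity of \<open>T\<close>.\<close>

lemma tends_mult:
  assumes X: "tends X f" and Y: "tends Y h"
  shows "tends (\<lambda>\<alpha>. X \<alpha> * Y \<alpha>) (\<lambda>x. f x * h x)"
proof -
  note f = tends_smooth[OF X] and h = tends_smooth[OF Y]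
  note Xc = tends_carrier[OF X] and Yc = tends_carrier[OF Y]
  obtain B where B: "\<And>\<alpha>. op_norm (Y \<alpha>) \<le> B" using tends_bounded[OF Y] by blast
  obtain C where C: "\<And>\<alpha>. op_norm (T \<alpha> f) \<le> C" using tends_bounded[OF tends_T[OF f]] by blast
  let ?r = "\<lambda>\<alpha>. op_norm (X \<alpha> - T \<alpha> f) * B + C * op_norm (Y \<alpha> - T \<alpha> h)
    + op_norm (T \<alpha> (\<lambda>x. f x * h x) - T \<alpha> f * T \<alpha> h)"
  have fh: "(\<lambda>x. f x * h x) \<in> smooth_fun \<Sigma>" using smooth_fun_mult[OF f h] .
  have bound: "op_norm (X \<alpha> * Y \<alpha> - T \<alpha> (\<lambda>x. f x * h x)) \<le> ?r \<alpha>" for \<alpha>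
  proof -
    let ?n = "N \<alpha>"
    note cs = Xc[of \<alpha>] Yc[of \<alpha>] T_carrier[OF f, of \<alpha>] T_carrier[OF h, of \<alpha>] T_carrier[OF fh, of \<alpha>]
    have 1: "op_norm (X \<alpha> * Y \<alpha> - T \<alpha> f * Y \<alpha>) \<le> op_norm (X \<alpha> - T \<alpha> f) * B"
    proof -
      have "X \<alpha> * Y \<alpha> - T \<alpha> f * Y \<alpha> = (X \<alpha> - T \<alpha> f) * Y \<alpha>"
        using cs by (simp add: minus_mult_distrib_mat[of _ ?n ?n])
      also have "op_norm \<dots> \<le> op_norm (X \<alpha> - T \<alpha> f) * op_norm (Y \<alpha>)"
        using cs by (intro op_norm_mult_le[of _ ?n ?n _ ?n] minus_carrier_mat)
      also have "\<dots> \<le> op_norm (X \<alpha> - T \<alpha> f) * B" using B by (simp add: mult_left_mono)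
      finally show ?thesis .
    qed
    have 2: "op_norm (T \<alpha> f * Y \<alpha> - T \<alpha> f * T \<alpha> h) \<le> C * op_norm (Y \<alpha> - T \<alpha> h)"
    proof -
      have "T \<alpha> f * Y \<alpha> - T \<alpha> f * T \<alpha> h = T \<alpha> f * (Y \<alpha> - T \<alpha> h)"
        using cs by (simp add: mult_minus_distrib_mat[of _ ?n ?n])
      also have "op_norm \<dots> \<le> op_norm (T \<alpha> f) * op_norm (Y \<alpha> - T \<alpha> h)"
        using cs by (intro op_norm_mult_le[of _ ?n ?n _ ?n] minus_carrier_mat)
      also have "\<dots> \<le> C * op_norm (Y \<alpha> - T \<alpha> h)" using C by (simp add: mult_right_mono)
      finally show ?thesis .
    qed
    have 3: "op_norm (T \<alpha> f * T \<alpha> h - T \<alpha> (\<lambda>x. f x * h x)) \<le> op_norm (T \<alpha> (\<lambda>x. f x * h x) - T \<alpha> f * T \<alpha> h)"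
    proof -
      have "T \<alpha> f * T \<alpha> h - T \<alpha> (\<lambda>x. f x * h x) = (-1) \<cdot>\<^sub>m (T \<alpha> (\<lambda>x. f x * h x) - T \<alpha> f * T \<alpha> h)"
        using cs by auto
      then show ?thesis using op_norm_smult_le[of "-1" "T \<alpha> (\<lambda>x. f x * h x) - T \<alpha> f * T \<alpha> h"] by simp
    qed
    have "op_norm (X \<alpha> * Y \<alpha> - T \<alpha> (\<lambda>x. f x * h x))
      \<le> op_norm (X \<alpha> * Y \<alpha> - T \<alpha> f * Y \<alpha>) + op_norm (T \<alpha> f * Y \<alpha> - T \<alpha> (\<lambda>x. f x * h x))"
      using cs by (intro op_norm_diff_triangle[of _ ?n ?n]) auto
    also have "op_norm (T \<alpha> f * Y \<alpha> - T \<alpha> (\<lambda>x. f x * h x))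
      \<le> op_norm (T \<alpha> f * Y \<alpha> - T \<alpha> f * T \<alpha> h) + op_norm (T \<alpha> f * T \<alpha> h - T \<alpha> (\<lambda>x. f x * h x))"
      using cs by (intro op_norm_diff_triangle[of _ ?n ?n]) auto
    finally show ?thesis using 1 2 3 by linarith
  qed
  have "(\<lambda>\<alpha>. op_norm (T \<alpha> (\<lambda>x. f x * h x) - T \<alpha> f * T \<alpha> h)) \<longlonglongrightarrow> 0"
    using regularization f h unfolding Ck_matrix_regularization_def by blast
  moreover have "(\<lambda>\<alpha>. op_norm (X \<alpha> - T \<alpha> f)) \<longlonglongrightarrow> 0" "(\<lambda>\<alpha>. op_norm (Y \<alpha> - T \<alpha> h)) \<longlonglongrightarrow> 0"
    using X Y unfolding matrix_seq_converges_def by blast+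
  ultimately have "?r \<longlonglongrightarrow> 0 * B + C * 0 + 0" by (intro tendsto_intros)
  then have "?r \<longlonglongrightarrow> 0" by simp
  then have "(\<lambda>\<alpha>. op_norm (X \<alpha> * Y \<alpha> - T \<alpha> (\<lambda>x. f x * h x))) \<longlonglongrightarrow> 0"
    by (rule Lim_null_comparison[rotated]) (simp add: bound)
  then show ?thesis unfolding matrix_seq_converges_def using fh mult_carrier_mat[OF Xc Yc] by blast
qed

section \<open>Traces and the integral\<close>

lemma N_hbar_bounded: "\<exists>B. \<forall>\<alpha>. real (N \<alpha>) * hbar (N \<alpha>) \<le> B"
proof -
  have "convergent (\<lambda>n. real n * hbar n)"
    using regularization unfolding Ck_matrix_regularization_def by blast
  then have "Bseq (\<lambda>n. real n * hbar n)" by (rule convergent_imp_Bseq)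
  then obtain B where B: "B > 0" "\<And>n. norm (real n * hbar n) \<le> B" using BseqE by blast
  have "real (N \<alpha>) * hbar (N \<alpha>) \<le> B" for \<alpha> using B(2)[of "N \<alpha>"] by simp
  then show ?thesis by blast
qed

lemma trace_T_limit:
  "f \<in> smooth_fun \<Sigma> \<Longrightarrow> (\<lambda>\<alpha>. complex_of_real (2 * pi * hbar (N \<alpha>)) * mtrace (T \<alpha> f))
    \<longlonglongrightarrow> complex_of_real (form_integral \<Sigma> \<omega> f)"
  using regularization unfolding Ck_matrix_regularization_def by blast

text \<open>The trace of an error matrix is at most \<open>N \<alpha>\<close> times its norm, and
  the boundedness of \<open>N \<alpha>\<close> times \<open>hbar (N \<alpha>)\<close> compensates
  for the growing dimension.\<close>

lemma tends_trace:
  assumes X: "tends X f"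
  shows "(\<lambda>\<alpha>. complex_of_real (2 * pi * hbar (N \<alpha>)) * mtrace (X \<alpha>)) \<longlonglongrightarrow> complex_of_real (form_integral \<Sigma> \<omega> f)"
proof -
  note f = tends_smooth[OF X] and Xc = tends_carrier[OF X]
  obtain B where B: "\<And>\<alpha>. real (N \<alpha>) * hbar (N \<alpha>) \<le> B" using N_hbar_bounded by blast
  let ?c = "\<lambda>\<alpha>. complex_of_real (2 * pi * hbar (N \<alpha>))"
  have bound: "cmod (?c \<alpha> * mtrace (X \<alpha> - T \<alpha> f)) \<le> (2 * pi * B) * op_norm (X \<alpha> - T \<alpha> f)" for \<alpha>
  proof -
    have "cmod (?c \<alpha> * mtrace (X \<alpha> - T \<alpha> f)) = 2 * pi * hbar (N \<alpha>) * cmod (mtrace (X \<alpha> - T \<alpha> f))"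
      using hbar_pos[of \<alpha>] by (simp add: norm_mult)
    also have "\<dots> \<le> 2 * pi * hbar (N \<alpha>) * (real (N \<alpha>) * op_norm (X \<alpha> - T \<alpha> f))"
      using hbar_pos[of \<alpha>] f by (intro mult_left_mono cmod_mtrace_le minus_carrier_mat) auto
    also have "\<dots> = 2 * pi * (real (N \<alpha>) * hbar (N \<alpha>)) * op_norm (X \<alpha> - T \<alpha> f)" by simp
    also have "\<dots> \<le> 2 * pi * B * op_norm (X \<alpha> - T \<alpha> f)"
      using B by (intro mult_right_mono mult_left_mono) auto
    finally show ?thesis .
  qed
  have "(\<lambda>\<alpha>. op_norm (X \<alpha> - T \<alpha> f)) \<longlonglongrightarrow> 0" using X unfolding matrix_seq_converges_def by blast
  then have "(\<lambda>\<alpha>. (2 * pi * B) * op_norm (X \<alpha> - T \<alpha> f)) \<longlonglongrightarrow> 0" by (rule tendsto_mult_right_zero)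
  then have "(\<lambda>\<alpha>. ?c \<alpha> * mtrace (X \<alpha> - T \<alpha> f)) \<longlonglongrightarrow> 0"
    by (rule Lim_null_comparison[rotated]) (intro always_eventually allI bound)
  from tendsto_add[OF this trace_T_limit[OF f]] show ?thesis
    using mtrace_diff[OF Xc T_carrier[OF f]] by (simp add: algebra_simps)
qed

text \<open>Linearity is inherited from \<open>T\<close> and the trace by uniqueness of limits,
  rather than from the dissection in the definition of the integral.\<close>

lemma form_integral_linear:
  assumes f: "f \<in> smooth_fun \<Sigma>" and h: "h \<in> smooth_fun \<Sigma>"
  shows "form_integral \<Sigma> \<omega> (\<lambda>x. a * f x + b * h x) = a * form_integral \<Sigma> \<omega> f + b * form_integral \<Sigma> \<omega> h"
proof -
  let ?c = "\<lambda>\<alpha>. complex_of_real (2 * pi * hbar (N \<alpha>))"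
  have fh: "(\<lambda>x. a * f x + b * h x) \<in> smooth_fun \<Sigma>"
    by (intro smooth_fun_add smooth_fun_cmult f h)
  have "?c \<alpha> * mtrace (T \<alpha> (\<lambda>x. a * f x + b * h x))
      = complex_of_real a * (?c \<alpha> * mtrace (T \<alpha> f)) + complex_of_real b * (?c \<alpha> * mtrace (T \<alpha> h))" for \<alpha>
    unfolding T_linear[OF f h]
    using T_carrier[OF f, of \<alpha>] T_carrier[OF h, of \<alpha>]
    by (simp add: mtrace_add[of _ "N \<alpha>"] mtrace_smult[of _ "N \<alpha>"] algebra_simps)
  then have "(\<lambda>\<alpha>. ?c \<alpha> * mtrace (T \<alpha> (\<lambda>x. a * f x + b * h x)))
      \<longlonglongrightarrow> complex_of_real a * form_integral \<Sigma> \<omega> f + complex_of_real b * form_integral \<Sigma> \<omega> h"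
    using trace_T_limit[OF f] trace_T_limit[OF h] by (simp add: tendsto_intros)
  from LIMSEQ_unique[OF this trace_T_limit[OF fh]]
  have "complex_of_real (a * form_integral \<Sigma> \<omega> f + b * form_integral \<Sigma> \<omega> h)
    = complex_of_real (form_integral \<Sigma> \<omega> (\<lambda>x. a * f x + b * h x))" by simp
  then show ?thesis unfolding of_real_eq_iff by simp
qed

lemma form_integral_add:
  assumes "f \<in> smooth_fun \<Sigma>" "h \<in> smooth_fun \<Sigma>"
  shows "form_integral \<Sigma> \<omega> (\<lambda>x. f x + h x) = form_integral \<Sigma> \<omega> f + form_integral \<Sigma> \<omega> h"
  using form_integral_linear[OF assms, of 1 1] by simp

lemma form_integral_sum:
  assumes "\<And>i. i \<in> I \<Longrightarrow> f i \<in> smooth_fun \<Sigma>"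
  shows "form_integral \<Sigma> \<omega> (\<lambda>x. \<Sum>i\<in>I. f i x) = (\<Sum>i\<in>I. form_integral \<Sigma> \<omega> (f i))"
proof -
  have z: "form_integral \<Sigma> \<omega> (\<lambda>x. 0) = 0"
    using form_integral_linear[OF smooth_fun_zero smooth_fun_zero, of 0 0] by simp
  show ?thesis using assms
    by (induction I rule: infinite_finite_induct) (simp_all add: z form_integral_add smooth_fun_sum)
qed

lemma tends_deriv_mat:
  assumes X: "matrix_seq_Ck_converges 2 \<Sigma> \<omega> N T hbar X f" and h: "h \<in> smooth_fun \<Sigma>"
  shows "tends (\<lambda>\<alpha>. deriv_mat \<alpha> h (X \<alpha>)) (bracket f h)"
proof -
  have Xf: "tends X f" using X unfolding matrix_seq_Ck_converges_def by blast
  have "(\<lambda>\<alpha>. op_norm (iter_commutator (T \<alpha>) (hbar (N \<alpha>)) [h] (X \<alpha>) - T \<alpha> (iter_bracket \<Sigma> \<omega> [h] f))) \<longlonglongrightarrow> 0"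
    using X h unfolding matrix_seq_Ck_converges_def by (elim conjE allE[of _ "[h]"]) simp
  then have "(\<lambda>\<alpha>. op_norm (deriv_mat \<alpha> h (X \<alpha>) - T \<alpha> (bracket f h))) \<longlonglongrightarrow> 0"
    by (simp add: iter_commutator_def iter_bracket_def)
  then show ?thesis
    unfolding matrix_seq_converges_def
    using poisson_bracket_smooth[OF surface symplectic tends_smooth[OF Xf] h] tends_carrier[OF Xf] h
    by (auto intro!: commutator_carrier)
qed

lemma T_Ck_converges:
  assumes f: "f \<in> smooth_fun \<Sigma>"
  shows "matrix_seq_Ck_converges 2 \<Sigma> \<omega> N T hbar (\<lambda>\<alpha>. T \<alpha> f) f"
  unfolding matrix_seq_Ck_converges_def using tends_T[OF f] regularization f
  unfolding Ck_matrix_regularization_def by blast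

text \<open>The trace of a commutator vanishes: this replaces Stokes' theorem.\<close>

lemma form_integral_bracket:
  assumes f: "f \<in> smooth_fun \<Sigma>" and h: "h \<in> smooth_fun \<Sigma>"
  shows "form_integral \<Sigma> \<omega> (bracket f h) = 0"
proof -
  note * = tends_trace[OF tends_deriv_mat[OF T_Ck_converges[OF f] h]]
  have "mtrace (deriv_mat \<alpha> h (T \<alpha> f)) = 0" for \<alpha>
    using T_carrier[OF f, of \<alpha>] T_carrier[OF h, of \<alpha>]
    by (simp add: mtrace_smult[of _ "N \<alpha>"] mtrace_commutator[of _ "N \<alpha>"])
  with * have "(\<lambda>\<alpha>::nat. 0 :: complex) \<longlonglongrightarrow> complex_of_real (form_integral \<Sigma> \<omega> (bracket f h))" by simp
  from LIMSEQ_unique[OF this tendsto_const] show ?thesis by simp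
qed

text \<open>The bracket of the product of \<open>f\<close> and \<open>k\<close> with
  \<open>h\<close> has integral zero; the Leibniz rule splits it into the two terms.\<close>

lemma form_integral_by_parts:
  assumes f: "f \<in> smooth_fun \<Sigma>" and k: "k \<in> smooth_fun \<Sigma>" and h: "h \<in> smooth_fun \<Sigma>"
  shows "form_integral \<Sigma> \<omega> (\<lambda>x. bracket f h x * k x) = - form_integral \<Sigma> \<omega> (\<lambda>x. f x * bracket k h x)"
proof -
  note s = poisson_bracket_smooth[OF surface symplectic]
  have "form_integral \<Sigma> \<omega> (\<lambda>x. f x * bracket k h x + bracket f h x * k x) = 0"
    using form_integral_bracket[OF smooth_fun_mult[OF f k] h]
    unfolding poisson_bracket_mult[OF surface symplectic f k h] .
  then show ?thesis using form_integral_add[OF smooth_fun_mult[OF f s[OF k h]] smooth_fun_mult[OF s[OF f h] k]] by simp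
qed

text \<open>Conjugating a positive semidefinite matrix by the hermitian matrix
  \<open>T \<alpha> h\<close> leaves a nonnegative trace, and this sign survives in the limit. An
  operator inequality thus becomes an inequality of integrals with a square as weight.\<close>

lemma form_integral_semidefinite:
  assumes K: "tends Khat K" and psd: "\<And>\<alpha>. \<alpha> > \<alpha>\<^sub>0 \<Longrightarrow> pos_semidef (Khat \<alpha> - complex_of_real \<kappa> \<cdot>\<^sub>m 1\<^sub>m (N \<alpha>))"
    and h: "h \<in> smooth_fun \<Sigma>"
  shows "\<kappa> * form_integral \<Sigma> \<omega> (\<lambda>x. h x * h x) \<le> form_integral \<Sigma> \<omega> (\<lambda>x. h x * (K x * h x))"
proof -
  let ?c = "\<lambda>\<alpha>. complex_of_real (2 * pi * hbar (N \<alpha>))"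
  let ?T = "\<lambda>\<alpha>. T \<alpha> h"
  note Kc = tends_carrier[OF K]
  have 1: "(\<lambda>\<alpha>. ?c \<alpha> * mtrace (?T \<alpha> * (Khat \<alpha> * ?T \<alpha>))) \<longlonglongrightarrow> form_integral \<Sigma> \<omega> (\<lambda>x. h x * (K x * h x))"
    by (intro tends_trace tends_mult tends_T K h)
  have 2: "(\<lambda>\<alpha>. ?c \<alpha> * mtrace (?T \<alpha> * ?T \<alpha>)) \<longlonglongrightarrow> form_integral \<Sigma> \<omega> (\<lambda>x. h x * h x)"
    by (intro tends_trace tends_mult tends_T h)
  have lim: "(\<lambda>\<alpha>. Re (?c \<alpha> * mtrace (?T \<alpha> * (Khat \<alpha> * ?T \<alpha>)) - complex_of_real \<kappa> * (?c \<alpha> * mtrace (?T \<alpha> * ?T \<alpha>))))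
    \<longlonglongrightarrow> Re (complex_of_real (form_integral \<Sigma> \<omega> (\<lambda>x. h x * (K x * h x))) - complex_of_real \<kappa> * form_integral \<Sigma> \<omega> (\<lambda>x. h x * h x))"
    by (intro tendsto_Re tendsto_diff tendsto_mult_left 1 2)
  have "0 \<le> Re (?c \<alpha> * mtrace (?T \<alpha> * (Khat \<alpha> * ?T \<alpha>)) - complex_of_real \<kappa> * (?c \<alpha> * mtrace (?T \<alpha> * ?T \<alpha>)))"
    if "\<alpha> > \<alpha>\<^sub>0" for \<alpha>
  proof -
    let ?n = "N \<alpha>"
    let ?P = "Khat \<alpha> - complex_of_real \<kappa> \<cdot>\<^sub>m 1\<^sub>m ?n"
    note cs = Kc[of \<alpha>] T_carrier[OF h, of \<alpha>]
    have "?T \<alpha> * (?P * ?T \<alpha>) = ?T \<alpha> * (Khat \<alpha> * ?T \<alpha>) - complex_of_real \<kappa> \<cdot>\<^sub>m (?T \<alpha> * ?T \<alpha>)"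
    proof -
      have "?P * ?T \<alpha> = Khat \<alpha> * ?T \<alpha> - complex_of_real \<kappa> \<cdot>\<^sub>m ?T \<alpha>"
        using cs by (simp add: minus_mult_distrib_mat[of _ ?n ?n] mult_smult_assoc_mat[of _ ?n ?n])
      also have "?T \<alpha> * \<dots> = ?T \<alpha> * (Khat \<alpha> * ?T \<alpha>) - ?T \<alpha> * (complex_of_real \<kappa> \<cdot>\<^sub>m ?T \<alpha>)"
        using cs by (intro mult_minus_distrib_mat[of _ ?n ?n _ ?n]) auto
      finally show ?thesis using cs by (simp add: mult_smult_distrib[of _ ?n ?n])
    qed
    then have "mtrace (?T \<alpha> * (?P * ?T \<alpha>)) = mtrace (?T \<alpha> * (Khat \<alpha> * ?T \<alpha>)) - complex_of_real \<kappa> * mtrace (?T \<alpha> * ?T \<alpha>)"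
      using cs by (simp add: mtrace_diff[of _ ?n] mtrace_smult[of _ ?n])
    moreover have "0 \<le> Re (mtrace (?T \<alpha> * (?P * ?T \<alpha>)))"
      using cs by (intro Re_mtrace_hermitian_conj_nonneg[of _ ?n] T_adjoint h psd that minus_carrier_mat) auto
    ultimately have "0 \<le> Re (mtrace (?T \<alpha> * (Khat \<alpha> * ?T \<alpha>)) - complex_of_real \<kappa> * mtrace (?T \<alpha> * ?T \<alpha>))" by simp
    then have "0 \<le> (2 * pi * hbar ?n) * Re (mtrace (?T \<alpha> * (Khat \<alpha> * ?T \<alpha>)) - complex_of_real \<kappa> * mtrace (?T \<alpha> * ?T \<alpha>))"
      using hbar_pos[of \<alpha>] by (intro mult_nonneg_nonneg) auto
    also have "\<dots> = Re (?c \<alpha> * (mtrace (?T \<alpha> * (Khat \<alpha> * ?T \<alpha>)) - complex_of_real \<kappa> * mtrace (?T \<alpha> * ?T \<alpha>)))"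
      by simp
    also have "?c \<alpha> * (mtrace (?T \<alpha> * (Khat \<alpha> * ?T \<alpha>)) - complex_of_real \<kappa> * mtrace (?T \<alpha> * ?T \<alpha>))
      = ?c \<alpha> * mtrace (?T \<alpha> * (Khat \<alpha> * ?T \<alpha>)) - complex_of_real \<kappa> * (?c \<alpha> * mtrace (?T \<alpha> * ?T \<alpha>))"
      by (simp only: right_diff_distrib mult.left_commute)
    finally show ?thesis .
  qed
  then have "0 \<le> Re (complex_of_real (form_integral \<Sigma> \<omega> (\<lambda>x. h x * (K x * h x))) - complex_of_real \<kappa> * form_integral \<Sigma> \<omega> (\<lambda>x. h x * h x))"
    by (intro LIMSEQ_le_const[OF lim] exI[of _ "Suc \<alpha>\<^sub>0"]) auto
  then show ?thesis by simp
qed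

text \<open>Multiplying the eigenvalue equation by \<open>T k\<close> and by the inverse of \<open>ginv\<close> and taking traces
  moves one of the two commutators onto \<open>T k\<close>, so that no commutator of \<open>ginv\<close> has to converge.\<close>

lemma weak_eigenvalue_equation:
  assumes g: "tends \<gamma>hat \<gamma>" and inv: "\<And>\<alpha>. inverts_mat (\<gamma>hat \<alpha>) (ginv \<alpha>)"
    and gi: "tends ginv \<gamma>'"
    and eig: "\<And>\<alpha>. discrete_laplacian \<Sigma> N T hbar ginv \<alpha> (X \<alpha>) = - lam \<alpha> \<cdot>\<^sub>m X \<alpha>"
    and lam: "lam \<longlonglongrightarrow> l"
    and X: "matrix_seq_Ck_converges 2 \<Sigma> \<omega> N T hbar X u"
    and k: "k \<in> smooth_fun \<Sigma>"
  shows "l * form_integral \<Sigma> \<omega> (\<lambda>x. k x * (\<gamma> x * u x))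
    = (\<Sum>j\<in>UNIV. form_integral \<Sigma> \<omega> (\<lambda>x. bracket k (coord_fun \<Sigma> j) x * (\<gamma>' x * bracket u (coord_fun \<Sigma> j) x)))"
proof -
  let ?c = "\<lambda>\<alpha>. complex_of_real (2 * pi * hbar (N \<alpha>))"
  let ?x = "coord_fun \<Sigma>"
  have Xu: "tends X u" using X unfolding matrix_seq_Ck_converges_def by blast
  note gc = tends_carrier[OF g] and gic = tends_carrier[OF gi] and Xc = tends_carrier[OF Xu]
  \<comment> \<open>The integration by parts is exact at every finite stage; limits are taken only
    afterwards.\<close>
  have eq: "lam \<alpha> * mtrace (T \<alpha> k * (\<gamma>hat \<alpha> * X \<alpha>))
      = (\<Sum>j\<in>UNIV. mtrace (deriv_mat \<alpha> (?x j) (T \<alpha> k) * (ginv \<alpha> * deriv_mat \<alpha> (?x j) (X \<alpha>))))" for \<alpha>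
  proof -
    let ?n = "N \<alpha>"
    let ?h = "complex_of_real (hbar ?n)"
    define C where "C j Y = commutator Y (T \<alpha> (?x j))" for j Y
    note cs = gc[of \<alpha>] gic[of \<alpha>] Xc[of \<alpha>] T_carrier[OF k, of \<alpha>] T_carrier[OF coord_fun_smooth, of \<alpha>]
    have Cc: "C j Y \<in> carrier_mat ?n ?n" if "Y \<in> carrier_mat ?n ?n" for j Y
      unfolding C_def using that cs by (intro commutator_carrier) auto
    have M: "ginv \<alpha> * C j (ginv \<alpha> * C j (X \<alpha>)) \<in> carrier_mat ?n ?n" for j
      using cs by (intro mult_carrier_mat[of _ _ ?n] Cc) auto
    have one: "\<gamma>hat \<alpha> * ginv \<alpha> = 1\<^sub>m ?n" using inv[of \<alpha>] cs unfolding inverts_mat_def by simp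
    let ?S = "Matrix.mat ?n ?n (\<lambda>rc. \<Sum>j\<in>UNIV. (ginv \<alpha> * C j (ginv \<alpha> * C j (X \<alpha>))) $$ rc)"
    have L: "complex_of_real (- 1 / (hbar ?n)\<^sup>2) \<cdot>\<^sub>m ?S = - lam \<alpha> \<cdot>\<^sub>m X \<alpha>"
      using eig[of \<alpha>] unfolding discrete_laplacian_def Let_def C_def .
    \<comment> \<open>The matrix \<open>\<gamma>hat \<alpha>\<close> cancels the outer factor
      \<open>ginv \<alpha>\<close> of the discrete Laplacian, which exposes the outer commutator to
      the cyclicity of the trace.\<close>
    have red: "T \<alpha> k * \<gamma>hat \<alpha> * (ginv \<alpha> * Z) = T \<alpha> k * Z" if Z: "Z \<in> carrier_mat ?n ?n" for Z
    proof -
      have "T \<alpha> k * \<gamma>hat \<alpha> * (ginv \<alpha> * Z) = T \<alpha> k * ((\<gamma>hat \<alpha> * ginv \<alpha>) * Z)"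
        using cs Z by (simp add: assoc_mult_mat[of _ ?n ?n _ ?n _ ?n])
      then show ?thesis unfolding one using Z by simp
    qed
    have "mtrace ((T \<alpha> k * \<gamma>hat \<alpha>) * ?S) = (\<Sum>j\<in>UNIV. mtrace ((T \<alpha> k * \<gamma>hat \<alpha>) * (ginv \<alpha> * C j (ginv \<alpha> * C j (X \<alpha>)))))"
      using cs M by (intro mtrace_mult_mat_sum) auto
    also have "\<dots> = (\<Sum>j\<in>UNIV. - mtrace (C j (T \<alpha> k) * (ginv \<alpha> * C j (X \<alpha>))))"
    proof (intro sum.cong refl)
      fix j
      have Z: "ginv \<alpha> * C j (X \<alpha>) \<in> carrier_mat ?n ?n" using cs by (intro mult_carrier_mat[of _ _ ?n] Cc) auto
      have "mtrace ((T \<alpha> k * \<gamma>hat \<alpha>) * (ginv \<alpha> * C j (ginv \<alpha> * C j (X \<alpha>)))) = mtrace (T \<alpha> k * C j (ginv \<alpha> * C j (X \<alpha>)))"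
        using red[OF Cc[OF Z]] by simp
      also have "\<dots> = - mtrace (C j (T \<alpha> k) * (ginv \<alpha> * C j (X \<alpha>)))"
        using mtrace_mult_commutator[OF cs(4) Z cs(5)] unfolding C_def .
      finally show "mtrace ((T \<alpha> k * \<gamma>hat \<alpha>) * (ginv \<alpha> * C j (ginv \<alpha> * C j (X \<alpha>)))) = - mtrace (C j (T \<alpha> k) * (ginv \<alpha> * C j (X \<alpha>)))" .
    qed
    finally have tr: "mtrace ((T \<alpha> k * \<gamma>hat \<alpha>) * ?S) = (\<Sum>j\<in>UNIV. - mtrace (C j (T \<alpha> k) * (ginv \<alpha> * C j (X \<alpha>))))" .
    have "- lam \<alpha> * mtrace (T \<alpha> k * (\<gamma>hat \<alpha> * X \<alpha>)) = mtrace ((T \<alpha> k * \<gamma>hat \<alpha>) * (- lam \<alpha> \<cdot>\<^sub>m X \<alpha>))"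
    proof -
      have "(T \<alpha> k * \<gamma>hat \<alpha>) * (- lam \<alpha> \<cdot>\<^sub>m X \<alpha>) = - lam \<alpha> \<cdot>\<^sub>m (T \<alpha> k * (\<gamma>hat \<alpha> * X \<alpha>))"
        using cs by (simp add: mult_smult_distrib[of _ ?n ?n] assoc_mult_mat[of _ ?n ?n _ ?n _ ?n])
      then show ?thesis using cs by (simp add: mtrace_smult[of _ ?n])
    qed
    also have "\<dots> = complex_of_real (- 1 / (hbar ?n)\<^sup>2) * mtrace ((T \<alpha> k * \<gamma>hat \<alpha>) * ?S)"
    proof -
      have A: "T \<alpha> k * \<gamma>hat \<alpha> \<in> carrier_mat ?n ?n" and B: "?S \<in> carrier_mat ?n ?n" using cs by auto
      show ?thesis
        unfolding L[symmetric] mult_smult_distrib[OF A B] mtrace_smult[OF mult_carrier_mat[OF A B]] ..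
    qed
    also have "\<dots> = - (\<Sum>j\<in>UNIV. (1 / (\<i> * ?h)) * (1 / (\<i> * ?h)) * mtrace (C j (T \<alpha> k) * (ginv \<alpha> * C j (X \<alpha>))))"
    proof -
      \<comment> \<open>The prefactor -1/hbar^2 is the square of 1/(i hbar), so each of the two
        commutators receives the normalisation of \<open>deriv_mat\<close>.\<close>
      have "(\<i> * ?h)\<^sup>2 = - ?h\<^sup>2" by (simp add: power_mult_distrib)
      then have "complex_of_real (- 1 / (hbar ?n)\<^sup>2) = 1 / (\<i> * ?h)\<^sup>2" by simp
      then have c: "complex_of_real (- 1 / (hbar ?n)\<^sup>2) = (1 / (\<i> * ?h)) * (1 / (\<i> * ?h))"
        by (simp add: power2_eq_square)
      show ?thesis unfolding tr c by (simp only: sum_negf sum_distrib_left mult_minus_right)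
    qed
    also have "\<dots> = - (\<Sum>j\<in>UNIV. mtrace (deriv_mat \<alpha> (?x j) (T \<alpha> k) * (ginv \<alpha> * deriv_mat \<alpha> (?x j) (X \<alpha>))))"
    proof (intro arg_cong[of _ _ uminus] sum.cong refl)
      fix j
      let ?a = "1 / (\<i> * ?h)"
      note C1 = Cc[OF cs(4), of j] and C2 = Cc[OF cs(3), of j]
      have Z: "ginv \<alpha> * C j (X \<alpha>) \<in> carrier_mat ?n ?n" using C2 cs by (intro mult_carrier_mat[of _ _ ?n]) auto
      have "(?a \<cdot>\<^sub>m C j (T \<alpha> k)) * (ginv \<alpha> * (?a \<cdot>\<^sub>m C j (X \<alpha>))) = ?a \<cdot>\<^sub>m (?a \<cdot>\<^sub>m (C j (T \<alpha> k) * (ginv \<alpha> * C j (X \<alpha>))))"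
        unfolding mult_smult_distrib[OF cs(2) C2] mult_smult_assoc_mat[OF C1 smult_carrier_mat[OF Z]]
          mult_smult_distrib[OF C1 Z] ..
      moreover have "mtrace (?a \<cdot>\<^sub>m (?a \<cdot>\<^sub>m (C j (T \<alpha> k) * (ginv \<alpha> * C j (X \<alpha>)))))
        = ?a * ?a * mtrace (C j (T \<alpha> k) * (ginv \<alpha> * C j (X \<alpha>)))"
        unfolding mtrace_smult[OF smult_carrier_mat[OF mult_carrier_mat[OF C1 Z]]] mtrace_smult[OF mult_carrier_mat[OF C1 Z]]
        by simp
      ultimately show "?a * ?a * mtrace (C j (T \<alpha> k) * (ginv \<alpha> * C j (X \<alpha>))) = mtrace (deriv_mat \<alpha> (?x j) (T \<alpha> k) * (ginv \<alpha> * deriv_mat \<alpha> (?x j) (X \<alpha>)))"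
        unfolding C_def by simp
    qed
    finally show ?thesis by simp
  qed
  have "(\<lambda>\<alpha>. lam \<alpha> * (?c \<alpha> * mtrace (T \<alpha> k * (\<gamma>hat \<alpha> * X \<alpha>))))
      \<longlonglongrightarrow> l * form_integral \<Sigma> \<omega> (\<lambda>x. k x * (\<gamma> x * u x))"
    by (intro tendsto_mult lam tends_trace tends_mult tends_T k g Xu)
  moreover have "(\<lambda>\<alpha>. \<Sum>j\<in>UNIV. ?c \<alpha> * mtrace (deriv_mat \<alpha> (?x j) (T \<alpha> k) * (ginv \<alpha> * deriv_mat \<alpha> (?x j) (X \<alpha>))))
      \<longlonglongrightarrow> (\<Sum>j\<in>UNIV. complex_of_real (form_integral \<Sigma> \<omega> (\<lambda>x. bracket k (?x j) x * (\<gamma>' x * bracket u (?x j) x))))"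
    by (intro tendsto_sum tends_trace tends_mult tends_deriv_mat T_Ck_converges k gi X coord_fun_smooth)
  moreover have "lam \<alpha> * (?c \<alpha> * mtrace (T \<alpha> k * (\<gamma>hat \<alpha> * X \<alpha>)))
      = (\<Sum>j\<in>UNIV. ?c \<alpha> * mtrace (deriv_mat \<alpha> (?x j) (T \<alpha> k) * (ginv \<alpha> * deriv_mat \<alpha> (?x j) (X \<alpha>))))" for \<alpha>
    using eq[of \<alpha>] by (simp add: mult.left_commute flip: sum_distrib_left)
  ultimately show ?thesis using LIMSEQ_unique by simp
qed

end

section \<open>The eigenvalue bound\<close>

context matrix_regularization
begin

lemma eigenvalue_limit_bound:
  assumes \<gamma>: "tends \<gamma>hat (gamma_fun \<Sigma> \<omega>)" and inv: "\<And>\<alpha>. inverts_mat (\<gamma>hat \<alpha>) (\<gamma>inv \<alpha>)"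
    and \<gamma>': "tends \<gamma>inv (\<lambda>x. 1 / gamma_fun \<Sigma> \<omega> x)"
    and K: "tends Khat (gauss_curvature \<Sigma> \<omega>)"
    and psd: "\<And>\<alpha>. \<alpha> > \<alpha>\<^sub>0 \<Longrightarrow> pos_semidef (Khat \<alpha> - complex_of_real \<kappa> \<cdot>\<^sub>m 1\<^sub>m (N \<alpha>))"
    and eig: "\<And>\<alpha>. discrete_laplacian \<Sigma> N T hbar \<gamma>inv \<alpha> (uhat \<alpha>) = - lam \<alpha> \<cdot>\<^sub>m uhat \<alpha>"
    and lam: "lam \<longlonglongrightarrow> l"
    and uhat: "matrix_seq_Ck_converges 2 \<Sigma> \<omega> N T hbar uhat u"
    and nontriv: "p \<in> \<Sigma>" "u p \<noteq> 0"
    and nz: "\<kappa> > 0 \<Longrightarrow> l \<noteq> 0"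
  shows "l \<in> \<real> \<and> Re l \<ge> 2 * \<kappa>"
proof -
  let ?\<gamma> = "gamma_fun \<Sigma> \<omega>" and ?K = "gauss_curvature \<Sigma> \<omega>" and ?I = "form_integral \<Sigma> \<omega>" and ?x = "coord_fun \<Sigma>"
  define V where "V = rot_grad \<Sigma> \<omega> u"
  define G where "G = grad \<Sigma> \<omega> u"
  define w where "w = laplace \<Sigma> \<omega> u"
  have u: "u \<in> smooth_fun \<Sigma>" using uhat tends_smooth unfolding matrix_seq_Ck_converges_def by blast
  note gs = tends_smooth[OF \<gamma>] and gis = tends_smooth[OF \<gamma>'] and Ks = tends_smooth[OF K]
  have Vs: "V k \<in> smooth_fun \<Sigma>" for k unfolding V_def by (rule rot_grad_smooth[OF surface symplectic gis u])
  have Gs: "G k \<in> smooth_fun \<Sigma>" for k unfolding G_def by (rule grad_smooth[OF surface symplectic gis u])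
  have ws: "w \<in> smooth_fun \<Sigma>" unfolding w_def by (rule laplace_smooth[OF surface symplectic gis u])
  note bs = poisson_bracket_smooth[OF surface symplectic] and cs = coord_fun_smooth[of \<Sigma>]
  have gpos: "?\<gamma> x > 0" if "x \<in> \<Sigma>" for x using gamma_fun_pos[OF surface symplectic that] .
  have bV: "bracket f (?x k) x = ?\<gamma> x * rot_grad \<Sigma> \<omega> f k x" for f k x
    using gpos[of x] by (cases "x \<in> \<Sigma>") (auto simp: rot_grad_def poisson_bracket_def)
  have weak: "l * ?I (\<lambda>x. k x * (?\<gamma> x * u x)) = (\<Sum>j\<in>UNIV. ?I (\<lambda>x. bracket k (?x j) x * V j x))"
    if k: "k \<in> smooth_fun \<Sigma>" for k
    using weak_eigenvalue_equation[OF \<gamma> inv \<gamma>' eig lam uhat k] unfolding V_def rot_grad_def .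
  \<comment> \<open>The classical integration by parts for the same sum. Together with
    \<open>weak\<close> it says that the limit function satisfies the eigenvalue equation for
    \<open>laplace\<close> when tested against \<open>k\<close>.\<close>
  have green: "(\<Sum>j\<in>UNIV. ?I (\<lambda>x. bracket k (?x j) x * V j x)) = - ?I (\<lambda>x. k x * (?\<gamma> x * w x))"
    if k: "k \<in> smooth_fun \<Sigma>" for k
  proof -
    have "(\<Sum>j\<in>UNIV. ?I (\<lambda>x. bracket k (?x j) x * V j x)) = (\<Sum>j\<in>UNIV. - ?I (\<lambda>x. k x * bracket (V j) (?x j) x))"
      by (intro sum.cong refl form_integral_by_parts k Vs cs)
    also have "\<dots> = - ?I (\<lambda>x. \<Sum>j\<in>UNIV. k x * bracket (V j) (?x j) x)"
      by (subst form_integral_sum) (auto intro!: smooth_fun_mult k bs Vs cs simp: sum_negf)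
    also have "(\<lambda>x. \<Sum>j\<in>UNIV. k x * bracket (V j) (?x j) x) = (\<lambda>x. k x * (?\<gamma> x * w x))"
      unfolding bV w_def laplace_def V_def by (simp add: sum_distrib_left)
    finally show ?thesis .
  qed
  \<comment> \<open>\<open>A\<close>, \<open>B\<close> and \<open>C\<close> are the weighted
    integrals of the squares of u, of its gradient and of its Laplacian. Testing with
    \<open>u\<close> gives \<open>l * A = B\<close>; testing with \<open>w\<close> will give
    \<open>C = r * B\<close>.\<close>
  define A where "A = ?I (\<lambda>x. u x * (?\<gamma> x * u x))"
  define B where "B = ?I (\<lambda>x. \<Sum>k\<in>UNIV. ?\<gamma> x * (V k x * V k x))"
  define C where "C = ?I (\<lambda>x. w x * (?\<gamma> x * w x))"
  have "(\<Sum>j\<in>UNIV. ?I (\<lambda>x. bracket u (?x j) x * V j x)) = ?I (\<lambda>x. \<Sum>j\<in>UNIV. bracket u (?x j) x * V j x)"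
    by (subst form_integral_sum) (auto intro!: smooth_fun_mult u bs Vs cs)
  also have "\<dots> = B" unfolding B_def bV V_def by (simp add: mult.assoc)
  finally have "(\<Sum>j\<in>UNIV. ?I (\<lambda>x. bracket u (?x j) x * V j x)) = B" .
  then have lA: "l * A = B" and uw: "- ?I (\<lambda>x. u x * (?\<gamma> x * w x)) = B"
    using weak[OF u] green[OF u] unfolding A_def by simp_all
  have A: "A > 0"
  proof -
    have pos: "u x * (?\<gamma> x * u x) \<ge> 0" if "x \<in> \<Sigma>" for x
    proof -
      have eq: "u x * (?\<gamma> x * u x) = ?\<gamma> x * (u x)\<^sup>2" by (simp add: power2_eq_square)
      show ?thesis unfolding eq using gpos[OF that] by simp
    qed
    have "A \<noteq> 0"
    proof
      assume "A = 0"
      then have "u p * (?\<gamma> p * u p) = 0" unfolding A_def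
        by (intro form_integral_eq_0_imp[OF surface symplectic smooth_fun_mult[OF u smooth_fun_mult[OF gs u]] pos _ nontriv(1)])
      then show False using nontriv gpos[OF nontriv(1)] by simp
    qed
    moreover have "A \<ge> 0" unfolding A_def by (rule form_integral_nonneg[OF surface symplectic pos])
    ultimately show ?thesis by simp
  qed
  have B: "B \<ge> 0" unfolding B_def
    by (intro form_integral_nonneg[OF surface symplectic] sum_nonneg) (simp add: less_imp_le gpos)
  define r where "r = B / A"
  have "l = complex_of_real B / complex_of_real A"
    using lA A by (simp add: nonzero_eq_divide_eq)
  then have l: "l = complex_of_real r" by (simp add: r_def)
  have rA: "B = r * A" using A by (simp add: r_def)
  have C: "C = r * B"
  proof -
    have "complex_of_real (r * ?I (\<lambda>x. w x * (?\<gamma> x * u x))) = complex_of_real (- C)"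
      using weak[OF ws] green[OF ws] unfolding l C_def by simp
    then have "r * ?I (\<lambda>x. w x * (?\<gamma> x * u x)) = - C" unfolding of_real_eq_iff .
    moreover have "(\<lambda>x. w x * (?\<gamma> x * u x)) = (\<lambda>x. u x * (?\<gamma> x * w x))" by (simp add: mult_ac)
    ultimately have "r * ?I (\<lambda>x. u x * (?\<gamma> x * w x)) = - C" by simp
    then show ?thesis using uw by (simp flip: uw)
  qed
  \<comment> \<open>\<open>form_integral_semidefinite\<close> produces integrals weighted by
    squares, so the density factor is split into two square roots. Its positivity on the surface
    keeps the root smooth.\<close>
  define h where "h k x = sqrt (?\<gamma> x) * V k x" for k x
  have hs: "h k \<in> smooth_fun \<Sigma>" for k
    unfolding h_def[abs_def] by (intro smooth_fun_mult smooth_fun_sqrt gs gpos Vs)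
  have hh: "h k x * h k x = ?\<gamma> x * (V k x * V k x)" for k x
    using gpos[of x] smooth_fun_outside[OF Vs, of x k] by (cases "x \<in> \<Sigma>") (auto simp: h_def mult_ac)
  have hKh: "h k x * (?K x * h k x) = ?\<gamma> x * (?K x * (V k x)\<^sup>2)" for k x
    using hh[of k x] by (simp add: power2_eq_square mult_ac)
  have "\<kappa> * B = (\<Sum>k\<in>UNIV. \<kappa> * ?I (\<lambda>x. h k x * h k x))"
    unfolding B_def hh by (subst form_integral_sum) (auto intro!: smooth_fun_mult gs Vs simp: sum_distrib_left)
  also have "\<dots> \<le> (\<Sum>k\<in>UNIV. ?I (\<lambda>x. h k x * (?K x * h k x)))"
    by (intro sum_mono form_integral_semidefinite[OF K psd hs])
  also have "\<dots> = ?I (\<lambda>x. \<Sum>k\<in>UNIV. h k x * (?K x * h k x))"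
    by (subst form_integral_sum) (auto intro!: smooth_fun_mult hs Ks)
  also have "\<dots> \<le> C / 2"
  proof -
    let ?f = "\<lambda>x. \<Sum>k\<in>UNIV. bracket (G k) (V k) x" and ?g = "\<lambda>x. \<Sum>k\<in>UNIV. h k x * (?K x * h k x)"
      and ?h = "\<lambda>x. w x * (?\<gamma> x * w x)"
    have fs: "?f \<in> smooth_fun \<Sigma>" by (intro smooth_fun_sum bs Gs Vs)
    have gs': "?g \<in> smooth_fun \<Sigma>" by (intro smooth_fun_sum smooth_fun_mult hs Ks)
    have hs': "?h \<in> smooth_fun \<Sigma>" by (intro smooth_fun_mult ws gs)
    have f0: "?I ?f = 0" by (simp add: form_integral_sum bs Gs Vs form_integral_bracket)
    \<comment> \<open>The coefficients 1 and -1 are written out so that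
      \<open>form_integral_linear\<close> can be applied twice. After integration the term
      \<open>?f\<close> disappears, which leaves the comparison of \<open>?g\<close> with half of
      \<open>?h\<close>.\<close>
    have ineq: "0 \<le> 1 * (1 * ?f x + (- 1) * ?g x) + (1/2) * ?h x" if "x \<in> \<Sigma>" for x
    proof -
      have g_eq: "?g x = ?\<gamma> x * (?K x * (\<Sum>k\<in>UNIV. (V k x)\<^sup>2))" unfolding hKh by (simp add: sum_distrib_left)
      have h_eq: "?h x = ?\<gamma> x * (w x)\<^sup>2" by (simp add: power2_eq_square)
      show ?thesis
        unfolding g_eq h_eq using curvature_inequality[OF surface symplectic gis u that, folded V_def G_def w_def]
        by (simp add: right_diff_distrib)
    qed
    have "(\<lambda>x. 1 * ?f x + (- 1) * ?g x) \<in> smooth_fun \<Sigma>"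
      by (intro smooth_fun_add smooth_fun_cmult fs gs')
    then have "?I (\<lambda>x. 1 * (1 * ?f x + (- 1) * ?g x) + (1/2) * ?h x) = 1 * (1 * ?I ?f + (- 1) * ?I ?g) + (1/2) * ?I ?h"
      by (simp only: form_integral_linear fs gs' hs')
    moreover have "0 \<le> ?I (\<lambda>x. 1 * (1 * ?f x + (- 1) * ?g x) + (1/2) * ?h x)"
      by (rule form_integral_nonneg[OF surface symplectic ineq])
    ultimately show ?thesis using f0 unfolding C_def by simp
  qed
  finally have main: "\<kappa> * B \<le> r * B / 2" unfolding C .
  have "2 * \<kappa> \<le> r"
  \<comment> \<open>Without Dirichlet energy the limit of the eigenvalues is 0, which
    \<open>nz\<close> permits only for nonpositive \<kappa>. Otherwise \<open>B\<close> is positive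
    and can be divided out of \<open>main\<close>.\<close>
  proof (cases "B = 0")
    case True
    then have "r = 0" by (simp add: r_def)
    then show ?thesis using nz l by fastforce
  next
    case False
    then show ?thesis using B main by (simp add: field_simps)
  qed
  then show ?thesis by (simp add: l)
qed

end

theorem theorem4p22:
  fixes \<Sigma> :: "(real^'m) set"
    and \<omega> :: "real^'m \<Rightarrow> real^'m \<Rightarrow> real^'m \<Rightarrow> real"
    and N :: "nat \<Rightarrow> nat"
    and T :: "nat \<Rightarrow> (real^'m \<Rightarrow> real) \<Rightarrow> complex Matrix.mat"
    and hbar :: "nat \<Rightarrow> real"
    and \<gamma>hat \<gamma>inv Khat uhat :: "nat \<Rightarrow> complex Matrix.mat"
    and u :: "real^'m \<Rightarrow> real"
    and lam :: "nat \<Rightarrow> complex"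
    and \<kappa> :: real
    and \<alpha>\<^sub>0 :: nat
  assumes "closed_surface \<Sigma>"
    and "symplectic_form \<Sigma> \<omega>"
    and "Ck_matrix_regularization 2 \<Sigma> \<omega> N T hbar"
    and "matrix_seq_Ck_converges 2 \<Sigma> \<omega> N T hbar \<gamma>hat (gamma_fun \<Sigma> \<omega>)"
    and "\<And>\<alpha>. inverts_mat (\<gamma>hat \<alpha>) (\<gamma>inv \<alpha>) \<and> inverts_mat (\<gamma>inv \<alpha>) (\<gamma>hat \<alpha>)"
    and "matrix_seq_converges \<Sigma> N T \<gamma>inv (\<lambda>x. 1 / gamma_fun \<Sigma> \<omega> x)"
    and "discrete_curvature \<Sigma> \<omega> N T Khat"
    and "\<And>\<alpha>. \<alpha> > \<alpha>\<^sub>0 \<Longrightarrow> pos_semidef (Khat \<alpha> - complex_of_real \<kappa> \<cdot>\<^sub>m 1\<^sub>m (N \<alpha>))"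
    and "eigenmatrix_sequence \<Sigma> N T hbar \<gamma>inv uhat (\<lambda>\<alpha>. - lam \<alpha>)"
    and "matrix_seq_Ck_converges 2 \<Sigma> \<omega> N T hbar uhat u"
    and nontrivial_limit: "\<exists>p\<in>\<Sigma>. u p \<noteq> 0"
    and nonzero_eigenvalue: "\<kappa> > 0 \<Longrightarrow> lim lam \<noteq> 0"
  shows "lim lam \<in> \<real> \<and> Re (lim lam) \<ge> 2 * \<kappa>"
proof -
  interpret matrix_regularization \<Sigma> \<omega> N T hbar
    by unfold_locales (use assms(1-3) in auto)
  obtain p where p: "p \<in> \<Sigma>" "u p \<noteq> 0" using nontrivial_limit by blast
  have eig: "discrete_laplacian \<Sigma> N T hbar \<gamma>inv \<alpha> (uhat \<alpha>) = - lam \<alpha> \<cdot>\<^sub>m uhat \<alpha>" for \<alpha>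
    using assms(9) unfolding eigenmatrix_sequence_def by blast
  have "convergent (\<lambda>\<alpha>. - lam \<alpha>)" using assms(9) unfolding eigenmatrix_sequence_def by blast
  then have "lam \<longlonglongrightarrow> lim lam" by (simp add: convergent_minus_iff[symmetric] convergent_LIMSEQ_iff)
  moreover have "tends \<gamma>hat (gamma_fun \<Sigma> \<omega>)" using assms(4) unfolding matrix_seq_Ck_converges_def by blast
  moreover have "inverts_mat (\<gamma>hat \<alpha>) (\<gamma>inv \<alpha>)" for \<alpha> using assms(5) by blast
  moreover have "tends Khat (gauss_curvature \<Sigma> \<omega>)" using assms(7) unfolding discrete_curvature_def .
  ultimately show ?thesis
    using eigenvalue_limit_bound[OF _ _ assms(6) _ assms(8) eig _ assms(10) p nonzero_eigenvalue] by blast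
qed

end
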